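(* If $\nabla$ is an analytic connection on an analytic manifold $M$, then $\widetilde{W}$ is a vector bundle over $M$.
   Context: $M$ is connected. Analytic means real analytic. A connection $\nabla$ on $M$ means a connection on $TM$, not necessarily symmetric. $\pi:W\to M$ is the vector bundle of symmetric elements of $T^*M\otimes T^*M$, with the induced connection, also denoted $\nabla$; $W_x=\pi^{-1}(x)$, and $R:TM\otimes TM\otimes W\to W$ is the curvature tensor of $\nabla$ on $W$. Properties of a subset $W'\subseteq W$: (P1) for each $x\in M$, $W'_x:=W_x\cap W'$ is a linear subspace of $W_x$; (P2) for each $w\in W'$ there are an open neighbourhood $U$ of $\pi(w)$ and a smooth local section $X:U\to W$ with values in $W'$ such that $X(\pi(w))=w$. For $W'$ satisfying P1 and P2, the second fundamental 1-form $\alpha_{W'}:W'\to(W/W')\otimes T^*M$ (quotient taken fibrewise) is the fibrewise linear map sending $w\in W'$ to the class of $(\nabla X)(\pi(w))$ in $(W_{\pi(w)}/W'_{\pi(w)})\otimes T^*_{\pi(w)}M$, where $X$ is a local section with values in $W'$ and $X(\pi(w))=w$. For $V\subseteq W$ satisfying P1, $\mathcal{S}(V)$ is the set of $v\in V$ for which there is a smooth local section $X$ of $W$ near $\pi(v)$ with values in $V$ and $X(\pi(v))=v$. Derived flag: $V^{(0)}=\{w\in W: R(\cdot,\cdot)(w)=0\}$, $W^{(i)}=\mathcal{S}(V^{(i)})$, $V^{(i+1)}=\ker\alpha_{W^{(i)}}=\{w\in W^{(i)}:\alpha_{W^{(i)}}(w)=0\}$. The decreasing sequence $W\supseteq W^{(0)}\supseteq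 W^{(1)}\supseteq\cdots$ stabilizes: for some $k$, $W^{(l)}=W^{(k)}$ for all $l\ge k$. Define $\widetilde{W}=W^{(k)}$. *)

theory Defs
  imports "HOL-Analysis.Analysis" "HOL-Library.Function_Algebras"
begin

text \<open>Families of components form a vector space pointwise; this makes \<open>span\<close> and
  \<open>independent\<close> available for the fibres below.\<close>

instantiation "fun" :: (type, real_vector) real_vector
begin

definition scaleR_fun :: "real \<Rightarrow> ('a \<Rightarrow> 'b) \<Rightarrow> 'a \<Rightarrow> 'b"
  where "scaleR_fun r f = (\<lambda>x. r *\<^sub>R f x)"

instance
  by standard (simp_all add: scaleR_fun_def fun_eq_iff scaleR_add_right scaleR_add_left)

end

subsection \<open>Smooth and real analytic maps\<close>

text \<open>Only used for open domains.\<close>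

primrec Ck_on :: "nat \<Rightarrow> 'a::real_normed_vector set \<Rightarrow> ('a \<Rightarrow> 'b::real_normed_vector) \<Rightarrow> bool"
  where
    "Ck_on 0 S f \<longleftrightarrow> continuous_on S f"
  | "Ck_on (Suc k) S f \<longleftrightarrow>
       (\<forall>p\<in>S. f differentiable (at p)) \<and> (\<forall>h. Ck_on k S (\<lambda>p. frechet_derivative f (at p) h))"

definition smooth_on :: "'a::real_normed_vector set \<Rightarrow> ('a \<Rightarrow> 'b::real_normed_vector) \<Rightarrow> bool"
  where "smooth_on S f \<longleftrightarrow> (\<forall>k. Ck_on k S f)"

text \<open>The multi-index \<open>\<alpha>\<close> ranges over all functions from the finite index type to \<open>nat\<close>.\<close>

definition real_analytic_on :: "(real^'n::finite) set \<Rightarrow> (real^'n \<Rightarrow> 'b::real_normed_vector) \<Rightarrow> bool"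
  where "real_analytic_on S f \<longleftrightarrow>
    (\<forall>p\<in>S. \<exists>r>0. \<exists>a :: ('n \<Rightarrow> nat) \<Rightarrow> 'b. \<forall>q\<in>ball p r.
       ((\<lambda>\<alpha>. (\<Prod>i\<in>UNIV. (q $ i - p $ i) ^ \<alpha> i) *\<^sub>R a \<alpha>) has_sum f q) UNIV)"

subsection \<open>Analytic manifolds\<close>

text \<open>The underlying space of the manifold is a type \<open>'m\<close> (Hausdorff and second countable by its
  type classes); a chart is a pair of its domain and its coordinate map.  The values of the
  coordinate map outside the domain are irrelevant.\<close>

type_synonym ('m, 'n) chart = "'m set \<times> ('m \<Rightarrow> real^'n)"

abbreviation chart_inv :: "('m, 'n::finite) chart \<Rightarrow> real^'n \<Rightarrow> 'm"
  where "chart_inv c \<equiv> inv_into (fst c) (snd c)"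

definition transition :: "('m, 'n::finite) chart \<Rightarrow> ('m, 'n) chart \<Rightarrow> real^'n \<Rightarrow> real^'n"
  where "transition c c' = (\<lambda>p. snd c' (chart_inv c p))"

definition analytic_atlas :: "('m::{t2_space, second_countable_topology}, 'n::finite) chart set \<Rightarrow> bool"
  where "analytic_atlas A \<longleftrightarrow>
    (\<Union>c\<in>A. fst c) = UNIV \<and>
    (\<forall>c\<in>A. open (fst c) \<and> open (snd c ` fst c) \<and>
       homeomorphism (fst c) (snd c ` fst c) (snd c) (chart_inv c)) \<and>
    (\<forall>c\<in>A. \<forall>c'\<in>A. real_analytic_on (snd c ` (fst c \<inter> fst c')) (transition c c'))"

definition charts_at :: "('m, 'n::finite) chart set \<Rightarrow> 'm \<Rightarrow> ('m, 'n) chart set"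
  where "charts_at A x = {c \<in> A. x \<in> fst c}"

definition smooth_map :: "('m, 'n::finite) chart set \<Rightarrow> 'm set \<Rightarrow> ('m \<Rightarrow> 'b::real_normed_vector) \<Rightarrow> bool"
  where "smooth_map A U f \<longleftrightarrow> (\<forall>c\<in>A. smooth_on (snd c ` (U \<inter> fst c)) (\<lambda>p. f (chart_inv c p)))"

text \<open>Derivative of a function at \<open>x\<close> in the direction with components \<open>h\<close> in the chart \<open>c\<close>.\<close>

definition chart_deriv :: "('m, 'n::finite) chart \<Rightarrow> ('m \<Rightarrow> real) \<Rightarrow> 'm \<Rightarrow> real^'n \<Rightarrow> real"
  where "chart_deriv c f x h = frechet_derivative (\<lambda>p. f (chart_inv c p)) (at (snd c x)) h"

text \<open>Jacobian matrix at \<open>x\<close> of the change of coordinates from \<open>c\<close> to \<open>c'\<close>.\<close>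

definition jac :: "('m, 'n::finite) chart \<Rightarrow> ('m, 'n) chart \<Rightarrow> 'm \<Rightarrow> real^'n^'n"
  where "jac c c' x = matrix (frechet_derivative (transition c c') (at (snd c x)))"

subsection \<open>The tangent bundle and the bundle of symmetric 2-tensors\<close>

text \<open>A tangent vector (a symmetric element of \<open>T\<^sup>*\<^sub>xM \<otimes> T\<^sup>*\<^sub>xM\<close>) is the family of its components
  (of its Gram matrices) in all charts at \<open>x\<close>, related by the usual transformation law.  Such
  families are normalised to be \<open>0\<close> at charts not containing \<open>x\<close>.\<close>

type_synonym ('m, 'n) vec_family = "('m, 'n) chart \<Rightarrow> real^'n"
type_synonym ('m, 'n) form_family = "('m, 'n) chart \<Rightarrow> real^'n^'n"

definition tangent_space :: "('m, 'n::finite) chart set \<Rightarrow> 'm \<Rightarrow> ('m, 'n) vec_family set"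
  where "tangent_space A x = {v.
    (\<forall>c. c \<notin> charts_at A x \<longrightarrow> v c = 0) \<and>
    (\<forall>c\<in>charts_at A x. \<forall>c'\<in>charts_at A x. v c' = jac c c' x *v v c)}"

definition sym_forms :: "('m, 'n::finite) chart set \<Rightarrow> 'm \<Rightarrow> ('m, 'n) form_family set"
  where "sym_forms A x = {w.
    (\<forall>c. c \<notin> charts_at A x \<longrightarrow> w c = 0) \<and>
    (\<forall>c\<in>charts_at A x. transpose (w c) = w c) \<and>
    (\<forall>c\<in>charts_at A x. \<forall>c'\<in>charts_at A x.
       w c = transpose (jac c c' x) ** w c' ** jac c c' x)}"

text \<open>The value \<open>w(u, v)\<close>, computed in the chart \<open>c\<close>.\<close>

definition form_apply ::
    "('m, 'n::finite) chart \<Rightarrow> ('m, 'n) form_family \<Rightarrow> ('m, 'n) vec_family \<Rightarrow> ('m, 'n) vec_family \<Rightarrow> real"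
  where "form_apply c w u v = u c \<bullet> (w c *v v c)"

definition vector_field :: "('m, 'n::finite) chart set \<Rightarrow> 'm set \<Rightarrow> ('m \<Rightarrow> ('m, 'n) vec_family) \<Rightarrow> bool"
  where "vector_field A U Y \<longleftrightarrow>
    (\<forall>x\<in>U. Y x \<in> tangent_space A x) \<and> (\<forall>c\<in>A. smooth_map A (U \<inter> fst c) (\<lambda>x. Y x c))"

definition form_section :: "('m, 'n::finite) chart set \<Rightarrow> 'm set \<Rightarrow> ('m \<Rightarrow> ('m, 'n) form_family) \<Rightarrow> bool"
  where "form_section A U X \<longleftrightarrow>
    (\<forall>x\<in>U. X x \<in> sym_forms A x) \<and> (\<forall>c\<in>A. smooth_map A (U \<inter> fst c) (\<lambda>x. X x c))"

text \<open>The vector field and the section of \<open>W\<close> over the domain of \<open>c\<close> that have constant components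
  \<open>h\<close> and \<open>m\<close> in the chart \<open>c\<close>; in particular \<open>coord_field A c (axis i 1)\<close> is the \<open>i\<close>-th coordinate
  vector field.\<close>

definition coord_field :: "('m, 'n::finite) chart set \<Rightarrow> ('m, 'n) chart \<Rightarrow> real^'n \<Rightarrow> 'm \<Rightarrow> ('m, 'n) vec_family"
  where "coord_field A c h = (\<lambda>x c'. if c' \<in> charts_at A x then jac c c' x *v h else 0)"

definition coord_form :: "('m, 'n::finite) chart set \<Rightarrow> ('m, 'n) chart \<Rightarrow> real^'n^'n \<Rightarrow> 'm \<Rightarrow> ('m, 'n) form_family"
  where "coord_form A c m =
    (\<lambda>x c'. if c' \<in> charts_at A x then transpose (jac c' c x) ** m ** jac c' c x else 0)"

subsection \<open>Connections\<close>

text \<open>\<open>D x v Y\<close> is \<open>\<nabla>\<^sub>vY\<close> for a tangent vector \<open>v\<close> at \<open>x\<close> and a smooth vector field \<open>Y\<close> near \<open>x\<close>.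
  No symmetry (vanishing torsion) is required.\<close>

type_synonym ('m, 'n) cov_deriv =
  "'m \<Rightarrow> ('m, 'n) vec_family \<Rightarrow> ('m \<Rightarrow> ('m, 'n) vec_family) \<Rightarrow> ('m, 'n) vec_family"

definition connection :: "('m::topological_space, 'n::finite) chart set \<Rightarrow> ('m, 'n) cov_deriv \<Rightarrow> bool"
  where "connection A D \<longleftrightarrow> (\<forall>U. open U \<longrightarrow>
    (\<forall>Y. vector_field A U Y \<longrightarrow>
       (\<forall>x\<in>U. \<forall>v\<in>tangent_space A x. D x v Y \<in> tangent_space A x) \<and>
       (\<forall>x\<in>U. \<forall>v\<in>tangent_space A x. \<forall>v'\<in>tangent_space A x. D x (v + v') Y = D x v Y + D x v' Y) \<and>
       (\<forall>x\<in>U. \<forall>v\<in>tangent_space A x. \<forall>r. D x (r *\<^sub>R v) Y = r *\<^sub>R D x v Y) \<and>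
       (\<forall>X. vector_field A U X \<longrightarrow> vector_field A U (\<lambda>x. D x (X x) Y)) \<and>
       (\<forall>f. smooth_map A U f \<longrightarrow> (\<forall>x\<in>U. \<forall>v\<in>tangent_space A x. \<forall>c\<in>charts_at A x.
          D x v (\<lambda>y. f y *\<^sub>R Y y) = chart_deriv c f x (v c) *\<^sub>R Y x + f x *\<^sub>R D x v Y))) \<and>
    (\<forall>Y Z. vector_field A U Y \<and> vector_field A U Z \<longrightarrow>
       (\<forall>x\<in>U. \<forall>v\<in>tangent_space A x. D x v (\<lambda>y. Y y + Z y) = D x v Y + D x v Z) \<and>
       ((\<forall>y\<in>U. Y y = Z y) \<longrightarrow> (\<forall>x\<in>U. \<forall>v\<in>tangent_space A x. D x v Y = D x v Z))))"

text \<open>Analyticity: the Christoffel symbols in every chart of the analytic atlas are analytic.\<close>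

definition analytic_connection :: "('m::topological_space, 'n::finite) chart set \<Rightarrow> ('m, 'n) cov_deriv \<Rightarrow> bool"
  where "analytic_connection A D \<longleftrightarrow> connection A D \<and>
    (\<forall>c\<in>A. \<forall>i j k. real_analytic_on (snd c ` fst c)
       (\<lambda>p. let x = chart_inv c p
            in D x (coord_field A c (axis i 1) x) (coord_field A c (axis j 1)) c $ k))"

text \<open>The induced connection on \<open>W\<close>:
  \<open>(\<nabla>\<^sub>vX)(\<partial>\<^sub>i, \<partial>\<^sub>j) = v(X(\<partial>\<^sub>i, \<partial>\<^sub>j)) - X(\<nabla>\<^sub>v\<partial>\<^sub>i, \<partial>\<^sub>j) - X(\<partial>\<^sub>i, \<nabla>\<^sub>v\<partial>\<^sub>j)\<close>.\<close>

definition form_cov_deriv ::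
    "('m, 'n::finite) chart set \<Rightarrow> ('m, 'n) cov_deriv \<Rightarrow> 'm \<Rightarrow> ('m, 'n) vec_family \<Rightarrow>
     ('m \<Rightarrow> ('m, 'n) form_family) \<Rightarrow> ('m, 'n) form_family"
  where "form_cov_deriv A D x v X = (\<lambda>c. if c \<in> charts_at A x then
      (\<chi> i j. let E = (\<lambda>k. coord_field A c (axis k 1)) in
         chart_deriv c (\<lambda>y. form_apply c (X y) (E i y) (E j y)) x (v c)
         - form_apply c (X x) (D x v (E i)) (E j x)
         - form_apply c (X x) (E i x) (D x v (E j)))
    else 0)"

text \<open>\<open>R(u, v)w = \<nabla>\<^sub>U\<nabla>\<^sub>VX - \<nabla>\<^sub>V\<nabla>\<^sub>UX - \<nabla>\<^bsub>[U,V]\<^esub>X\<close> for extensions \<open>U\<close>, \<open>V\<close>, \<open>X\<close> of \<open>u\<close>, \<open>v\<close>, \<open>w\<close>.  This is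
  independent of the extensions; the components in the chart \<open>c\<close> are computed from those with
  constant components in \<open>c\<close>, for which \<open>[U, V] = 0\<close>.\<close>

definition form_curvature ::
    "('m, 'n::finite) chart set \<Rightarrow> ('m, 'n) cov_deriv \<Rightarrow> 'm \<Rightarrow> ('m, 'n) vec_family \<Rightarrow>
     ('m, 'n) vec_family \<Rightarrow> ('m, 'n) form_family \<Rightarrow> ('m, 'n) form_family"
  where "form_curvature A D x u v w = (\<lambda>c. if c \<in> charts_at A x then
      (let U = coord_field A c (u c); V = coord_field A c (v c); X = coord_form A c (w c) in
         form_cov_deriv A D x u (\<lambda>y. form_cov_deriv A D y (V y) X) c
         - form_cov_deriv A D x v (\<lambda>y. form_cov_deriv A D y (U y) X) c)
    else 0)"

subsection \<open>Subsets of \<open>W\<close> and the derived flag\<close>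

text \<open>The total space of \<open>W\<close> consists of the pairs \<open>(x, w)\<close> with \<open>w \<in> sym_forms A x\<close>.\<close>

type_synonym ('m, 'n) form_set = "('m \<times> ('m, 'n) form_family) set"

definition fib :: "('m, 'n::finite) form_set \<Rightarrow> 'm \<Rightarrow> ('m, 'n) form_family set"
  where "fib V x = {w. (x, w) \<in> V}"

definition local_section ::
    "('m::topological_space, 'n::finite) chart set \<Rightarrow> ('m, 'n) form_set \<Rightarrow> 'm set \<Rightarrow>
     ('m \<Rightarrow> ('m, 'n) form_family) \<Rightarrow> bool"
  where "local_section A V U X \<longleftrightarrow> open U \<and> form_section A U X \<and> (\<forall>y\<in>U. X y \<in> fib V y)"

definition smooth_part ::
    "('m::topological_space, 'n::finite) chart set \<Rightarrow> ('m, 'n) form_set \<Rightarrow> ('m, 'n) form_set"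
  where "smooth_part A V =
    {(x, w) \<in> V. \<exists>U X. x \<in> U \<and> local_section A V U X \<and> X x = w}"

text \<open>The second fundamental 1-form.  An element of \<open>(W\<^sub>x/V\<^sub>x) \<otimes> T\<^sup>*\<^sub>xM = Hom(T\<^sub>xM, W\<^sub>x/V\<^sub>x)\<close> is a function
  from \<open>T\<^sub>xM\<close> to cosets of \<open>V\<^sub>x\<close>.  The predicate says that \<open>\<beta>\<close> is the class of \<open>(\<nabla>X)(x)\<close> for some
  local section \<open>X\<close> with values in \<open>V\<close> and \<open>X x = w\<close>.  It is a relation and not a function of \<open>w\<close>
  because at points where the rank of \<open>V\<close> jumps this class can depend on \<open>X\<close>: the lines spanned by
  \<open>(-y, x)\<close> in a trivial flat plane bundle over the \<open>(x, y)\<close>-plane have fibre \<open>0\<close> over the origin, yet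
  the sections \<open>0\<close> and \<open>(-y, x)\<close> through \<open>0\<close> have different derivatives there.\<close>

definition second_fundamental_form ::
    "('m::topological_space, 'n::finite) chart set \<Rightarrow> ('m, 'n) cov_deriv \<Rightarrow> ('m, 'n) form_set \<Rightarrow>
     'm \<Rightarrow> ('m, 'n) form_family \<Rightarrow> (('m, 'n) vec_family \<Rightarrow> ('m, 'n) form_family set) \<Rightarrow> bool"
  where "second_fundamental_form A D V x w \<beta> \<longleftrightarrow>
    (\<exists>U X. x \<in> U \<and> local_section A V U X \<and> X x = w \<and>
       \<beta> = (\<lambda>v\<in>tangent_space A x. {form_cov_deriv A D x v X + z | z. z \<in> fib V x}))"

text \<open>The zero element of \<open>Hom(T\<^sub>xM, W\<^sub>x/V\<^sub>x)\<close> sends every \<open>v\<close> to the coset \<open>V\<^sub>x\<close>.\<close>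

definition kernel_second_fundamental_form ::
    "('m::topological_space, 'n::finite) chart set \<Rightarrow> ('m, 'n) cov_deriv \<Rightarrow> ('m, 'n) form_set \<Rightarrow>
     ('m, 'n) form_set"
  where "kernel_second_fundamental_form A D V =
    {(x, w) \<in> V. second_fundamental_form A D V x w (\<lambda>v\<in>tangent_space A x. fib V x)}"

primrec derived_V ::
    "('m::topological_space, 'n::finite) chart set \<Rightarrow> ('m, 'n) cov_deriv \<Rightarrow> nat \<Rightarrow> ('m, 'n) form_set"
  where
    "derived_V A D 0 = {(x, w). w \<in> sym_forms A x \<and>
       (\<forall>u\<in>tangent_space A x. \<forall>v\<in>tangent_space A x. form_curvature A D x u v w = 0)}"
  | "derived_V A D (Suc i) = kernel_second_fundamental_form A D (smooth_part A (derived_V A D i))"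

definition derived_W ::
    "('m::topological_space, 'n::finite) chart set \<Rightarrow> ('m, 'n) cov_deriv \<Rightarrow> nat \<Rightarrow> ('m, 'n) form_set"
  where "derived_W A D i = smooth_part A (derived_V A D i)"

text \<open>The flag stabilises, so the choice of the index \<open>k\<close> from which it is constant is immaterial.\<close>

definition W_tilde ::
    "('m::topological_space, 'n::finite) chart set \<Rightarrow> ('m, 'n) cov_deriv \<Rightarrow> ('m, 'n) form_set"
  where "W_tilde A D = derived_W A D (LEAST k. \<forall>l\<ge>k. derived_W A D l = derived_W A D k)"

text \<open>A subset of \<open>W\<close> is a vector bundle (of rank \<open>r\<close>, with the structure induced from \<open>W\<close>) if it is
  locally trivial: near every point there is a smooth frame \<open>X 0, \<dots>, X (r - 1)\<close>, the trivialisation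
  being \<open>(y, a) \<mapsto> \<Sum>i<r. a i *\<^sub>R X i y\<close>.\<close>

definition is_vector_bundle ::
    "('m::topological_space, 'n::finite) chart set \<Rightarrow> ('m, 'n) form_set \<Rightarrow> bool"
  where "is_vector_bundle A V \<longleftrightarrow>
    (\<exists>r::nat. \<forall>x. \<exists>U X. x \<in> U \<and> open U \<and> (\<forall>i<r. form_section A U (X i)) \<and>
       (\<forall>y\<in>U. inj_on (\<lambda>i. X i y) {..<r} \<and> independent ((\<lambda>i. X i y) ` {..<r}) \<and>
          fib V y = span ((\<lambda>i. X i y) ` {..<r})))"

end

theory Submission
  imports Defs
begin

text \<open>
  In a chart the bundle \<open>W\<close> is trivial, and both the symmetry of a form and the condition
  \<open>R(\<cdot>,\<cdot>)(w) = 0\<close> are linear equations \<open>g\<cdot>w = 0\<close> whose coefficients \<open>g\<close> are analytic.  The covariant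
  derivatives of these equations with respect to the dual connection give further equations, and
  so on.  Let \<open>K\<^sub>i\<close> be the space of common solutions of the generations \<open>0, \<dots>, i\<close> of equations,
  and \<open>K\<close> that of all generations.  The claim is that \<open>W\<^sup>(\<^sup>i\<^sup>) = K\<close> for all large \<open>i\<close>, and that \<open>K\<close> has
  constant rank.

  The inclusion \<open>W\<^sup>(\<^sup>i\<^sup>) \<subseteq> K\<^sub>i\<close> (\<open>derived_W_in_kernel_upto\<close>) holds at every point, whether or not ranks
  jump there: through \<open>w \<in> W\<^sup>(\<^sup>i\<^sup>+\<^sup>1\<^sup>)\<close> passes a section \<open>X\<close> with values in \<open>W\<^sup>(\<^sup>i\<^sup>)\<close> and \<open>\<nabla>X \<in> W\<^sup>(\<^sup>i\<^sup>)\<close> at the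
  point, and differentiating \<open>g\<cdot>X = 0\<close> gives \<open>(\<nabla>g)\<cdot>w = 0\<close>.

  Analyticity is used for the rank of all equations together (\<open>rank_upper_semicontinuous\<close>).  If the
  rank at \<open>p\<close> is \<open>\<rho>\<close>, then the minors of size \<open>\<rho> + 1\<close> that pair equations with analytic vector fields
  vanish at \<open>p\<close>.  The derivative of such a minor is a sum of such minors.  Hence all their
  derivatives vanish at \<open>p\<close>, so they vanish near \<open>p\<close>, and the rank does not exceed \<open>\<rho>\<close> there.  As
  ranks can only jump up nearby, the rank is locally constant.  This takes the place of the
  construction of parallel sections: no differential equation is solved.

  Where the rank is constant, solutions extend to smooth sections (\<open>smooth_section_of_kernel\<close>), and a
  section with values in \<open>K\<close> has its covariant derivative in \<open>K\<close>.  Therefore \<open>K \<subseteq> W\<^sup>(\<^sup>i\<^sup>)\<close> for all \<open>i\<close>.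
  Here the covariant derivative and the curvature, which are computed in one chart, must be
  compared with their components in all other charts (\<open>form_cov_deriv_sym_form\<close>,
  \<open>form_curvature_zero_iff\<close>).

  For the converse inclusion the generation at which \<open>K\<^sub>i\<close> reaches \<open>K\<close> may depend on the point and
  admits no uniform bound in general.  On a dense set, however, the ranks of the first generations are locally constant;
  they are bounded by the dimension of the space of matrices, so among sufficiently many generations
  two consecutive ones have the same rank, and from then on the equations produce nothing new
  (\<open>kernel_stabilizes_somewhere\<close>).  A section with values in \<open>K\<^sub>N\<close>, where \<open>N\<close> exceeds this dimension
  by one, thus lies in \<open>K\<close> on a dense set, and by continuity everywhere
  (\<open>section_in_kernel\<close>).  So \<open>W\<^sup>(\<^sup>i\<^sup>) = K\<close> for \<open>i \<ge> N\<close>, the flag stabilises, and \<open>K\<close> is a vector bundle because its rank is locally constant on a connected manifold.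
\<close>

section \<open>Calculus of smooth maps\<close>

lemma frechet_derivative_cong_open:
  assumes "open S" "p \<in> S" "\<And>q. q \<in> S \<Longrightarrow> f q = g q"
  shows "frechet_derivative f (at p) = frechet_derivative g (at p)"
proof -
  have "(f has_derivative f') (at p) \<longleftrightarrow> (g has_derivative f') (at p)" for f'
    using has_derivative_transform_within_open[of f f' p UNIV S g]
      has_derivative_transform_within_open[of g f' p UNIV S f] assms by auto
  then show ?thesis unfolding frechet_derivative_def by simp
qed

lemma differentiable_cong_open:
  assumes "open S" "p \<in> S" "\<And>q. q \<in> S \<Longrightarrow> f q = g q"
  shows "f differentiable at p \<longleftrightarrow> g differentiable at p"
  unfolding differentiable_def
  using has_derivative_transform_within_open[of f _ p UNIV S g]
      has_derivative_transform_within_open[of g _ p UNIV S f] assms by metis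

lemma Ck_on_cong:
  assumes "open S" "\<And>q. q \<in> S \<Longrightarrow> f q = g q"
  shows "Ck_on k S f \<longleftrightarrow> Ck_on k S g"
  using assms(2)
proof (induction k arbitrary: f g)
  case 0
  then show ?case by (simp cong: continuous_on_cong)
next
  case (Suc k)
  have d: "frechet_derivative f (at p) = frechet_derivative g (at p)" if "p \<in> S" for p
    by (rule frechet_derivative_cong_open[OF assms(1) that Suc.prems])
  have "Ck_on k S (\<lambda>p. frechet_derivative f (at p) h)
    \<longleftrightarrow> Ck_on k S (\<lambda>p. frechet_derivative g (at p) h)" for h
    by (rule Suc.IH) (simp add: d)
  moreover have "(\<forall>p\<in>S. f differentiable at p) \<longleftrightarrow> (\<forall>p\<in>S. g differentiable at p)"
    using differentiable_cong_open[OF assms(1) _ Suc.prems] by auto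
  ultimately show ?case by simp
qed

lemma Ck_on_subset: "Ck_on k S f \<Longrightarrow> T \<subseteq> S \<Longrightarrow> Ck_on k T f"
  by (induction k arbitrary: f) (auto intro: continuous_on_subset)

lemma Ck_on_SucD: "Ck_on (Suc k) S f \<Longrightarrow> Ck_on k S f"
proof (induction k arbitrary: f)
  case 0
  then show ?case
    by (auto intro!: continuous_at_imp_continuous_on simp: differentiable_imp_continuous_within)
next
  case (Suc k)
  then show ?case by (metis Ck_on.simps(2))
qed

text \<open>Most closure properties below are proved by induction from this rule: it suffices to write down
  some derivative and to see that it is built from maps to which the induction hypothesis applies.\<close>

lemma Ck_on_SucI:
  assumes "open S" "\<And>p. p \<in> S \<Longrightarrow> (f has_derivative f' p) (at p)"
    and "\<And>h. Ck_on k S (\<lambda>p. f' p h)"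
  shows "Ck_on (Suc k) S f"
proof -
  have "frechet_derivative f (at p) = f' p" if "p \<in> S" for p
    using frechet_derivative_at[OF assms(2)[OF that]] by simp
  then have "Ck_on k S (\<lambda>p. frechet_derivative f (at p) h) \<longleftrightarrow> Ck_on k S (\<lambda>p. f' p h)" for h
    by (intro Ck_on_cong assms) auto
  then show ?thesis using assms by (auto simp: differentiable_def)
qed

lemma has_derivative_frechet_Ck:
  "Ck_on (Suc k) S f \<Longrightarrow> p \<in> S \<Longrightarrow> (f has_derivative frechet_derivative f (at p)) (at p)"
  by (simp add: frechet_derivative_works)

lemma Ck_on_const [simp]: "open S \<Longrightarrow> Ck_on k S (\<lambda>_. c)"
proof (induction k arbitrary: c)
  case (Suc k)
  then show ?case by (intro Ck_on_SucI[where f' = "\<lambda>_ _. 0"]) auto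
qed simp

lemma Ck_on_bounded_linear:
  assumes "open S" "bounded_linear L" "Ck_on k S f"
  shows "Ck_on k S (\<lambda>p. L (f p))"
  using assms(3)
proof (induction k arbitrary: f)
  case 0
  then show ?case by (simp add: bounded_linear.continuous_on[OF assms(2)])
next
  case (Suc k)
  show ?case
  proof (rule Ck_on_SucI[OF assms(1), where f' = "\<lambda>p h. L (frechet_derivative f (at p) h)"])
    show "((\<lambda>p. L (f p)) has_derivative (\<lambda>h. L (frechet_derivative f (at p) h))) (at p)"
      if "p \<in> S" for p
      by (rule bounded_linear.has_derivative[OF assms(2) has_derivative_frechet_Ck[OF Suc.prems that]])
    show "Ck_on k S (\<lambda>p. L (frechet_derivative f (at p) h))" for h
      using Suc by auto
  qed
qed

lemma Ck_on_add:
  assumes "open S" "Ck_on k S f" "Ck_on k S g"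
  shows "Ck_on k S (\<lambda>p. f p + g p)"
  using assms(2,3)
proof (induction k arbitrary: f g)
  case 0
  then show ?case by (simp add: continuous_on_add)
next
  case (Suc k)
  show ?case
  proof (rule Ck_on_SucI[OF assms(1), where
        f' = "\<lambda>p h. frechet_derivative f (at p) h + frechet_derivative g (at p) h"])
    show "((\<lambda>p. f p + g p) has_derivative
        (\<lambda>h. frechet_derivative f (at p) h + frechet_derivative g (at p) h)) (at p)"
      if "p \<in> S" for p
      by (intro has_derivative_add has_derivative_frechet_Ck[OF _ that]) (use Suc in auto)
    show "Ck_on k S (\<lambda>p. frechet_derivative f (at p) h + frechet_derivative g (at p) h)" for h
      using Suc by auto
  qed
qed

lemma Ck_on_bilinear:
  assumes "open S" "bounded_bilinear B" "Ck_on k S f" "Ck_on k S g"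
  shows "Ck_on k S (\<lambda>p. B (f p) (g p))"
  using assms(3,4)
proof (induction k arbitrary: f g)
  case 0
  then show ?case by (simp add: bounded_bilinear.continuous_on[OF assms(2)])
next
  case (Suc k)
  note fg = Suc.prems Suc.prems[THEN Ck_on_SucD]
  show ?case
  proof (rule Ck_on_SucI[OF assms(1), where
        f' = "\<lambda>p h. B (f p) (frechet_derivative g (at p) h) + B (frechet_derivative f (at p) h) (g p)"])
    show "((\<lambda>p. B (f p) (g p)) has_derivative
        (\<lambda>h. B (f p) (frechet_derivative g (at p) h) + B (frechet_derivative f (at p) h) (g p))) (at p)"
      if "p \<in> S" for p
      by (intro bounded_bilinear.FDERIV[OF assms(2)] has_derivative_frechet_Ck[OF _ that])
        (use fg in auto)
    show "Ck_on k S (\<lambda>p. B (f p) (frechet_derivative g (at p) h)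
        + B (frechet_derivative f (at p) h) (g p))" for h
      by (intro Ck_on_add Suc.IH assms(1)) (use fg in auto)
  qed
qed

lemma Ck_on_sum:
  assumes "open S" "\<And>i. i \<in> I \<Longrightarrow> Ck_on k S (f i)"
  shows "Ck_on k S (\<lambda>p. \<Sum>i\<in>I. f i p)"
  using assms(2)
  by (induction I rule: infinite_finite_induct) (auto intro: Ck_on_add simp: assms(1))

lemma Ck_on_inverse:
  fixes f :: "'a::real_normed_vector \<Rightarrow> real"
  assumes "open S" "Ck_on k S f" "\<And>p. p \<in> S \<Longrightarrow> f p \<noteq> 0"
  shows "Ck_on k S (\<lambda>p. inverse (f p))"
  using assms(2)
proof (induction k)
  case 0
  then show ?case using assms(3) by (simp add: continuous_on_inverse)
next
  case (Suc k)
  show ?case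
  proof (rule Ck_on_SucI[OF assms(1), where
        f' = "\<lambda>p h. - (inverse (f p) * frechet_derivative f (at p) h * inverse (f p))"])
    show "((\<lambda>p. inverse (f p)) has_derivative
        (\<lambda>h. - (inverse (f p) * frechet_derivative f (at p) h * inverse (f p)))) (at p)"
      if "p \<in> S" for p
      by (intro Deriv.has_derivative_inverse has_derivative_frechet_Ck[OF _ that])
        (use Suc.prems assms(3) that in auto)
    show "Ck_on k S (\<lambda>p. - (inverse (f p) * frechet_derivative f (at p) h * inverse (f p)))" for h
      using Suc.IH[OF Ck_on_SucD[OF Suc.prems]] Suc.prems
      by (intro Ck_on_bounded_linear[OF assms(1) bounded_linear_minus[OF bounded_linear_ident]]
          Ck_on_bilinear[OF assms(1) bounded_bilinear_mult]) auto
  qed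
qed

lemma linear_Basis_expansion:
  fixes L :: "'a::euclidean_space \<Rightarrow> 'b::real_vector"
  assumes "linear L"
  shows "L x = (\<Sum>b\<in>Basis. (x \<bullet> b) *\<^sub>R L b)"
proof -
  have "L x = L (\<Sum>b\<in>Basis. (x \<bullet> b) *\<^sub>R b)" by (simp add: euclidean_representation)
  then show ?thesis by (simp add: linear_sum[OF assms] linear_scale[OF assms])
qed

text \<open>Expanding \<open>Dg(h)\<close> in the basis turns the chain rule into a sum of products of compositions with
  partial derivatives, so that the induction on \<open>k\<close> goes through.\<close>

lemma Ck_on_compose:
  fixes f :: "'b::euclidean_space \<Rightarrow> 'c::real_normed_vector"
  assumes "open S" "open T" "Ck_on k T f" "Ck_on k S g" "g ` S \<subseteq> T"
  shows "Ck_on k S (\<lambda>p. f (g p))"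
  using assms(3,4)
proof (induction k arbitrary: f)
  case 0
  then show ?case using continuous_on_compose2[of T f S g] assms(5) by simp
next
  case (Suc k)
  define f' where "f' p h = (\<Sum>b\<in>Basis. (frechet_derivative g (at p) h \<bullet> b) *\<^sub>R
      frechet_derivative f (at (g p)) b)" for p h
  show ?case
  proof (rule Ck_on_SucI[OF assms(1), where f' = f'])
    show "((\<lambda>p. f (g p)) has_derivative f' p) (at p)" if "p \<in> S" for p
    proof -
      have gp: "g p \<in> T" using assms(5) that by auto
      have "((\<lambda>p. f (g p)) has_derivative
          (\<lambda>h. frechet_derivative f (at (g p)) (frechet_derivative g (at p) h))) (at p)"
        using diff_chain_at[OF has_derivative_frechet_Ck[OF Suc.prems(2) that]
            has_derivative_frechet_Ck[OF Suc.prems(1) gp]] by (simp add: o_def)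
      moreover have "linear (frechet_derivative f (at (g p)))"
        using Suc.prems(1) gp by (simp add: linear_frechet_derivative)
      ultimately show ?thesis
        by (simp add: f'_def[abs_def] linear_Basis_expansion[of _ "frechet_derivative g (at p) _"])
    qed
    show "Ck_on k S (\<lambda>p. f' p h)" for h
      unfolding f'_def
      by (intro Ck_on_sum assms(1) Ck_on_bilinear[OF assms(1) bounded_bilinear_scaleR]
          Ck_on_bounded_linear[OF assms(1) bounded_linear_inner_left] Suc.IH Ck_on_SucD[OF Suc.prems(2)])
        (use Suc.prems in auto)
  qed
qed

lemma Ck_on_locally:
  assumes "\<And>p. p \<in> S \<Longrightarrow> \<exists>T. open T \<and> p \<in> T \<and> Ck_on k T f"
  shows "Ck_on k S f"
  using assms
proof (induction k arbitrary: f)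
  case 0
  then show ?case
    by (metis Ck_on.simps(1) continuous_at_imp_continuous_on continuous_on_eq_continuous_at)
next
  case (Suc k)
  have "Ck_on k S (\<lambda>p. frechet_derivative f (at p) h)" for h
    by (rule Suc.IH) (use Suc.prems in fastforce)
  then show ?case using Suc.prems by fastforce
qed

lemma smooth_on_cong:
  "open S \<Longrightarrow> (\<And>q. q \<in> S \<Longrightarrow> f q = g q) \<Longrightarrow> smooth_on S f \<longleftrightarrow> smooth_on S g"
  unfolding smooth_on_def using Ck_on_cong by metis

lemma smooth_on_transfer:
  "smooth_on S g \<Longrightarrow> open S \<Longrightarrow> (\<And>q. q \<in> S \<Longrightarrow> f q = g q) \<Longrightarrow> smooth_on S f"
  using smooth_on_cong[of S f g] by simp

lemma smooth_on_subset: "smooth_on S f \<Longrightarrow> T \<subseteq> S \<Longrightarrow> smooth_on T f"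
  unfolding smooth_on_def using Ck_on_subset by metis

lemma smooth_on_locally:
  "(\<And>p. p \<in> S \<Longrightarrow> \<exists>T. open T \<and> p \<in> T \<and> smooth_on T f) \<Longrightarrow> smooth_on S f"
  unfolding smooth_on_def by (meson Ck_on_locally)

lemma smooth_on_const [simp]: "open S \<Longrightarrow> smooth_on S (\<lambda>_. c)"
  by (simp add: smooth_on_def)

lemma smooth_on_bounded_linear:
  "open S \<Longrightarrow> bounded_linear L \<Longrightarrow> smooth_on S f \<Longrightarrow> smooth_on S (\<lambda>p. L (f p))"
  unfolding smooth_on_def by (blast intro: Ck_on_bounded_linear)

lemma smooth_on_add:
  "open S \<Longrightarrow> smooth_on S f \<Longrightarrow> smooth_on S g \<Longrightarrow> smooth_on S (\<lambda>p. f p + g p)"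
  unfolding smooth_on_def by (blast intro: Ck_on_add)

lemma smooth_on_bilinear:
  "open S \<Longrightarrow> bounded_bilinear B \<Longrightarrow> smooth_on S f \<Longrightarrow> smooth_on S g \<Longrightarrow>
    smooth_on S (\<lambda>p. B (f p) (g p))"
  unfolding smooth_on_def by (blast intro: Ck_on_bilinear)

lemma smooth_on_sum:
  "open S \<Longrightarrow> (\<And>i. i \<in> I \<Longrightarrow> smooth_on S (f i)) \<Longrightarrow> smooth_on S (\<lambda>p. \<Sum>i\<in>I. f i p)"
  unfolding smooth_on_def by (blast intro: Ck_on_sum)

lemma smooth_on_inverse:
  fixes f :: "'a::real_normed_vector \<Rightarrow> real"
  shows "open S \<Longrightarrow> smooth_on S f \<Longrightarrow> (\<And>p. p \<in> S \<Longrightarrow> f p \<noteq> 0) \<Longrightarrow> smooth_on S (\<lambda>p. inverse (f p))"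
  unfolding smooth_on_def by (blast intro: Ck_on_inverse)

lemma smooth_on_compose:
  fixes f :: "'b::euclidean_space \<Rightarrow> 'c::real_normed_vector"
  shows "open S \<Longrightarrow> open T \<Longrightarrow> smooth_on T f \<Longrightarrow> smooth_on S g \<Longrightarrow> g ` S \<subseteq> T \<Longrightarrow>
    smooth_on S (\<lambda>p. f (g p))"
  unfolding smooth_on_def by (blast intro: Ck_on_compose)

lemma smooth_on_frechet_derivative:
  "smooth_on S f \<Longrightarrow> smooth_on S (\<lambda>p. frechet_derivative f (at p) h)"
  unfolding smooth_on_def by (metis Ck_on.simps(2))

lemma smooth_on_differentiable: "smooth_on S f \<Longrightarrow> p \<in> S \<Longrightarrow> f differentiable at p"
  unfolding smooth_on_def by (metis Ck_on.simps(2))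

lemma smooth_on_continuous_on: "smooth_on S f \<Longrightarrow> continuous_on S f"
  unfolding smooth_on_def by (metis Ck_on.simps(1))

lemma smooth_on_has_derivative:
  "smooth_on S f \<Longrightarrow> p \<in> S \<Longrightarrow> (f has_derivative frechet_derivative f (at p)) (at p)"
  using smooth_on_differentiable frechet_derivative_works by blast

lemmas smooth_on_scaleR = smooth_on_bilinear[OF _ bounded_bilinear_scaleR]
  and smooth_on_inner = smooth_on_bilinear[OF _ bounded_bilinear_inner]
  and smooth_on_mult = smooth_on_bilinear[OF _ bounded_bilinear_mult]
  and smooth_on_vec_nth = smooth_on_bounded_linear[OF _ bounded_linear_vec_nth]

lemma smooth_on_minus: "open S \<Longrightarrow> smooth_on S f \<Longrightarrow> smooth_on S (\<lambda>p. - f p)"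
  by (rule smooth_on_bounded_linear[OF _ bounded_linear_minus[OF bounded_linear_ident]])

lemma smooth_on_diff:
  "open S \<Longrightarrow> smooth_on S f \<Longrightarrow> smooth_on S g \<Longrightarrow> smooth_on S (\<lambda>p. f p - g p)"
  using smooth_on_add[OF _ _ smooth_on_minus, of S f g] by simp

lemma smooth_on_componentwise:
  fixes f :: "'a::real_normed_vector \<Rightarrow> 'b::euclidean_space"
  assumes "open S" "\<And>b. b \<in> Basis \<Longrightarrow> smooth_on S (\<lambda>p. f p \<bullet> b)"
  shows "smooth_on S f"
proof -
  have "smooth_on S (\<lambda>p. \<Sum>b\<in>Basis. (f p \<bullet> b) *\<^sub>R b)"
    by (intro smooth_on_sum smooth_on_scaleR smooth_on_const assms)
  then show ?thesis by (simp add: euclidean_representation)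
qed

lemma smooth_on_vecI:
  fixes f :: "'a::real_normed_vector \<Rightarrow> 'b::euclidean_space ^ 'n"
  assumes "open S" "\<And>i. smooth_on S (\<lambda>p. f p $ i)"
  shows "smooth_on S f"
proof (rule smooth_on_componentwise[OF assms(1)])
  fix b :: "'b ^ 'n" assume "b \<in> Basis"
  then obtain i u where "b = axis i u" by (auto simp: Basis_vec_def)
  then show "smooth_on S (\<lambda>p. f p \<bullet> b)"
    using smooth_on_bounded_linear[OF assms(1) bounded_linear_inner_left assms(2)]
    by (simp add: inner_axis)
qed

lemma frechet_derivative_eqI: "(f has_derivative f') (at p) \<Longrightarrow> frechet_derivative f (at p) = f'"
  using frechet_derivative_at by metis

text \<open>The product rule for a family of linear maps applied to a moving argument: expanding the
  argument in the basis reduces it to the rule for scalar multiples.\<close>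

lemma has_derivative_linear_family:
  fixes \<Phi> :: "'a::real_normed_vector \<Rightarrow> 'b::euclidean_space \<Rightarrow> 'c::real_normed_vector"
  assumes "\<And>q. linear (\<Phi> q)"
    and \<Phi>: "\<And>u. (\<lambda>q. \<Phi> q u) differentiable at p" and \<beta>: "\<beta> differentiable at p"
  shows "((\<lambda>q. \<Phi> q (\<beta> q)) has_derivative
    (\<lambda>a. frechet_derivative (\<lambda>q. \<Phi> q (\<beta> p)) (at p) a
      + \<Phi> p (frechet_derivative \<beta> (at p) a))) (at p)"
proof -
  have \<beta>': "(\<beta> has_derivative frechet_derivative \<beta> (at p)) (at p)"
    using \<beta> frechet_derivative_works by blast
  have \<Phi>': "((\<lambda>q. \<Phi> q u) has_derivative frechet_derivative (\<lambda>q. \<Phi> q u) (at p)) (at p)" for u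
    using \<Phi> frechet_derivative_works by blast
  have expand: "(\<Sum>b\<in>Basis. (u \<bullet> b) *\<^sub>R \<Phi> q b) = \<Phi> q u" for q u
    by (rule linear_Basis_expansion[OF assms(1), symmetric])
  have "((\<lambda>q. \<Sum>b\<in>Basis. (u \<bullet> b) *\<^sub>R \<Phi> q b) has_derivative
      (\<lambda>a. \<Sum>b\<in>Basis. (u \<bullet> b) *\<^sub>R frechet_derivative (\<lambda>q. \<Phi> q b) (at p) a)) (at p)" for u
    by (intro has_derivative_sum has_derivative_scaleR_right \<Phi>')
  then have const': "frechet_derivative (\<lambda>q. \<Phi> q u) (at p) a
      = (\<Sum>b\<in>Basis. (u \<bullet> b) *\<^sub>R frechet_derivative (\<lambda>q. \<Phi> q b) (at p) a)" for u a
    unfolding expand by (rule frechet_derivative_eqI[THEN fun_cong])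
  have "((\<lambda>q. \<Sum>b\<in>Basis. (\<beta> q \<bullet> b) *\<^sub>R \<Phi> q b) has_derivative
      (\<lambda>a. \<Sum>b\<in>Basis. (\<beta> p \<bullet> b) *\<^sub>R frechet_derivative (\<lambda>q. \<Phi> q b) (at p) a
        + (frechet_derivative \<beta> (at p) a \<bullet> b) *\<^sub>R \<Phi> p b)) (at p)"
    by (intro has_derivative_sum has_derivative_scaleR \<Phi>' has_derivative_inner_left \<beta>')
  then show ?thesis
    unfolding sum.distrib expand const'[of "\<beta> p", symmetric] .
qed

text \<open>The version needed for \<open>frechet_derivative f (at q)\<close>, which need not be linear where \<open>f\<close> is not
  differentiable.\<close>

lemma has_derivative_linear_family_on:
  fixes \<Phi> :: "'a::real_normed_vector \<Rightarrow> 'b::euclidean_space \<Rightarrow> 'c::real_normed_vector"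
  assumes S: "open S" "p \<in> S" and lin: "\<And>q. q \<in> S \<Longrightarrow> linear (\<Phi> q)"
    and \<Phi>: "\<And>u. (\<lambda>q. \<Phi> q u) differentiable at p" and \<beta>: "\<beta> differentiable at p"
  shows "((\<lambda>q. \<Phi> q (\<beta> q)) has_derivative
    (\<lambda>a. frechet_derivative (\<lambda>q. \<Phi> q (\<beta> p)) (at p) a
      + \<Phi> p (frechet_derivative \<beta> (at p) a))) (at p)"
proof -
  define \<Psi> where "\<Psi> q = (if q \<in> S then \<Phi> q else (\<lambda>_. 0))" for q
  have eq: "\<Psi> q = \<Phi> q" if "q \<in> S" for q using that by (simp add: \<Psi>_def)
  have lin': "linear (\<Psi> q)" for q
    by (cases "q \<in> S") (auto simp: \<Psi>_def lin linear_zero)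
  have diff: "(\<lambda>q. \<Psi> q u) differentiable at p" for u
    by (rule differentiable_cong_open[OF S, THEN iffD2, OF _ \<Phi>]) (simp add: eq)
  have "frechet_derivative (\<lambda>q. \<Psi> q (\<beta> p)) (at p) = frechet_derivative (\<lambda>q. \<Phi> q (\<beta> p)) (at p)"
    by (rule frechet_derivative_cong_open[OF S]) (simp add: eq)
  with has_derivative_linear_family[of \<Psi> p \<beta>, OF lin' diff \<beta>]
  have "((\<lambda>q. \<Psi> q (\<beta> q)) has_derivative
    (\<lambda>a. frechet_derivative (\<lambda>q. \<Phi> q (\<beta> p)) (at p) a
      + \<Phi> p (frechet_derivative \<beta> (at p) a))) (at p)"
    by (simp add: eq S)
  then show ?thesis
    by (rule has_derivative_transform_within_open[OF _ S]) (simp add: eq)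
qed

section \<open>Power series in several variables\<close>

definition monomial :: "('n::finite \<Rightarrow> nat) \<Rightarrow> real^'n \<Rightarrow> real"
  where "monomial \<alpha> x = (\<Prod>i\<in>UNIV. (x $ i) ^ \<alpha> i)"

text \<open>The radius is part of the notion.  Sums, products and derivatives of power series on a ball
  converge on the same ball, so the infinitely many functions that arise from finitely many by
  these operations can be compared with each other there.\<close>

definition power_series_rep ::
    "real^'n::finite \<Rightarrow> real \<Rightarrow> (real^'n \<Rightarrow> real) \<Rightarrow> (('n \<Rightarrow> nat) \<Rightarrow> real) \<Rightarrow> bool"
  where "power_series_rep p r f a \<longleftrightarrow>
    (\<forall>q\<in>ball p r. ((\<lambda>\<alpha>. monomial \<alpha> (q - p) * a \<alpha>) has_sum f q) UNIV)"

definition power_series_on :: "real^'n::finite \<Rightarrow> real \<Rightarrow> (real^'n \<Rightarrow> real) \<Rightarrow> bool"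
  where "power_series_on p r f \<longleftrightarrow> (\<exists>a. power_series_rep p r f a)"

lemma power_series_rep_cong:
  "power_series_rep p r f a \<Longrightarrow> (\<And>q. q \<in> ball p r \<Longrightarrow> f q = g q) \<Longrightarrow> power_series_rep p r g a"
  unfolding power_series_rep_def by auto

lemma power_series_on_cong:
  "power_series_on p r f \<Longrightarrow> (\<And>q. q \<in> ball p r \<Longrightarrow> f q = g q) \<Longrightarrow> power_series_on p r g"
  unfolding power_series_on_def using power_series_rep_cong by blast

lemma power_series_on_mono: "power_series_on p r f \<Longrightarrow> s \<le> r \<Longrightarrow> power_series_on p s f"
  unfolding power_series_on_def power_series_rep_def by fastforce

lemma monomial_0: "monomial \<alpha> 0 = (if \<alpha> = 0 then 1 else 0)"
  by (auto simp: monomial_def zero_fun_def power_0_left fun_eq_iff)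

lemma monomial_add: "monomial (\<alpha> + \<beta>) x = monomial \<alpha> x * monomial \<beta> x"
  by (simp add: monomial_def power_add prod.distrib)

lemma power_series_rep_at_center:
  assumes "power_series_rep p r f a" "0 < r"
  shows "a 0 = f p"
proof -
  have "((\<lambda>\<alpha>. monomial \<alpha> (p - p) * a \<alpha>) has_sum f p) UNIV"
    using assms unfolding power_series_rep_def by (meson centre_in_ball)
  moreover have "(\<lambda>\<alpha>. monomial \<alpha> (p - p) * a \<alpha>) = (\<lambda>\<alpha>. if \<alpha> = 0 then a 0 else 0)"
    by (auto simp: monomial_0)
  moreover have "((\<lambda>\<alpha>. if \<alpha> = 0 then a 0 else 0) has_sum a 0) (UNIV :: ('a \<Rightarrow> nat) set)"
    by (rule has_sum_finite_neutralI[of "{0}"]) auto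
  ultimately show ?thesis using has_sum_unique by metis
qed

lemma power_series_on_const [simp]: "power_series_on p r (\<lambda>_. c)"
proof -
  have "((\<lambda>\<alpha>. monomial \<alpha> (q - p) * (if \<alpha> = 0 then c else 0)) has_sum c) UNIV" for q
    by (rule has_sum_finite_neutralI[of "{0}"]) (auto simp: monomial_def)
  then show ?thesis
    unfolding power_series_on_def power_series_rep_def
    by (intro exI[of _ "\<lambda>\<alpha>. if \<alpha> = 0 then c else 0"]) blast
qed

lemma power_series_on_add:
  assumes "power_series_on p r f" "power_series_on p r g"
  shows "power_series_on p r (\<lambda>q. f q + g q)"
proof -
  obtain a b where "power_series_rep p r f a" "power_series_rep p r g b"
    using assms unfolding power_series_on_def by auto
  then have "power_series_rep p r (\<lambda>q. f q + g q) (\<lambda>\<alpha>. a \<alpha> + b \<alpha>)"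
    unfolding power_series_rep_def by (auto simp: distrib_left intro: has_sum_add)
  then show ?thesis unfolding power_series_on_def by auto
qed

lemma has_sum_times_real:
  fixes f :: "'a \<Rightarrow> real" and g :: "'b \<Rightarrow> real"
  assumes f: "(f has_sum s) UNIV" and g: "(g has_sum t) UNIV"
  shows "((\<lambda>(x, y). f x * g y) has_sum (s * t)) (UNIV \<times> UNIV)"
proof -
  have f': "(\<lambda>x. norm (f x)) summable_on UNIV" and g': "(\<lambda>x. norm (g x)) summable_on UNIV"
    using has_sum_imp_summable[OF f] has_sum_imp_summable[OF g]
    by (simp_all only: summable_on_iff_abs_summable_on_real[symmetric])
  have "(\<lambda>x. norm (case x of (x, y) \<Rightarrow> f x * g y)) summable_on (UNIV \<times> UNIV)"
    unfolding Infinite_Sum.abs_summable_on_Sigma_iff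
    using summable_on_cmult_right[OF g'] summable_on_cmult_left[OF f']
    by (simp add: abs_mult infsum_cmult_right')
  then have "(\<lambda>(x, y). f x * g y) summable_on (UNIV \<times> UNIV)"
    by (simp only: summable_on_iff_abs_summable_on_real[symmetric])
  then show ?thesis
    by (intro has_sum_SigmaI[where g = "\<lambda>x. f x * t"])
      (simp_all add: has_sum_cmult_right has_sum_cmult_left f g)
qed

text \<open>The Cauchy product: unconditional convergence lets the double series be summed along
  the antidiagonals \<open>\<alpha> + \<beta> = \<gamma>\<close>, each of which is finite.\<close>

lemma power_series_on_mult:
  assumes "power_series_on p r f" "power_series_on p r g"
  shows "power_series_on p r (\<lambda>q. f q * g q)"
proof -
  obtain a b where a: "power_series_rep p r f a" and b: "power_series_rep p r g b"
    using assms unfolding power_series_on_def by auto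
  define T where "T \<gamma> = {(\<alpha>, \<beta>). \<alpha> + \<beta> = \<gamma>}" for \<gamma> :: "'a \<Rightarrow> nat"
  define c where "c \<gamma> = (\<Sum>(\<alpha>, \<beta>)\<in>T \<gamma>. a \<alpha> * b \<beta>)" for \<gamma>
  have fin: "finite (T \<gamma>)" for \<gamma>
  proof -
    have "{\<alpha>. \<forall>i. \<alpha> i \<le> \<gamma> i} = PiE UNIV (\<lambda>i. {..\<gamma> i})"
      by (simp add: PiE_def Pi_def)
    then have "finite {\<alpha>. \<forall>i. \<alpha> i \<le> \<gamma> i}"
      by (simp add: finite_PiE)
    moreover have "T \<gamma> \<subseteq> {\<alpha>. \<forall>i. \<alpha> i \<le> \<gamma> i} \<times> {\<alpha>. \<forall>i. \<alpha> i \<le> \<gamma> i}"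
      unfolding T_def by auto
    ultimately show ?thesis by (meson finite_SigmaI finite_subset)
  qed
  have "((\<lambda>\<gamma>. monomial \<gamma> (q - p) * c \<gamma>) has_sum (f q * g q)) UNIV" if q: "q \<in> ball p r" for q
  proof -
    define F where "F = (\<lambda>(\<alpha>, \<beta>). (monomial \<alpha> (q - p) * a \<alpha>) * (monomial \<beta> (q - p) * b \<beta>))"
    have f: "((\<lambda>\<alpha>. monomial \<alpha> (q - p) * a \<alpha>) has_sum f q) UNIV"
      and g: "((\<lambda>\<alpha>. monomial \<alpha> (q - p) * b \<alpha>) has_sum g q) UNIV"
      using a b q unfolding power_series_rep_def by auto
    have F: "(F has_sum (f q * g q)) (UNIV \<times> UNIV)"
      unfolding F_def by (rule has_sum_times_real[OF f g])
    have bij: "bij_betw snd (SIGMA \<gamma>:UNIV. T \<gamma>) (UNIV \<times> UNIV)"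
      unfolding T_def by (intro bij_betwI[where g = "\<lambda>(\<alpha>, \<beta>). (\<alpha> + \<beta>, (\<alpha>, \<beta>))"]) fastforce+
    have "((\<lambda>x. F (snd x)) has_sum (f q * g q)) (SIGMA \<gamma>:UNIV. T \<gamma>)"
      using F has_sum_reindex_bij_betw[OF bij, of F] by simp
    then show ?thesis
    proof (rule has_sum_SigmaD)
      fix \<gamma> :: "'a \<Rightarrow> nat"
      have "(\<Sum>x\<in>T \<gamma>. F x) = monomial \<gamma> (q - p) * c \<gamma>"
        unfolding c_def sum_distrib_left
        by (intro sum.cong) (auto simp: F_def T_def monomial_add)
      then show "((\<lambda>y. F (snd (\<gamma>, y))) has_sum monomial \<gamma> (q - p) * c \<gamma>) (T \<gamma>)"
        using has_sum_finite[OF fin, of F \<gamma>] by simp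
    qed
  qed
  then show ?thesis unfolding power_series_on_def power_series_rep_def by blast
qed

lemma power_series_on_sum:
  "(\<And>i. i \<in> I \<Longrightarrow> power_series_on p r (f i)) \<Longrightarrow> power_series_on p r (\<lambda>q. \<Sum>i\<in>I. f i q)"
  by (induction I rule: infinite_finite_induct) (auto intro: power_series_on_add)

lemma power_series_on_prod:
  "(\<And>i. i \<in> I \<Longrightarrow> power_series_on p r (f i)) \<Longrightarrow> power_series_on p r (\<lambda>q. \<Prod>i\<in>I. f i q)"
  by (induction I rule: infinite_finite_induct) (auto intro: power_series_on_mult)

lemma power_series_on_cmult: "power_series_on p r f \<Longrightarrow> power_series_on p r (\<lambda>q. c * f q)"
  by (intro power_series_on_mult) auto

lemma power_series_on_uminus: "power_series_on p r f \<Longrightarrow> power_series_on p r (\<lambda>q. - f q)"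
  using power_series_on_cmult[of p r f "-1"] by simp

lemma power_series_on_diff:
  "power_series_on p r f \<Longrightarrow> power_series_on p r g \<Longrightarrow> power_series_on p r (\<lambda>q. f q - g q)"
  using power_series_on_add[OF _ power_series_on_uminus] by fastforce

subsection \<open>Termwise differentiation\<close>

definition monomial_deriv :: "('n::finite \<Rightarrow> nat) \<Rightarrow> real^'n \<Rightarrow> 'n \<Rightarrow> real"
  where "monomial_deriv \<alpha> x i = of_nat (\<alpha> i) * (x $ i) ^ (\<alpha> i - 1) * (\<Prod>j\<in>UNIV - {i}. (x $ j) ^ \<alpha> j)"

lemma has_derivative_monomial:
  "((\<lambda>q. monomial \<alpha> (q - p)) has_derivative (\<lambda>h. \<Sum>i\<in>UNIV. h $ i * monomial_deriv \<alpha> (q - p) i)) (at q)"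
proof -
  have 1: "((\<lambda>q. ((q - p) $ i) ^ \<alpha> i) has_derivative
      (\<lambda>h. of_nat (\<alpha> i) * (h $ i) * ((q - p) $ i) ^ (\<alpha> i - 1))) (at q)" for i
    by (auto intro!: derivative_eq_intros bounded_linear.has_derivative[OF bounded_linear_vec_nth])
  show ?thesis
    unfolding monomial_def
    by (rule has_derivative_eq_rhs[OF has_derivative_prod[OF 1]])
      (simp add: monomial_deriv_def mult_ac)
qed

text \<open>The coefficients of the \<open>i\<close>-th partial derivative.\<close>

definition deriv_coeff :: "'n \<Rightarrow> (('n \<Rightarrow> nat) \<Rightarrow> real) \<Rightarrow> ('n \<Rightarrow> nat) \<Rightarrow> real"
  where "deriv_coeff i a \<beta> = of_nat (Suc (\<beta> i)) * a (\<beta>(i := Suc (\<beta> i)))"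

lemma monomial_deriv_Suc:
  "monomial_deriv (\<beta>(i := Suc (\<beta> i))) x i = of_nat (Suc (\<beta> i)) * monomial \<beta> x"
proof -
  have "monomial \<beta> x = (x $ i) ^ \<beta> i * (\<Prod>j\<in>UNIV - {i}. (x $ j) ^ \<beta> j)"
    unfolding monomial_def by (subst prod.remove[of _ i]) auto
  then show ?thesis by (simp add: monomial_deriv_def)
qed

lemma monomial_deriv_eq_0: "\<alpha> i = 0 \<Longrightarrow> monomial_deriv \<alpha> x i = 0"
  by (simp add: monomial_deriv_def)

text \<open>Only the multi-indices with \<open>\<alpha> i > 0\<close> contribute to the partial derivative, and they are
  the successors in direction \<open>i\<close>.\<close>

lemma has_sum_monomial_deriv_iff:
  fixes x :: "real^'n::finite"
  shows "((\<lambda>\<alpha>. monomial_deriv \<alpha> x i * a \<alpha>) has_sum s) UNIV \<longleftrightarrow>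
    ((\<lambda>\<beta>. monomial \<beta> x * deriv_coeff i a \<beta>) has_sum s) UNIV"
proof -
  let ?S = "\<lambda>\<beta>::'n \<Rightarrow> nat. \<beta>(i := Suc (\<beta> i))"
  have bij: "bij_betw ?S UNIV {\<alpha>. \<alpha> i \<noteq> 0}"
    by (rule bij_betw_byWitness[where f' = "\<lambda>\<alpha>. \<alpha>(i := \<alpha> i - 1)"]) auto
  have "((\<lambda>\<alpha>. monomial_deriv \<alpha> x i * a \<alpha>) has_sum s) UNIV \<longleftrightarrow>
     ((\<lambda>\<alpha>. monomial_deriv \<alpha> x i * a \<alpha>) has_sum s) {\<alpha>. \<alpha> i \<noteq> 0}"
    by (rule has_sum_cong_neutral) (auto simp: monomial_deriv_eq_0)
  also have "\<dots> \<longleftrightarrow> ((\<lambda>\<beta>. monomial_deriv (?S \<beta>) x i * a (?S \<beta>)) has_sum s) UNIV"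
    using has_sum_reindex_bij_betw[OF bij, of "\<lambda>\<alpha>. monomial_deriv \<alpha> x i * a \<alpha>"] by simp
  finally show ?thesis by (simp add: monomial_deriv_Suc deriv_coeff_def mult_ac del: fun_upd_apply)
qed

text \<open>The two lowest terms of \<open>(\<rho> + \<epsilon>) ^ k\<close> in powers of \<open>\<epsilon>\<close>: differentiation costs no more than an arbitrarily small
  enlargement of the argument.\<close>

lemma power_deriv_bound:
  fixes \<rho> \<epsilon> :: real
  assumes "0 \<le> \<rho>" "0 < \<epsilon>"
  shows "of_nat k * \<rho> ^ (k - 1) \<le> (\<rho> + \<epsilon>) ^ k / \<epsilon>"
proof -
  have "\<rho> ^ k + of_nat k * \<rho> ^ (k - 1) * \<epsilon> \<le> (\<rho> + \<epsilon>) ^ k"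
  proof (induction k)
    case (Suc k)
    have "\<rho> ^ Suc k + of_nat (Suc k) * \<rho> ^ k * \<epsilon>
        \<le> (\<rho> + \<epsilon>) * (\<rho> ^ k + of_nat k * \<rho> ^ (k - 1) * \<epsilon>)"
      using assms by (cases k) (auto simp: algebra_simps)
    also have "\<dots> \<le> (\<rho> + \<epsilon>) * (\<rho> + \<epsilon>) ^ k"
      using Suc assms by (intro mult_left_mono) auto
    finally show ?case by simp
  qed simp
  moreover have "0 \<le> \<rho> ^ k" using assms by simp
  ultimately have "of_nat k * \<rho> ^ (k - 1) * \<epsilon> \<le> (\<rho> + \<epsilon>) ^ k" by linarith
  then show ?thesis using assms by (simp add: pos_le_divide_eq)
qed

lemma monomial_deriv_bound:
  assumes "0 < \<epsilon>" "\<And>j. \<bar>x $ j\<bar> \<le> \<rho> j"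
  shows "\<bar>monomial_deriv \<alpha> x i\<bar> \<le> monomial \<alpha> (\<chi> j. \<rho> j + \<epsilon>) / \<epsilon>"
proof -
  have \<rho>: "0 \<le> \<rho> j" for j using assms(2)[of j] by linarith
  have "\<bar>monomial_deriv \<alpha> x i\<bar>
      = of_nat (\<alpha> i) * \<bar>x $ i\<bar> ^ (\<alpha> i - 1) * (\<Prod>j\<in>UNIV - {i}. \<bar>x $ j\<bar> ^ \<alpha> j)"
    by (simp add: monomial_deriv_def abs_mult abs_prod power_abs)
  also have "\<dots> \<le> of_nat (\<alpha> i) * \<rho> i ^ (\<alpha> i - 1) * (\<Prod>j\<in>UNIV - {i}. (\<rho> j + \<epsilon>) ^ \<alpha> j)"
    using assms(1) \<rho> order_trans[OF assms(2)]
    by (intro mult_mono prod_mono power_mono conjI mult_nonneg_nonneg prod_nonneg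
        zero_le_power ballI assms(2)) (auto intro: add_increasing2 order_trans[OF assms(2)])
  also have "\<dots> \<le> ((\<rho> i + \<epsilon>) ^ \<alpha> i / \<epsilon>) * (\<Prod>j\<in>UNIV - {i}. (\<rho> j + \<epsilon>) ^ \<alpha> j)"
    using assms(1) \<rho>
    by (intro mult_right_mono power_deriv_bound prod_nonneg) (auto intro: add_nonneg_nonneg less_imp_le)
  also have "\<dots> = monomial \<alpha> (\<chi> j. \<rho> j + \<epsilon>) / \<epsilon>"
    unfolding monomial_def by (subst prod.remove[of UNIV i]) auto
  finally show ?thesis .
qed

text \<open>Near \<open>q\<close> the series of partial derivatives is dominated by the original series at a slightly
  larger point of the same ball, hence converges uniformly there.\<close>

proposition power_series_rep_has_derivative:
  fixes p :: "real^'n::finite"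
  assumes rep: "power_series_rep p r f a"
  shows "\<exists>F. (\<forall>i. power_series_rep p r (F i) (deriv_coeff i a)) \<and>
    (\<forall>q\<in>ball p r. (f has_derivative (\<lambda>h. \<Sum>i\<in>UNIV. h $ i * F i q)) (at q))"
proof -
  have inf: "infinite (UNIV :: ('n \<Rightarrow> nat) set)"
  proof
    assume "finite (UNIV :: ('n \<Rightarrow> nat) set)"
    then have "finite ((\<lambda>\<alpha>::'n \<Rightarrow> nat. \<alpha> undefined) ` UNIV)" by (rule finite_imageI)
    moreover have "k \<in> (\<lambda>\<alpha>::'n \<Rightarrow> nat. \<alpha> undefined) ` UNIV" for k by (rule image_eqI[of _ _ "\<lambda>_. k"]) auto
    ultimately show False using infinite_UNIV_nat by (metis UNIV_eq_I)
  qed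
  obtain e :: "nat \<Rightarrow> ('n \<Rightarrow> nat)" where e: "bij e"
    using bij_betw_from_nat_into[OF _ inf] by auto
  have sums_e: "(\<lambda>n. g (e n)) sums s" if "(g has_sum s) UNIV" for g :: "('n \<Rightarrow> nat) \<Rightarrow> real" and s
    using that has_sum_reindex_bij_betw[OF e, of g s] has_sum_imp_sums by auto
  define F where "F i q = (\<Sum>\<^sub>\<infinity>\<beta>. monomial \<beta> (q - p) * deriv_coeff i a \<beta>)" for i q
  have main: "(\<forall>i. ((\<lambda>\<beta>. monomial \<beta> (q - p) * deriv_coeff i a \<beta>) has_sum F i q) UNIV) \<and>
      (f has_derivative (\<lambda>h. \<Sum>i\<in>UNIV. h $ i * F i q)) (at q)" if q: "q \<in> ball p r" for q
  proof -
    \<comment> \<open>Around \<open>q\<close> the series is dominated by its value at a corner \<open>z\<close> of a slightly larger box.\<close>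
    define z where "z \<epsilon> = (\<chi> i. \<bar>(q - p) $ i\<bar> + 2 * \<epsilon>)" for \<epsilon> :: real
    have "norm (z 0) = norm (q - p)" unfolding z_def norm_vec_def L2_set_def by simp
    then have "norm (z 0) < r" using q by (simp add: dist_norm norm_minus_commute)
    moreover have "((\<lambda>\<epsilon>. norm (z \<epsilon>)) \<longlongrightarrow> norm (z 0)) (at_right 0)"
      unfolding z_def by (intro tendsto_intros) 
    ultimately have "\<forall>\<^sub>F \<epsilon> in at_right 0. norm (z \<epsilon>) < r" by (simp add: order_tendstoD)
    moreover have "\<forall>\<^sub>F \<epsilon> in at_right (0::real). 0 < \<epsilon>" by (simp add: eventually_at_right_less)
    ultimately have "\<forall>\<^sub>F \<epsilon> in at_right 0. norm (z \<epsilon>) < r \<and> 0 < \<epsilon>" by eventually_elim simp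
    then obtain \<epsilon> where \<epsilon>: "norm (z \<epsilon>) < r" "0 < \<epsilon>"
      using eventually_happens'[OF trivial_limit_at_right_real] by blast
    define M where "M \<alpha> = monomial \<alpha> (z \<epsilon>) * \<bar>a \<alpha>\<bar> / \<epsilon>" for \<alpha>
    have "p + z \<epsilon> \<in> ball p r" using \<epsilon> by (simp add: dist_norm)
    with rep have "((\<lambda>\<alpha>. monomial \<alpha> (p + z \<epsilon> - p) * a \<alpha>) has_sum f (p + z \<epsilon>)) UNIV"
      unfolding power_series_rep_def by (rule bspec)
    then have "(\<lambda>\<alpha>. monomial \<alpha> (z \<epsilon>) * a \<alpha>) summable_on UNIV"
      by (simp add: has_sum_imp_summable)
    then have "(\<lambda>\<alpha>. norm (monomial \<alpha> (z \<epsilon>) * a \<alpha>)) summable_on UNIV"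
      by (rule summable_on_iff_abs_summable_on_real[THEN iffD1])
    moreover have "0 \<le> monomial \<alpha> (z \<epsilon>)" for \<alpha>
      using \<epsilon> by (auto simp: monomial_def z_def intro!: prod_nonneg)
    ultimately have "M summable_on UNIV"
      using summable_on_cmult_left[of "\<lambda>\<alpha>. norm (monomial \<alpha> (z \<epsilon>) * a \<alpha>)" UNIV "1 / \<epsilon>"]
      by (simp add: M_def[abs_def] abs_mult)
    define S where "S = ball q \<epsilon> \<inter> ball p r"
    have S: "convex S" "open S" "q \<in> S"
      using q \<epsilon> by (auto simp: S_def convex_Int)
    have bound: "\<bar>monomial_deriv \<alpha> (x - p) i * a \<alpha>\<bar> \<le> M \<alpha>" if "x \<in> S" for x \<alpha> i
    proof -
      have "\<bar>(x - p) $ j\<bar> \<le> \<bar>(q - p) $ j\<bar> + \<epsilon>" for j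
        using component_le_norm_cart[of "x - q" j] that by (auto simp: S_def dist_norm norm_minus_commute)
      from monomial_deriv_bound[OF \<epsilon>(2), of "x - p" "\<lambda>j. \<bar>(q - p) $ j\<bar> + \<epsilon>", OF this]
      have "\<bar>monomial_deriv \<alpha> (x - p) i\<bar> \<le> monomial \<alpha> (z \<epsilon>) / \<epsilon>"
        by (simp add: z_def add.commute)
      from mult_right_mono[OF this, of "\<bar>a \<alpha>\<bar>"] show ?thesis
        by (simp add: M_def abs_mult)
    qed
    have sum_F: "((\<lambda>\<beta>. monomial \<beta> (x - p) * deriv_coeff i a \<beta>) has_sum F i x) UNIV" if "x \<in> S" for x i
    proof -
      have "(\<lambda>\<alpha>. norm (monomial_deriv \<alpha> (x - p) i * a \<alpha>)) summable_on UNIV"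
        by (rule Infinite_Sum.abs_summable_on_comparison_test'[OF \<open>M summable_on UNIV\<close>])
          (use bound[OF that] in simp)
      then have "(\<lambda>\<alpha>. monomial_deriv \<alpha> (x - p) i * a \<alpha>) summable_on UNIV"
        by (rule summable_on_iff_abs_summable_on_real[THEN iffD2])
      then obtain s where "((\<lambda>\<alpha>. monomial_deriv \<alpha> (x - p) i * a \<alpha>) has_sum s) UNIV"
        unfolding summable_on_def by (rule exE)
      then have "((\<lambda>\<beta>. monomial \<beta> (x - p) * deriv_coeff i a \<beta>) has_sum s) UNIV"
        by (rule has_sum_monomial_deriv_iff[THEN iffD1])
      then show ?thesis unfolding F_def by (rule has_sum_infsum[OF has_sum_imp_summable])
    qed
    have sums_F: "(\<lambda>n. monomial_deriv (e n) (x - p) i * a (e n)) sums F i x" if "x \<in> S" for x i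
      by (rule sums_e[OF has_sum_monomial_deriv_iff[THEN iffD2, OF sum_F[OF that]]])
    have sums_f: "(\<lambda>n. monomial (e n) (x - p) * a (e n)) sums f x" if "x \<in> S" for x
    proof -
      have "x \<in> ball p r" using that by (simp add: S_def)
      with rep show ?thesis unfolding power_series_rep_def by (intro sums_e) (rule bspec)
    qed
    have "(M has_sum infsum M UNIV) UNIV"
      using \<open>M summable_on UNIV\<close> by (rule has_sum_infsum)
    then have "summable (\<lambda>n. M (e n))"
      by (rule sums_summable[OF sums_e])
    then have uniform: "uniform_limit S (\<lambda>n x. \<Sum>k<n. monomial_deriv (e k) (x - p) i * a (e k)) (F i) sequentially" for i
    proof -
      have "uniform_limit S (\<lambda>n x. \<Sum>k<n. monomial_deriv (e k) (x - p) i * a (e k))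
          (\<lambda>x. \<Sum>k. monomial_deriv (e k) (x - p) i * a (e k)) sequentially"
        using bound \<open>summable (\<lambda>n. M (e n))\<close> by (intro Weierstrass_m_test) auto
      moreover have "(\<Sum>k. monomial_deriv (e k) (x - p) i * a (e k)) = F i x" if "x \<in> S" for x
        using sums_unique[OF sums_F[OF that]] by metis
      ultimately show ?thesis using uniform_limit_cong' by (metis (no_types, lifting))
    qed
    have "\<exists>g. \<forall>x\<in>S. (\<lambda>n. monomial (e n) (x - p) * a (e n)) sums (g x) \<and>
        (g has_derivative (\<lambda>h. \<Sum>i\<in>UNIV. h $ i * F i x)) (at x within S)"
    proof (rule has_derivative_series[where f = "\<lambda>n x. monomial (e n) (x - p) * a (e n)" and x = q and l = "f q"
          and f' = "\<lambda>n x h. (\<Sum>i\<in>UNIV. h $ i * monomial_deriv (e n) (x - p) i) * a (e n)"])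
      show "convex S" "q \<in> S" "(\<lambda>n. monomial (e n) (q - p) * a (e n)) sums f q"
        using S sums_f by blast+
      show "((\<lambda>x. monomial (e n) (x - p) * a (e n)) has_derivative
          (\<lambda>h. (\<Sum>i\<in>UNIV. h $ i * monomial_deriv (e n) (x - p) i) * a (e n))) (at x within S)" for n x
        by (intro has_derivative_mult_left has_derivative_at_withinI[OF has_derivative_monomial])
      fix d :: real assume "0 < d"
      define d' where "d' = d / CARD('n)"
      have "0 < d'" using \<open>0 < d\<close> by (simp add: d'_def)
      then have "\<forall>\<^sub>F n in sequentially. \<forall>i. \<forall>x\<in>S.
          \<bar>(\<Sum>k<n. monomial_deriv (e k) (x - p) i * a (e k)) - F i x\<bar> < d'"
        using uniform by (intro eventually_all_finite) (auto simp: uniform_limit_iff dist_real_def)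
      then show "\<forall>\<^sub>F n in sequentially. \<forall>x\<in>S. \<forall>h. norm ((\<Sum>k<n. (\<Sum>i\<in>UNIV. h $ i * monomial_deriv (e k) (x - p) i) * a (e k))
          - (\<Sum>i\<in>UNIV. h $ i * F i x)) \<le> d * norm h"
      proof eventually_elim
        case (elim n)
        show ?case
        proof (intro ballI allI)
          fix x h assume "x \<in> S"
          have "(\<Sum>k<n. (\<Sum>i\<in>UNIV. h $ i * monomial_deriv (e k) (x - p) i) * a (e k))
            = (\<Sum>i\<in>UNIV. h $ i * (\<Sum>k<n. monomial_deriv (e k) (x - p) i * a (e k)))"
            unfolding sum_distrib_right sum_distrib_left by (subst sum.swap) (simp add: mult_ac)
          then have "norm ((\<Sum>k<n. (\<Sum>i\<in>UNIV. h $ i * monomial_deriv (e k) (x - p) i) * a (e k))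
              - (\<Sum>i\<in>UNIV. h $ i * F i x))
            = norm (\<Sum>i\<in>UNIV. h $ i * ((\<Sum>k<n. monomial_deriv (e k) (x - p) i * a (e k)) - F i x))"
            by (simp add: sum_subtractf right_diff_distrib)
          also have "\<dots> \<le> (\<Sum>i\<in>(UNIV::'n set). norm h * d')"
            using elim \<open>x \<in> S\<close> component_le_norm_cart[of h]
            by (intro sum_norm_le) (simp add: abs_mult mult_mono less_imp_le)
          also have "\<dots> = d * norm h" by (simp add: d'_def)
          finally show "norm ((\<Sum>k<n. (\<Sum>i\<in>UNIV. h $ i * monomial_deriv (e k) (x - p) i) * a (e k))
              - (\<Sum>i\<in>UNIV. h $ i * F i x)) \<le> d * norm h" .
        qed
      qed
    qed
    then obtain g where g: "\<And>x. x \<in> S \<Longrightarrow> (\<lambda>n. monomial (e n) (x - p) * a (e n)) sums g x"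
      "\<And>x. x \<in> S \<Longrightarrow> (g has_derivative (\<lambda>h. \<Sum>i\<in>UNIV. h $ i * F i x)) (at x within S)" by blast
    have "g x = f x" if "x \<in> S" for x using g(1) sums_f that sums_unique2 by blast
    moreover have "(g has_derivative (\<lambda>h. \<Sum>i\<in>UNIV. h $ i * F i q)) (at q)"
      using g(2)[OF S(3)] unfolding at_within_open[OF S(3,2)] .
    ultimately have "(f has_derivative (\<lambda>h. \<Sum>i\<in>UNIV. h $ i * F i q)) (at q)"
      using has_derivative_transform_within_open[OF _ S(2,3)] by blast
    then show ?thesis by (intro conjI allI sum_F S(3))
  qed
  have "power_series_rep p r (F i) (deriv_coeff i a)" for i
    unfolding power_series_rep_def using main by blast
  then show ?thesis using main by blast
qed

lemma power_series_on_differentiable: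
  "power_series_on p r f \<Longrightarrow> q \<in> ball p r \<Longrightarrow> f differentiable at q"
  unfolding power_series_on_def differentiable_def using power_series_rep_has_derivative by blast

lemma power_series_on_frechet_derivative:
  assumes "power_series_on p r f"
  shows "power_series_on p r (\<lambda>q. frechet_derivative f (at q) h)"
proof -
  obtain a where "power_series_rep p r f a" using assms unfolding power_series_on_def by auto
  then obtain F where F: "\<And>i. power_series_rep p r (F i) (deriv_coeff i a)"
    and f': "\<And>q. q \<in> ball p r \<Longrightarrow> (f has_derivative (\<lambda>h. \<Sum>i\<in>UNIV. h $ i * F i q)) (at q)"
    using power_series_rep_has_derivative by blast
  have "power_series_on p r (\<lambda>q. \<Sum>i\<in>UNIV. h $ i * F i q)"
    using F by (intro power_series_on_sum power_series_on_cmult) (auto simp: power_series_on_def)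
  then show ?thesis
    by (rule power_series_on_cong) (simp add: frechet_derivative_eqI[OF f'])
qed

lemma power_series_on_smooth:
  assumes "power_series_on p r f"
  shows "smooth_on (ball p r) f"
proof -
  have "Ck_on k (ball p r) f" for k
    using assms
  proof (induction k arbitrary: f)
    case 0
    then show ?case
      by (auto intro!: continuous_at_imp_continuous_on differentiable_imp_continuous_within
          power_series_on_differentiable)
  next
    case (Suc k)
    show ?case
      unfolding Ck_on.simps
      using power_series_on_differentiable[OF Suc.prems]
        Suc.IH[OF power_series_on_frechet_derivative[OF Suc.prems]] by blast
  qed
  then show ?thesis by (simp add: smooth_on_def)
qed

text \<open>The coefficients of both sides agree.\<close>

lemma power_series_on_second_derivative_symmetric:
  assumes "power_series_on p r f" and q: "q \<in> ball p r"
  shows "frechet_derivative (\<lambda>q. frechet_derivative f (at q) h) (at q) k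
    = frechet_derivative (\<lambda>q. frechet_derivative f (at q) k) (at q) h"
proof -
  obtain a where "power_series_rep p r f a" using assms unfolding power_series_on_def by auto
  then obtain F where F: "\<And>i. power_series_rep p r (F i) (deriv_coeff i a)"
    and f': "\<And>q. q \<in> ball p r \<Longrightarrow> (f has_derivative (\<lambda>h. \<Sum>i\<in>UNIV. h $ i * F i q)) (at q)"
    using power_series_rep_has_derivative by blast
  have "\<exists>G. (\<forall>j. power_series_rep p r (G j) (deriv_coeff j (deriv_coeff i a))) \<and>
      (\<forall>q\<in>ball p r. (F i has_derivative (\<lambda>h. \<Sum>j\<in>UNIV. h $ j * G j q)) (at q))" for i
    by (rule power_series_rep_has_derivative[OF F[of i]])
  then obtain G where "\<forall>i. (\<forall>j. power_series_rep p r (G i j) (deriv_coeff j (deriv_coeff i a))) \<and>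
      (\<forall>q\<in>ball p r. (F i has_derivative (\<lambda>h. \<Sum>j\<in>UNIV. h $ j * G i j q)) (at q))"
    by (rule choice[OF allI, THEN exE])
  then have G: "power_series_rep p r (G i j) (deriv_coeff j (deriv_coeff i a))"
    and F': "q \<in> ball p r \<Longrightarrow> (F i has_derivative (\<lambda>h. \<Sum>j\<in>UNIV. h $ j * G i j q)) (at q)" for i j q
    by blast+
  have comm: "deriv_coeff j (deriv_coeff i a) = deriv_coeff i (deriv_coeff j a)" for i j
  proof (cases "i = j")
    case False
    then have "\<beta>(i := u, j := v) = \<beta>(j := v, i := u)" for \<beta> :: "'a \<Rightarrow> nat" and u v
      by (rule fun_upd_twist)
    with False show ?thesis by (intro ext) (simp add: deriv_coeff_def)
  qed simp
  have sum_G: "((\<lambda>\<alpha>. monomial \<alpha> (q - p) * deriv_coeff j (deriv_coeff i a) \<alpha>) has_sum G i j q) UNIV" for i j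
    using G[of i j] q unfolding power_series_rep_def by (rule bspec)
  have sym: "G i j q = G j i q" for i j
    using has_sum_unique[OF sum_G[where i = i and j = j]] sum_G[where i = j and j = i]
    by (simp only: comm[where i = i and j = j])
  have "frechet_derivative (\<lambda>q. frechet_derivative f (at q) h) (at q) k
      = (\<Sum>i\<in>UNIV. h $ i * (\<Sum>j\<in>UNIV. k $ j * G i j q))" for h k
  proof -
    have "frechet_derivative (\<lambda>q. frechet_derivative f (at q) h) (at q)
        = frechet_derivative (\<lambda>q. \<Sum>i\<in>UNIV. h $ i * F i q) (at q)"
      by (rule frechet_derivative_cong_open[OF open_ball q]) (simp add: frechet_derivative_eqI[OF f'])
    also have "\<dots> = (\<lambda>k. \<Sum>i\<in>UNIV. h $ i * (\<Sum>j\<in>UNIV. k $ j * G i j q))"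
      by (intro frechet_derivative_eqI has_derivative_sum has_derivative_mult_right F' q)
    finally show ?thesis by simp
  qed
  note D2 = this
  show ?thesis
    unfolding D2 sum_distrib_left by (subst sum.swap) (simp add: sym mult_ac)
qed

text \<open>The identity theorem in the form in which it replaces the transport of solutions of a
  differential equation: the coefficients of a member are the values at the centre of its iterated
  derivatives, which are members again.\<close>

lemma power_series_family_vanishes:
  assumes ps: "\<And>f. f \<in> \<F> \<Longrightarrow> power_series_on p r f" and "0 < r"
    and zero: "\<And>f. f \<in> \<F> \<Longrightarrow> f p = 0"
    and deriv: "\<And>f h. f \<in> \<F> \<Longrightarrow>
      \<exists>g\<in>\<F>. \<forall>q\<in>ball p r. frechet_derivative f (at q) h = g q"
    and "f \<in> \<F>" "q \<in> ball p r"
  shows "f q = 0"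
proof -
  have coeff: "a \<alpha> = 0" if "f \<in> \<F>" "power_series_rep p r f a" for f a \<alpha>
    using that
  proof (induction "\<Sum>i\<in>UNIV. \<alpha> i" arbitrary: f a \<alpha>)
    case 0
    then have "\<alpha> = 0" by (simp add: fun_eq_iff)
    then show ?case
      using power_series_rep_at_center[OF 0(3) assms(2)] zero 0 by simp
  next
    case (Suc n)
    then obtain i where i: "\<alpha> i \<noteq> 0" by (metis Zero_not_Suc sum.neutral)
    define \<beta> where "\<beta> = \<alpha>(i := \<alpha> i - 1)"
    have \<alpha>: "\<alpha> = \<beta>(i := Suc (\<beta> i))" using i by (simp add: \<beta>_def)
    have "sum \<alpha> UNIV = \<alpha> i + sum \<alpha> (UNIV - {i})" "sum \<beta> UNIV = \<beta> i + sum \<beta> (UNIV - {i})"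
      by (simp_all add: sum.remove[of UNIV i])
    moreover have "sum \<beta> (UNIV - {i}) = sum \<alpha> (UNIV - {i})" by (simp add: \<beta>_def)
    ultimately have n: "n = sum \<beta> UNIV" using Suc.hyps(2) i by (simp add: \<beta>_def)
    obtain F where F: "\<And>i. power_series_rep p r (F i) (deriv_coeff i a)"
      and f': "\<And>q. q \<in> ball p r \<Longrightarrow> (f has_derivative (\<lambda>h. \<Sum>i\<in>UNIV. h $ i * F i q)) (at q)"
      using power_series_rep_has_derivative[OF Suc.prems(2)] by blast
    obtain g where g: "g \<in> \<F>" "\<And>q. q \<in> ball p r \<Longrightarrow> frechet_derivative f (at q) (axis i 1) = g q"
      using deriv[OF Suc.prems(1)] by metis
    have "g q = F i q" if "q \<in> ball p r" for q
      using g(2)[OF that] frechet_derivative_eqI[OF f'[OF that]]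
      by (simp add: axis_def if_distrib[of "\<lambda>x. x * _"] cong: if_cong)
    then have "power_series_rep p r g (deriv_coeff i a)"
      using power_series_rep_cong[OF F] by metis
    then have "deriv_coeff i a \<beta> = 0" using Suc.hyps(1)[OF n g(1)] by blast
    then show ?case unfolding deriv_coeff_def \<alpha>[symmetric] by simp
  qed
  obtain a where a: "power_series_rep p r f a" using ps assms(5) unfolding power_series_on_def by auto
  then have "((\<lambda>\<alpha>. monomial \<alpha> (q - p) * a \<alpha>) has_sum f q) UNIV"
    using assms(6) unfolding power_series_rep_def by blast
  then have "((\<lambda>\<alpha>. 0) has_sum f q) (UNIV :: ('a \<Rightarrow> nat) set)"
    using coeff[OF assms(5) a] by simp
  then show ?thesis using has_sum_0 has_sum_unique by (metis (no_types, lifting))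
qed

lemma real_analytic_on_power_series:
  fixes f :: "real^'n::finite \<Rightarrow> 'b::real_inner"
  assumes "real_analytic_on S f" "p \<in> S"
  shows "\<exists>r>0. \<forall>b. power_series_on p r (\<lambda>q. f q \<bullet> b)"
proof -
  obtain r a where "0 < r" and a: "\<And>q. q \<in> ball p r \<Longrightarrow>
      ((\<lambda>\<alpha>. (\<Prod>i\<in>UNIV. (q $ i - p $ i) ^ \<alpha> i) *\<^sub>R a \<alpha>) has_sum f q) UNIV"
    using assms unfolding real_analytic_on_def by blast
  have "power_series_rep p r (\<lambda>q. f q \<bullet> b) (\<lambda>\<alpha>. a \<alpha> \<bullet> b)" for b
    unfolding power_series_rep_def
  proof
    fix q assume "q \<in> ball p r"
    from has_sum_bounded_linear[OF bounded_linear_inner_left[of b] a[OF this]]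
    show "((\<lambda>\<alpha>. monomial \<alpha> (q - p) * (a \<alpha> \<bullet> b)) has_sum f q \<bullet> b) UNIV"
      by (simp add: monomial_def o_def)
  qed
  then show ?thesis using \<open>0 < r\<close> unfolding power_series_on_def by blast
qed

lemma real_analytic_on_smooth_on:
  fixes f :: "real^'n::finite \<Rightarrow> 'b::euclidean_space"
  assumes "real_analytic_on S f"
  shows "smooth_on S f"
proof (rule smooth_on_locally)
  fix p assume "p \<in> S"
  then obtain r where "0 < r" and r: "\<And>b. power_series_on p r (\<lambda>q. f q \<bullet> b)"
    using real_analytic_on_power_series[OF assms] by blast
  have "smooth_on (ball p r) f"
    by (rule smooth_on_componentwise[OF open_ball power_series_on_smooth[OF r]])
  then show "\<exists>T. open T \<and> p \<in> T \<and> smooth_on T f"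
    using \<open>0 < r\<close> by (meson centre_in_ball open_ball)
qed

section \<open>Linear independence and minors\<close>

text \<open>Indexed families, because repeated vectors must count as dependent.\<close>

definition independent_family :: "nat \<Rightarrow> (nat \<Rightarrow> 'e::real_vector) \<Rightarrow> bool"
  where "independent_family s g \<longleftrightarrow> (\<forall>i<s. g i \<notin> span (g ` ({..<s} - {i})))"

text \<open>The Leibniz formula for the determinant of the matrix of all \<open>g i \<bullet> v j\<close>.  Its size is a rank and
  varies with the point, so it is a number and not the cardinality of an index type.\<close>

definition minor :: "nat \<Rightarrow> (nat \<Rightarrow> 'e::real_inner) \<Rightarrow> (nat \<Rightarrow> 'e) \<Rightarrow> real"
  where "minor s g v = (\<Sum>\<sigma> | \<sigma> permutes {..<s}. of_int (sign \<sigma>) * (\<Prod>i<s. g i \<bullet> v (\<sigma> i)))"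

lemma independent_family_inj: "independent_family s g \<Longrightarrow> inj_on g {..<s}"
proof (rule inj_onI)
  fix i j assume g: "independent_family s g" and ij: "i \<in> {..<s}" "j \<in> {..<s}" "g i = g j"
  show "i = j"
  proof (rule ccontr)
    assume "i \<noteq> j"
    then have "g i \<in> g ` ({..<s} - {i})" using ij by auto
    then have "g i \<in> span (g ` ({..<s} - {i}))" by (rule span_base)
    then show False using g ij(1) by (simp add: independent_family_def)
  qed
qed

lemma independent_family_iff:
  "independent_family s g \<longleftrightarrow> inj_on g {..<s} \<and> independent (g ` {..<s})"
proof (cases "inj_on g {..<s}")
  case True
  then have "g ` {..<s} - {g i} = g ` ({..<s} - {i})" if "i < s" for i
    using that by (auto simp: inj_on_def)
  then show ?thesis using True by (auto simp: independent_family_def dependent_def)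
qed (use independent_family_inj in blast)

lemma independent_family_mono: "independent_family s g \<Longrightarrow> r \<le> s \<Longrightarrow> independent_family r g"
  unfolding independent_family_def
proof (intro allI impI)
  fix i assume *: "\<forall>i<s. g i \<notin> span (g ` ({..<s} - {i}))" "r \<le> s" "i < r"
  then have "span (g ` ({..<r} - {i})) \<subseteq> span (g ` ({..<s} - {i}))"
    by (intro span_mono) auto
  then show "g i \<notin> span (g ` ({..<r} - {i}))" using * by auto
qed

lemma independent_family_le_dim:
  fixes g :: "nat \<Rightarrow> 'e::euclidean_space"
  assumes "independent_family s g" "\<And>i. i < s \<Longrightarrow> g i \<in> S"
  shows "s \<le> dim S"
proof -
  have "inj_on g {..<s}" "independent (g ` {..<s})"
    using assms(1) by (auto simp: independent_family_iff)
  then have "dim (g ` {..<s}) = s" by (simp add: dim_eq_card_independent card_image)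
  moreover have "dim (g ` {..<s}) \<le> dim S" using assms(2) by (intro dim_subset) auto
  ultimately show ?thesis by simp
qed

lemma independent_family_exists:
  fixes S :: "'e::euclidean_space set"
  obtains g where "\<And>i. i < dim S \<Longrightarrow> g i \<in> S" "independent_family (dim S) g"
proof -
  obtain B where B: "B \<subseteq> S" "independent B" "S \<subseteq> span B" "card B = dim S"
    using basis_exists by blast
  then have "finite B" by (simp add: finiteI_independent)
  then obtain g where g: "bij_betw g {0..<dim S} B"
    using ex_bij_betw_nat_finite[of B] B(4) by auto
  then have "g ` {..<dim S} = B" "inj_on g {..<dim S}"
    by (auto simp: bij_betw_def atLeast0LessThan)
  then show thesis
    using B by (intro that[of g]) (auto simp: independent_family_iff)
qed

lemma independent_family_span_eq:
  fixes g :: "nat \<Rightarrow> 'e::euclidean_space"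
  assumes "independent_family s g" "\<And>i. i < s \<Longrightarrow> g i \<in> S" "dim S \<le> s"
  shows "span (g ` {..<s}) = span S"
proof -
  have "inj_on g {..<s}" "independent (g ` {..<s})"
    using assms(1) by (auto simp: independent_family_iff)
  then have "dim (g ` {..<s}) = s" by (simp add: dim_eq_card_independent card_image)
  then show ?thesis using assms by (intro dim_eq_span) auto
qed

lemma minor_update_row:
  assumes "a < s"
  shows "minor s (g(a := x)) v = (\<Sum>\<sigma> | \<sigma> permutes {..<s}.
    of_int (sign \<sigma>) * ((x \<bullet> v (\<sigma> a)) * (\<Prod>i\<in>{..<s} - {a}. g i \<bullet> v (\<sigma> i))))"
proof -
  have "(\<Prod>i<s. (g(a := x)) i \<bullet> v (\<sigma> i)) = (x \<bullet> v (\<sigma> a)) * (\<Prod>i\<in>{..<s} - {a}. g i \<bullet> v (\<sigma> i))" for \<sigma>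
    using assms by (subst prod.remove[of _ a]) auto
  then show ?thesis by (simp add: minor_def)
qed

text \<open>Composition with the transposition of \<open>i\<close> and \<open>j\<close> changes the sign of every term.\<close>

lemma minor_equal_rows:
  assumes ij: "i < s" "j < s" "i \<noteq> j" and eq: "g i = g j"
  shows "minor s g v = 0"
proof -
  let ?\<tau> = "Transposition.transpose i j"
  have \<tau>: "?\<tau> permutes {..<s}" using ij by (intro permutes_swap_id) auto
  have row: "g (?\<tau> k) = g k" for k using eq by (auto simp: Transposition.transpose_def)
  have "minor s g v = (\<Sum>\<sigma> | \<sigma> permutes {..<s}.
      of_int (sign (\<sigma> \<circ> ?\<tau>)) * (\<Prod>k<s. g k \<bullet> v ((\<sigma> \<circ> ?\<tau>) k)))"
    unfolding minor_def by (rule sum_permutations_compose_right[OF \<tau>])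
  also have "\<dots> = (\<Sum>\<sigma> | \<sigma> permutes {..<s}. - (of_int (sign \<sigma>) * (\<Prod>k<s. g k \<bullet> v (\<sigma> k))))"
  proof (intro sum.cong refl)
    fix \<sigma> assume "\<sigma> \<in> {\<sigma>. \<sigma> permutes {..<s}}"
    then have "permutation \<sigma>" using permutes_imp_permutation by blast
    then have "sign (\<sigma> \<circ> ?\<tau>) = - sign \<sigma>"
      using ij(3) by (simp add: sign_compose permutation_swap_id sign_swap_id)
    moreover have "(\<Prod>k<s. g k \<bullet> v ((\<sigma> \<circ> ?\<tau>) k)) = (\<Prod>k<s. g k \<bullet> v (\<sigma> k))"
      by (subst prod.permute[OF \<tau>]) (simp add: o_def row)
    ultimately show "of_int (sign (\<sigma> \<circ> ?\<tau>)) * (\<Prod>k<s. g k \<bullet> v ((\<sigma> \<circ> ?\<tau>) k))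
        = - (of_int (sign \<sigma>) * (\<Prod>k<s. g k \<bullet> v (\<sigma> k)) :: real)" by simp
  qed
  also have "\<dots> = - minor s g v" by (simp add: minor_def sum_negf)
  finally show ?thesis by simp
qed

text \<open>As a function of one row the minor is linear, and it vanishes at the other rows, hence on their
  span.\<close>

lemma minor_eq_0_if_dependent:
  assumes "\<not> independent_family s g"
  shows "minor s g v = 0"
proof -
  obtain a where a: "a < s" "g a \<in> span (g ` ({..<s} - {a}))"
    using assms unfolding independent_family_def by auto
  have "minor s (g(a := x)) v = 0" if "x \<in> span (g ` ({..<s} - {a}))" for x
    using that
  proof (induction rule: span_induct)
    case base
    show ?case unfolding subspace_def minor_update_row[OF a(1)] mem_Collect_eq
      by (auto simp: inner_add_left algebra_simps sum.distrib simp flip: sum_distrib_left)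
  next
    case (step x)
    then obtain j where "j < s" "j \<noteq> a" "x = g j" by auto
    then show ?case using a(1) by (intro minor_equal_rows[of a s j]) auto
  qed
  from this[OF a(2)] show ?thesis by simp
qed

text \<open>The component of \<open>g j\<close> orthogonal to the other members of the family serves as \<open>v j\<close>; this makes
  the matrix diagonal.\<close>

lemma minor_nonzero_exists:
  fixes g :: "nat \<Rightarrow> 'e::euclidean_space"
  assumes "independent_family s g"
  obtains v where "minor s g v \<noteq> 0"
proof -
  have "\<exists>z. (\<forall>i<s. i \<noteq> j \<longrightarrow> g i \<bullet> z = 0) \<and> g j \<bullet> z \<noteq> 0" if "j < s" for j
  proof -
    obtain y z where y: "y \<in> span (g ` ({..<s} - {j}))" and g: "g j = y + z"
      and z: "\<And>w. w \<in> span (g ` ({..<s} - {j})) \<Longrightarrow> orthogonal z w"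
      by (rule orthogonal_subspace_decomp_exists[of "g ` ({..<s} - {j})" "g j"]) blast
    have "z \<noteq> 0" using assms that y g unfolding independent_family_def by auto
    moreover have "y \<bullet> z = 0" using z[OF y] by (simp add: orthogonal_def inner_commute)
    ultimately have "g j \<bullet> z \<noteq> 0" by (simp add: g inner_add_left)
    moreover have "g i \<bullet> z = 0" if "i < s" "i \<noteq> j" for i
      using z[OF span_base, of "g i"] that by (simp add: orthogonal_def inner_commute)
    ultimately show ?thesis by blast
  qed
  then obtain v where v: "\<And>i j. j < s \<Longrightarrow> i < s \<Longrightarrow> i \<noteq> j \<Longrightarrow> g i \<bullet> v j = 0"
    "\<And>j. j < s \<Longrightarrow> g j \<bullet> v j \<noteq> 0"
    by metis
  have "(\<Prod>i<s. g i \<bullet> v (\<sigma> i)) = 0" if \<sigma>: "\<sigma> permutes {..<s}" "\<sigma> \<noteq> id" for \<sigma>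
  proof -
    obtain i where "\<sigma> i \<noteq> i" using \<sigma>(2) by (auto simp: fun_eq_iff)
    then have "i < s" using permutes_not_in[OF \<sigma>(1)] by (meson lessThan_iff)
    then have "\<sigma> i < s" using permutes_in_image[OF \<sigma>(1), of i] by simp
    then show ?thesis using v(1)[of "\<sigma> i" i] \<open>\<sigma> i \<noteq> i\<close> \<open>i < s\<close> by (intro prod_zero) auto
  qed
  then have "minor s g v = (\<Sum>\<sigma>\<in>{id}. of_int (sign \<sigma>) * (\<Prod>i<s. g i \<bullet> v (\<sigma> i)))"
    unfolding minor_def
    by (intro sum.mono_neutral_right) (auto simp: finite_permutations permutes_id)
  also have "\<dots> \<noteq> 0" using v(2) by (simp add: sign_id)
  finally show thesis by (rule that)
qed

lemma independent_family_nearby: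
  fixes g :: "nat \<Rightarrow> 'a::topological_space \<Rightarrow> 'e::euclidean_space"
  assumes S: "open S" "p \<in> S" and cont: "\<And>i. i < s \<Longrightarrow> continuous_on S (g i)"
    and ind: "independent_family s (\<lambda>i. g i p)"
  obtains T where "open T" "p \<in> T" "T \<subseteq> S" "\<And>q. q \<in> T \<Longrightarrow> independent_family s (\<lambda>i. g i q)"
proof -
  obtain v where v: "minor s (\<lambda>i. g i p) v \<noteq> 0" using minor_nonzero_exists[OF ind] .
  have "continuous_on S (\<lambda>q. minor s (\<lambda>i. g i q) v)"
    unfolding minor_def by (intro continuous_intros cont) auto
  then have "open (S \<inter> (\<lambda>q. minor s (\<lambda>i. g i q) v) -` (- {0}))"
    using S(1) by (intro continuous_open_preimage) auto
  then show thesis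
    by (rule that) (use S v minor_eq_0_if_dependent in auto)
qed

section \<open>Kernels of families of covectors\<close>

text \<open>A set of maps into a Euclidean space is read as a set of rows of a matrix of functions.\<close>

abbreviation rows_at :: "('a \<Rightarrow> 'e) set \<Rightarrow> 'a \<Rightarrow> 'e set"
  where "rows_at \<G> q \<equiv> (\<lambda>g. g q) ` \<G>"

definition kernel_at :: "('a \<Rightarrow> 'e::real_inner) set \<Rightarrow> 'a \<Rightarrow> 'e set"
  where "kernel_at \<G> q = {w. \<forall>g\<in>\<G>. g q \<bullet> w = 0}"

lemma subspace_kernel_at: "subspace (kernel_at \<G> q)"
  by (auto simp: subspace_def kernel_at_def inner_add_right)

lemma kernel_at_antimono: "\<G> \<subseteq> \<H> \<Longrightarrow> kernel_at \<H> q \<subseteq> kernel_at \<G> q"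
  by (auto simp: kernel_at_def)

lemma orthogonal_to_span_iff: "(\<forall>x\<in>span S. x \<bullet> w = 0) \<longleftrightarrow> (\<forall>x\<in>S. x \<bullet> w = 0)"
proof
  assume *: "\<forall>x\<in>S. x \<bullet> w = 0"
  have "x \<bullet> w = 0" if "x \<in> span S" for x
    using that by (induction rule: span_induct) (use * in \<open>auto simp: subspace_def inner_add_left\<close>)
  then show "\<forall>x\<in>span S. x \<bullet> w = 0" by blast
qed (use span_base in blast)

lemma kernel_at_span: "kernel_at \<G> q = {w. \<forall>x\<in>span (rows_at \<G> q). x \<bullet> w = 0}"
  by (auto simp: kernel_at_def orthogonal_to_span_iff)

lemma kernel_at_eq_if_dim_eq:
  fixes q :: 'a and \<G> :: "('a \<Rightarrow> 'e::euclidean_space) set"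
  assumes "\<G> \<subseteq> \<H>" "dim (rows_at \<H> q) \<le> dim (rows_at \<G> q)"
  shows "kernel_at \<G> q = kernel_at \<H> q"
proof -
  have "span (rows_at \<G> q) = span (rows_at \<H> q)"
    using assms by (intro dim_eq_span) auto
  then show ?thesis by (simp add: kernel_at_span)
qed

lemma dim_kernel_at:
  fixes q :: 'a and \<G> :: "('a \<Rightarrow> 'e::euclidean_space) set"
  shows "dim (kernel_at \<G> q) + dim (rows_at \<G> q) = DIM('e)"
proof -
  have "dim {y \<in> UNIV. \<forall>x\<in>span (rows_at \<G> q). orthogonal x y} + dim (span (rows_at \<G> q)) = dim (UNIV :: 'e set)"
    by (intro dim_subspace_orthogonal_to_vectors) auto
  moreover have "{y \<in> UNIV. \<forall>x\<in>span (rows_at \<G> q). orthogonal x y} = kernel_at \<G> q"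
    by (simp add: kernel_at_span orthogonal_def)
  ultimately show ?thesis by (simp add: dim_span)
qed

lemma rank_family_exists:
  fixes p :: 'a and \<G> :: "('a \<Rightarrow> 'e::euclidean_space) set"
  obtains h where "\<And>i. i < dim (rows_at \<G> p) \<Longrightarrow> h i \<in> \<G>"
    and "independent_family (dim (rows_at \<G> p)) (\<lambda>i. h i p)"
proof -
  obtain g where g: "\<And>i. i < dim (rows_at \<G> p) \<Longrightarrow> g i \<in> rows_at \<G> p"
    and ind: "independent_family (dim (rows_at \<G> p)) g"
    by (rule independent_family_exists[where S = "rows_at \<G> p"]) blast
  then have "\<forall>i. \<exists>h. i < dim (rows_at \<G> p) \<longrightarrow> h \<in> \<G> \<and> g i = h p" by blast
  then obtain h where h: "\<forall>i. i < dim (rows_at \<G> p) \<longrightarrow> h i \<in> \<G> \<and> g i = h i p"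
    by (rule choice[THEN exE])
  have "independent_family (dim (rows_at \<G> p)) (\<lambda>i. h i p) = independent_family (dim (rows_at \<G> p)) g"
    unfolding independent_family_def
  proof (intro all_cong1 imp_cong refl)
    fix i assume i: "i < dim (rows_at \<G> p)"
    have "(\<lambda>i. h i p) ` ({..<dim (rows_at \<G> p)} - {i}) = g ` ({..<dim (rows_at \<G> p)} - {i})"
      by (rule image_cong) (use h in auto)
    then show "(h i p \<notin> span ((\<lambda>i. h i p) ` ({..<dim (rows_at \<G> p)} - {i})))
        = (g i \<notin> span (g ` ({..<dim (rows_at \<G> p)} - {i})))"
      using h i by simp
  qed
  with h ind show thesis by (intro that[of h]) auto
qed

lemma rank_lower_semicontinuous:
  fixes \<G> :: "('a::topological_space \<Rightarrow> 'e::euclidean_space) set"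
  assumes S: "open S" "p \<in> S" and cont: "\<And>g. g \<in> \<G> \<Longrightarrow> continuous_on S g"
  obtains T where "open T" "p \<in> T" "T \<subseteq> S"
    "\<And>q. q \<in> T \<Longrightarrow> dim (rows_at \<G> p) \<le> dim (rows_at \<G> q)"
proof -
  obtain h where h: "\<And>i. i < dim (rows_at \<G> p) \<Longrightarrow> h i \<in> \<G>"
    and ind: "independent_family (dim (rows_at \<G> p)) (\<lambda>i. h i p)"
    by (rule rank_family_exists[where \<G> = \<G> and p = p]) blast
  have "continuous_on S (h i)" if "i < dim (rows_at \<G> p)" for i
    using cont h that by blast
  from independent_family_nearby[OF S this ind] obtain T where
    T: "open T" "p \<in> T" "T \<subseteq> S" "\<And>q. q \<in> T \<Longrightarrow> independent_family (dim (rows_at \<G> p)) (\<lambda>i. h i q)"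
    by blast
  have "dim (rows_at \<G> p) \<le> dim (rows_at \<G> q)" if "q \<in> T" for q
    using T(4)[OF that] by (rule independent_family_le_dim) (use h in auto)
  with T show thesis by (intro that[of T]) auto
qed

text \<open>Gram-Schmidt with parameters: the component of \<open>W\<close> orthogonal to independent rows depends
  smoothly on the point.  The rows are split off one at a time, and the last one is first
  replaced by its own component \<open>u\<close> orthogonal to the others.\<close>

lemma smooth_orthogonal_part:
  fixes h :: "nat \<Rightarrow> 'a::real_normed_vector \<Rightarrow> 'e::euclidean_space"
  assumes S: "open S" "p \<in> S" and h: "\<And>i. i < s \<Longrightarrow> smooth_on S (h i)"
    and "independent_family s (\<lambda>i. h i p)" and "smooth_on S W"
  shows "\<exists>T X. open T \<and> p \<in> T \<and> T \<subseteq> S \<and> smooth_on T X \<and>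
    (\<forall>q\<in>T. (\<forall>i<s. h i q \<bullet> X q = 0) \<and> W q - X q \<in> span ((\<lambda>i. h i q) ` {..<s}))"
  using assms(3-)
proof (induction s arbitrary: W)
  case 0
  then show ?case using S by (intro exI[of _ S] exI[of _ W]) auto
next
  case (Suc s)
  have ind: "independent_family s (\<lambda>i. h i p)"
    using independent_family_mono[OF Suc.prems(2)] by simp
  obtain T1 X1 where T1: "open T1" "p \<in> T1" "T1 \<subseteq> S" "smooth_on T1 X1"
    and X1: "\<And>q i. q \<in> T1 \<Longrightarrow> i < s \<Longrightarrow> h i q \<bullet> X1 q = 0"
      "\<And>q. q \<in> T1 \<Longrightarrow> W q - X1 q \<in> span ((\<lambda>i. h i q) ` {..<s})"
    using Suc.IH[OF Suc.prems(1) ind Suc.prems(3)] by force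
  obtain T2 u where T2: "open T2" "p \<in> T2" "T2 \<subseteq> S" "smooth_on T2 u"
    and u: "\<And>q i. q \<in> T2 \<Longrightarrow> i < s \<Longrightarrow> h i q \<bullet> u q = 0"
      "\<And>q. q \<in> T2 \<Longrightarrow> h s q - u q \<in> span ((\<lambda>i. h i q) ` {..<s})"
    using Suc.IH[OF Suc.prems(1) ind, of "h s"] Suc.prems(1) by force
  have "{..<Suc s} - {s} = {..<s}" by auto
  then have "h s p \<notin> span ((\<lambda>i. h i p) ` {..<s})"
    using Suc.prems(2) unfolding independent_family_def by fastforce
  then have "u p \<noteq> 0" using u(2)[OF T2(2)] by auto
  define T where "T = (T1 \<inter> T2) \<inter> u -` (- {0})"
  have "continuous_on (T1 \<inter> T2) u"
    using smooth_on_continuous_on[OF T2(4)] continuous_on_subset by blast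
  then have T: "open T" unfolding T_def
    using T1(1) T2(1) by (intro continuous_open_preimage) auto
  define X where "X q = X1 q - ((X1 q \<bullet> u q) * inverse (u q \<bullet> u q)) *\<^sub>R u q" for q
  have smooth: "smooth_on T X1" "smooth_on T u"
    by (rule smooth_on_subset[OF T1(4)] smooth_on_subset[OF T2(4)]; auto simp: T_def)+
  have "smooth_on T X"
    unfolding X_def
    by (intro smooth_on_diff smooth_on_scaleR smooth_on_mult smooth_on_inverse smooth_on_inner
        smooth T) (auto simp: T_def)
  moreover have "h i q \<bullet> X q = 0" if "q \<in> T" "i < Suc s" for q i
  proof (cases "i < s")
    case True
    then show ?thesis using X1(1) u(1) that by (simp add: X_def T_def inner_diff_right)
  next
    case False
    then have i: "i = s" using that by simp
    have q: "q \<in> T1" "q \<in> T2" "u q \<bullet> u q \<noteq> 0" using that(1) by (auto simp: T_def)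
    have "X1 q \<bullet> (h s q - u q) = 0" "u q \<bullet> (h s q - u q) = 0"
      using u(2)[OF q(2)] orthogonal_to_span_iff[of "(\<lambda>i. h i q) ` {..<s}" "X1 q"]
        orthogonal_to_span_iff[of "(\<lambda>i. h i q) ` {..<s}" "u q"] X1(1)[OF q(1)] u(1)[OF q(2)]
      by (auto simp: inner_commute)
    then show ?thesis
      using q(3) by (simp add: i X_def inner_diff_right inner_diff_left inner_commute)
  qed
  moreover have "W q - X q \<in> span ((\<lambda>i. h i q) ` {..<Suc s})" if "q \<in> T" for q
  proof -
    have q: "q \<in> T1" "q \<in> T2" using that by (auto simp: T_def)
    have mono: "span ((\<lambda>i. h i q) ` {..<s}) \<subseteq> span ((\<lambda>i. h i q) ` {..<Suc s})"
      by (intro span_mono) auto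
    have "h s q \<in> span ((\<lambda>i. h i q) ` {..<Suc s})" by (intro span_base) auto
    then have "h s q - (h s q - u q) \<in> span ((\<lambda>i. h i q) ` {..<Suc s})"
      using subsetD[OF mono u(2)[OF q(2)]] by (rule span_diff)
    then have "(W q - X1 q) + ((X1 q \<bullet> u q) * inverse (u q \<bullet> u q)) *\<^sub>R u q
        \<in> span ((\<lambda>i. h i q) ` {..<Suc s})"
      using X1(2)[OF q(1)] mono by (intro span_add span_scale) auto
    then show ?thesis by (simp add: X_def algebra_simps)
  qed
  ultimately show ?case
    using T T1 T2 \<open>u p \<noteq> 0\<close> by (intro exI[of _ T] exI[of _ X]) (auto simp: T_def)
qed

text \<open>Where the rank is constant, every vector of the kernel extends to a smooth section: finitely
  many rows that are independent at \<open>p\<close> cut out the kernel of the whole family near \<open>p\<close>.\<close>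

lemma smooth_section_of_kernel:
  fixes \<G> :: "('a::real_normed_vector \<Rightarrow> 'e::euclidean_space) set"
  assumes S: "open S" "p \<in> S" and smooth: "\<And>g. g \<in> \<G> \<Longrightarrow> smooth_on S g"
    and rank: "\<And>q. q \<in> S \<Longrightarrow> dim (rows_at \<G> q) \<le> dim (rows_at \<G> p)"
    and w: "w \<in> kernel_at \<G> p"
  obtains T X where "open T" "p \<in> T" "T \<subseteq> S" "smooth_on T X" "X p = w"
    "\<And>q. q \<in> T \<Longrightarrow> X q \<in> kernel_at \<G> q"
proof -
  let ?s = "dim (rows_at \<G> p)"
  obtain h where h: "\<And>i. i < ?s \<Longrightarrow> h i \<in> \<G>" and ind: "independent_family ?s (\<lambda>i. h i p)"
    by (rule rank_family_exists[where \<G> = \<G> and p = p]) blast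
  have "continuous_on S (h i)" if "i < ?s" for i
    using smooth h that smooth_on_continuous_on by blast
  from independent_family_nearby[OF S this ind] obtain T1 where
    T1: "open T1" "p \<in> T1" "T1 \<subseteq> S" "\<And>q. q \<in> T1 \<Longrightarrow> independent_family ?s (\<lambda>i. h i q)"
    by blast
  have "\<exists>T X. open T \<and> p \<in> T \<and> T \<subseteq> T1 \<and> smooth_on T X \<and>
    (\<forall>q\<in>T. (\<forall>i<?s. h i q \<bullet> X q = 0) \<and> w - X q \<in> span ((\<lambda>i. h i q) ` {..<?s}))"
    by (intro smooth_orthogonal_part[of T1 p ?s h "\<lambda>_. w"] T1 ind smooth_on_const
        smooth_on_subset[OF smooth[OF h]])
  then obtain T X where T: "open T" "p \<in> T" "T \<subseteq> T1" "smooth_on T X"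
    and X: "\<And>q i. q \<in> T \<Longrightarrow> i < ?s \<Longrightarrow> h i q \<bullet> X q = 0"
      "\<And>q. q \<in> T \<Longrightarrow> w - X q \<in> span ((\<lambda>i. h i q) ` {..<?s})"
    by blast
  have span: "span ((\<lambda>i. h i q) ` {..<?s}) = span (rows_at \<G> q)" if "q \<in> T" for q
    by (rule independent_family_span_eq) (use T1 T h rank that in auto)
  have ker: "X q \<in> kernel_at \<G> q" if "q \<in> T" for q
    using X(1)[OF that] orthogonal_to_span_iff[of "(\<lambda>i. h i q) ` {..<?s}" "X q"] span[OF that]
    by (auto simp: kernel_at_span)
  have "w - X p \<in> kernel_at \<G> p"
    by (rule subspace_diff[OF subspace_kernel_at w ker[OF T(2)]])
  moreover have "w - X p \<in> span (rows_at \<G> p)" using X(2)[OF T(2)] span[OF T(2)] by simp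
  ultimately have "(w - X p) \<bullet> (w - X p) = 0" by (auto simp: kernel_at_span)
  then have "X p = w" by simp
  with T T1 ker show thesis by (intro that[of T X]) auto
qed

text \<open>Sections through a basis of the kernel at \<open>p\<close> stay independent nearby, and they span because the
  dimension of the kernel does not grow.\<close>

lemma smooth_frame_of_kernel:
  fixes \<G> :: "('a::real_normed_vector \<Rightarrow> 'e::euclidean_space) set"
  assumes S: "open S" "p \<in> S" and smooth: "\<And>g. g \<in> \<G> \<Longrightarrow> smooth_on S g"
    and rank: "\<And>q. q \<in> S \<Longrightarrow> dim (rows_at \<G> q) \<le> dim (rows_at \<G> p)"
  obtains T X where "open T" "p \<in> T" "T \<subseteq> S" "\<And>i. i < dim (kernel_at \<G> p) \<Longrightarrow> smooth_on T (X i)"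
    "\<And>q. q \<in> T \<Longrightarrow> independent_family (dim (kernel_at \<G> p)) (\<lambda>i. X i q)"
    "\<And>q. q \<in> T \<Longrightarrow> span ((\<lambda>i. X i q) ` {..<dim (kernel_at \<G> p)}) = kernel_at \<G> q"
proof -
  let ?d = "dim (kernel_at \<G> p)"
  obtain w where w: "\<And>i. i < ?d \<Longrightarrow> w i \<in> kernel_at \<G> p" and ind: "independent_family ?d w"
    by (rule independent_family_exists[where S = "kernel_at \<G> p"]) blast
  have "\<forall>i. \<exists>TX. i < ?d \<longrightarrow> open (fst TX) \<and> p \<in> fst TX \<and> fst TX \<subseteq> S \<and> smooth_on (fst TX) (snd TX)
      \<and> snd TX p = w i \<and> (\<forall>q\<in>fst TX. snd TX q \<in> kernel_at \<G> q)"
    using smooth_section_of_kernel[OF S smooth rank w] by (metis fst_conv snd_conv)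
  then obtain TX where TX: "\<forall>i. i < ?d \<longrightarrow> open (fst (TX i)) \<and> p \<in> fst (TX i) \<and> fst (TX i) \<subseteq> S \<and>
      smooth_on (fst (TX i)) (snd (TX i)) \<and> snd (TX i) p = w i \<and> (\<forall>q\<in>fst (TX i). snd (TX i) q \<in> kernel_at \<G> q)"
    by (rule choice[THEN exE])
  define X where "X i = snd (TX i)" for i
  obtain T0 where T0: "open T0" "p \<in> T0" "T0 \<subseteq> S" "\<And>q. q \<in> T0 \<Longrightarrow> dim (rows_at \<G> p) \<le> dim (rows_at \<G> q)"
    using rank_lower_semicontinuous[OF S, of \<G>] smooth smooth_on_continuous_on by blast
  define T1 where "T1 = T0 \<inter> (\<Inter>i<?d. fst (TX i))"
  have T1: "open T1" "p \<in> T1" "T1 \<subseteq> S"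
    using T0 TX by (auto simp: T1_def intro!: open_Int open_INT)
  have X: "smooth_on T1 (X i)" "X i p = w i" "\<And>q. q \<in> T1 \<Longrightarrow> X i q \<in> kernel_at \<G> q" if "i < ?d" for i
    using TX that smooth_on_subset[of "fst (TX i)" "X i" T1] by (auto simp: X_def T1_def)
  have "independent_family ?d (\<lambda>i. X i p)"
    using ind unfolding independent_family_iff inj_on_def
    by (simp add: X(2) cong: image_cong_simp)
  then obtain T where T: "open T" "p \<in> T" "T \<subseteq> T1" "\<And>q. q \<in> T \<Longrightarrow> independent_family ?d (\<lambda>i. X i q)"
    using independent_family_nearby[OF T1(1,2), of ?d X] X(1) smooth_on_continuous_on by blast
  have "span ((\<lambda>i. X i q) ` {..<?d}) = kernel_at \<G> q" if q: "q \<in> T" for q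
  proof -
    have "dim (kernel_at \<G> q) \<le> ?d"
      using dim_kernel_at[of \<G> p] dim_kernel_at[of \<G> q] T0(4)[of q] q T(3) by (auto simp: T1_def)
    then have "span ((\<lambda>i. X i q) ` {..<?d}) = span (kernel_at \<G> q)"
      using T q X(3) by (intro independent_family_span_eq) auto
    then show ?thesis by (simp add: span_eq_iff subspace_kernel_at)
  qed
  moreover have "smooth_on T (X i)" if "i < ?d" for i
    using X(1)[OF that] T(3) smooth_on_subset by blast
  ultimately show thesis using T T1 by (intro that[of T X]) auto
qed

section \<open>Analytic connections on a trivial bundle\<close>

definition vec_power_series_on :: "real^'n::finite \<Rightarrow> real \<Rightarrow> (real^'n \<Rightarrow> 'e::real_inner) \<Rightarrow> bool"
  where "vec_power_series_on p r f \<longleftrightarrow> (\<forall>e. power_series_on p r (\<lambda>q. f q \<bullet> e))"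

lemma vec_power_series_on_const [simp]: "vec_power_series_on p r (\<lambda>_. c)"
  by (simp add: vec_power_series_on_def)

lemma vec_power_series_on_smooth:
  fixes f :: "real^'n::finite \<Rightarrow> 'e::euclidean_space"
  assumes "vec_power_series_on p r f"
  shows "smooth_on (ball p r) f"
proof (rule smooth_on_componentwise[OF open_ball power_series_on_smooth])
  show "power_series_on p r (\<lambda>q. f q \<bullet> b)" for b
    using assms by (simp add: vec_power_series_on_def)
qed

lemma frechet_derivative_inner:
  assumes "f differentiable at q"
  shows "frechet_derivative (\<lambda>q. f q \<bullet> e) (at q) h = frechet_derivative f (at q) h \<bullet> e"
  using frechet_derivative_eqI[OF has_derivative_inner_left[OF
        assms[unfolded frechet_derivative_works]], of e] by simp

lemma vec_power_series_on_frechet_derivative: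
  fixes f :: "real^'n::finite \<Rightarrow> 'e::euclidean_space"
  assumes "vec_power_series_on p r f"
  shows "vec_power_series_on p r (\<lambda>q. frechet_derivative f (at q) h)"
  unfolding vec_power_series_on_def
proof
  fix e
  have "power_series_on p r (\<lambda>q. frechet_derivative (\<lambda>q. f q \<bullet> e) (at q) h)"
    using assms unfolding vec_power_series_on_def by (blast intro: power_series_on_frechet_derivative)
  then show "power_series_on p r (\<lambda>q. frechet_derivative f (at q) h \<bullet> e)"
  proof (rule power_series_on_cong)
    fix q assume "q \<in> ball p r"
    then show "frechet_derivative (\<lambda>q. f q \<bullet> e) (at q) h = frechet_derivative f (at q) h \<bullet> e"
      by (intro frechet_derivative_inner smooth_on_differentiable[OF vec_power_series_on_smooth[OF assms]])
  qed
qed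

lemma vec_power_series_on_add:
  "vec_power_series_on p r f \<Longrightarrow> vec_power_series_on p r g \<Longrightarrow> vec_power_series_on p r (\<lambda>q. f q + g q)"
  unfolding vec_power_series_on_def by (auto simp: inner_add_left intro: power_series_on_add)

lemma vec_power_series_on_diff:
  "vec_power_series_on p r f \<Longrightarrow> vec_power_series_on p r g \<Longrightarrow> vec_power_series_on p r (\<lambda>q. f q - g q)"
  unfolding vec_power_series_on_def by (auto simp: inner_diff_left intro: power_series_on_diff)

lemma vec_power_series_on_inner:
  fixes f g :: "real^'n::finite \<Rightarrow> 'e::euclidean_space"
  assumes "vec_power_series_on p r f" "vec_power_series_on p r g"
  shows "power_series_on p r (\<lambda>q. f q \<bullet> g q)"
  using assms unfolding vec_power_series_on_def euclidean_inner[of "f _" "g _"]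
  by (intro power_series_on_sum power_series_on_mult) auto

lemma vec_power_series_on_linear_family:
  fixes \<Phi> :: "real^'n::finite \<Rightarrow> 'e::euclidean_space \<Rightarrow> 'f::euclidean_space"
  assumes "\<And>q. linear (\<Phi> q)" and \<Phi>: "\<And>w. vec_power_series_on p r (\<lambda>q. \<Phi> q w)"
    and f: "vec_power_series_on p r f"
  shows "vec_power_series_on p r (\<lambda>q. \<Phi> q (f q))"
proof -
  have "\<Phi> q (f q) \<bullet> e = (\<Sum>b\<in>Basis. (f q \<bullet> b) * (\<Phi> q b \<bullet> e))" for q e
    by (subst linear_Basis_expansion[OF assms(1)]) (simp add: inner_sum_left)
  moreover have "power_series_on p r (\<lambda>q. \<Sum>b\<in>Basis. (f q \<bullet> b) * (\<Phi> q b \<bullet> e))" for e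
    using f \<Phi> unfolding vec_power_series_on_def
    by (intro power_series_on_sum power_series_on_mult) auto
  ultimately show ?thesis by (simp add: vec_power_series_on_def)
qed

text \<open>\<open>C q h\<close> is the connection form at \<open>q\<close> in the direction \<open>h\<close>, so that the covariant derivative of a
  section \<open>\<xi>\<close> is \<open>\<partial>\<^sub>h \<xi> - C q h (\<xi> q)\<close>; \<open>base\<close> is the set of linear equations to begin with.\<close>

locale analytic_bundle_equations =
  fixes \<Omega> :: "(real^'n::finite) set"
    and C :: "real^'n \<Rightarrow> real^'n \<Rightarrow> 'e::euclidean_space \<Rightarrow> 'e"
    and base :: "(real^'n \<Rightarrow> 'e) set"
  assumes open_domain: "open \<Omega>"
    and linear_C: "linear (C q h)"
    and analytic: "p \<in> \<Omega> \<Longrightarrow> \<exists>r>0. ball p r \<subseteq> \<Omega> \<and>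
      (\<forall>h w. vec_power_series_on p r (\<lambda>q. C q h w)) \<and> (\<forall>g\<in>base. vec_power_series_on p r g)"
begin

definition cov :: "real^'n \<Rightarrow> (real^'n \<Rightarrow> 'e) \<Rightarrow> real^'n \<Rightarrow> 'e"
  where "cov h \<xi> q = frechet_derivative \<xi> (at q) h - C q h (\<xi> q)"

text \<open>The dual connection, chosen so that \<open>\<partial>\<^sub>h (g \<bullet> \<xi>) = dual_cov h g \<bullet> \<xi> + g \<bullet> cov h \<xi>\<close>.\<close>

definition dual_cov :: "real^'n \<Rightarrow> (real^'n \<Rightarrow> 'e) \<Rightarrow> real^'n \<Rightarrow> 'e"
  where "dual_cov h g q = frechet_derivative g (at q) h + adjoint (C q h) (g q)"

primrec rows :: "nat \<Rightarrow> (real^'n \<Rightarrow> 'e) set"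
  where "rows 0 = base"
  | "rows (Suc k) = {dual_cov h g | h g. g \<in> rows k}"

definition rows_upto :: "nat \<Rightarrow> (real^'n \<Rightarrow> 'e) set"
  where "rows_upto k = (\<Union>j\<le>k. rows j)"

definition all_rows :: "(real^'n \<Rightarrow> 'e) set"
  where "all_rows = (\<Union>j. rows j)"

lemma rows_upto_mono: "j \<le> k \<Longrightarrow> rows_upto j \<subseteq> rows_upto k"
  unfolding rows_upto_def by fastforce

lemma rows_upto_subset_all: "rows_upto k \<subseteq> all_rows"
  unfolding rows_upto_def all_rows_def by blast

lemma dual_cov_rows_upto: "g \<in> rows_upto k \<Longrightarrow> dual_cov h g \<in> rows_upto (Suc k)"
proof -
  assume "g \<in> rows_upto k"
  then obtain j where "j \<le> k" "g \<in> rows j" by (auto simp: rows_upto_def)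
  then have "Suc j \<le> Suc k" "dual_cov h g \<in> rows (Suc j)" by auto
  then show ?thesis unfolding rows_upto_def by blast
qed

lemma rows_upto_SucE:
  assumes "g \<in> rows_upto (Suc k)"
  shows "g \<in> rows_upto k \<or> (\<exists>h f. g = dual_cov h f \<and> f \<in> rows_upto k)"
proof -
  obtain l where l: "l \<le> Suc k" "g \<in> rows l" using assms by (auto simp: rows_upto_def)
  show ?thesis
  proof (cases "l \<le> k")
    case True
    then show ?thesis using l(2) unfolding rows_upto_def by blast
  next
    case False
    then have "l = Suc k" using l(1) by simp
    with l(2) obtain h f where "g = dual_cov h f" "f \<in> rows k" by auto
    then show ?thesis unfolding rows_upto_def by blast
  qed
qed

lemma dual_cov_all_rows: "g \<in> all_rows \<Longrightarrow> dual_cov h g \<in> all_rows"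
proof -
  assume "g \<in> all_rows"
  then obtain j where "g \<in> rows j" by (auto simp: all_rows_def)
  then have "dual_cov h g \<in> rows (Suc j)" by auto
  then show ?thesis unfolding all_rows_def by blast
qed

lemma inner_dual_cov: "dual_cov h g q \<bullet> w = frechet_derivative g (at q) h \<bullet> w + g q \<bullet> C q h w"
proof -
  have "adjoint (C q h) (g q) \<bullet> w = g q \<bullet> C q h w"
    using adjoint_works[OF linear_C, of w q h "g q"] by (simp only: inner_commute)
  then show ?thesis by (simp add: dual_cov_def inner_add_left)
qed

lemma connection_power_series:
  assumes "\<And>h w. vec_power_series_on p r (\<lambda>q. C q h w)"
  shows "vec_power_series_on p r f \<Longrightarrow> vec_power_series_on p r (cov h f)"
    and "vec_power_series_on p r f \<Longrightarrow> vec_power_series_on p r (dual_cov h f)"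
proof -
  assume f: "vec_power_series_on p r f"
  then have "vec_power_series_on p r (\<lambda>q. C q h (f q))"
    by (rule vec_power_series_on_linear_family[OF linear_C assms])
  then show "vec_power_series_on p r (cov h f)"
    unfolding cov_def[abs_def] by (intro vec_power_series_on_diff vec_power_series_on_frechet_derivative f)
  have "vec_power_series_on p r (\<lambda>q. frechet_derivative f (at q) h)"
    by (rule vec_power_series_on_frechet_derivative[OF f])
  then show "vec_power_series_on p r (dual_cov h f)"
    unfolding vec_power_series_on_def inner_dual_cov
    by (intro allI power_series_on_add vec_power_series_on_inner f assms)
      (auto simp: vec_power_series_on_def)
qed

lemma analytic_rows:
  assumes "p \<in> \<Omega>"
  obtains r where "0 < r" "ball p r \<subseteq> \<Omega>" "\<And>h w. vec_power_series_on p r (\<lambda>q. C q h w)"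
    "\<And>g. g \<in> all_rows \<Longrightarrow> vec_power_series_on p r g"
proof -
  obtain r where r: "0 < r" "ball p r \<subseteq> \<Omega>" and C: "\<And>h w. vec_power_series_on p r (\<lambda>q. C q h w)"
    and base: "\<And>g. g \<in> base \<Longrightarrow> vec_power_series_on p r g"
    using analytic[OF assms] by blast
  have "vec_power_series_on p r g" if "g \<in> rows k" for g k
    using that
  proof (induction k arbitrary: g)
    case (Suc k)
    then show ?case using connection_power_series(2)[OF C] by auto
  qed (use base in simp)
  then have "vec_power_series_on p r g" if "g \<in> all_rows" for g
    using that unfolding all_rows_def by blast
  with r C show thesis by (rule that)
qed

lemma smooth_rows:
  assumes "g \<in> all_rows"
  shows "smooth_on \<Omega> g"
proof (rule smooth_on_locally)
  fix p assume "p \<in> \<Omega>"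
  then obtain r where "0 < r" "vec_power_series_on p r g"
    using analytic_rows assms by metis
  then show "\<exists>T. open T \<and> p \<in> T \<and> smooth_on T g"
    by (intro exI[of _ "ball p r"]) (auto intro: vec_power_series_on_smooth)
qed

lemma frechet_derivative_pairing:
  assumes "g differentiable at q" "\<xi> differentiable at q"
  shows "frechet_derivative (\<lambda>q. g q \<bullet> \<xi> q) (at q) h = dual_cov h g q \<bullet> \<xi> q + g q \<bullet> cov h \<xi> q"
proof -
  have "((\<lambda>q. g q \<bullet> \<xi> q) has_derivative (\<lambda>h. g q \<bullet> frechet_derivative \<xi> (at q) h
      + frechet_derivative g (at q) h \<bullet> \<xi> q)) (at q)"
    using assms unfolding frechet_derivative_works by (rule has_derivative_inner)
  from frechet_derivative_eqI[OF this] show ?thesis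
    by (simp add: inner_dual_cov cov_def inner_diff_right)
qed

lemma pairing_derivative_zero:
  assumes "g \<in> all_rows" "open T" "T \<subseteq> \<Omega>" "smooth_on T \<xi>" "\<And>q. q \<in> T \<Longrightarrow> g q \<bullet> \<xi> q = 0" "q \<in> T"
  shows "dual_cov h g q \<bullet> \<xi> q + g q \<bullet> cov h \<xi> q = 0"
proof -
  have "dual_cov h g q \<bullet> \<xi> q + g q \<bullet> cov h \<xi> q = frechet_derivative (\<lambda>q. g q \<bullet> \<xi> q) (at q) h"
    using assms smooth_on_differentiable[OF smooth_rows] smooth_on_differentiable[OF assms(4)]
    by (intro frechet_derivative_pairing[symmetric]) auto
  also have "\<dots> = frechet_derivative (\<lambda>q. 0) (at q) h"
    using frechet_derivative_cong_open[OF assms(2,6), of "\<lambda>q. g q \<bullet> \<xi> q" "\<lambda>_. 0"] assms(5) by simp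
  finally show ?thesis by simp
qed

text \<open>The set of all equations is closed under differentiation, so differentiating \<open>g \<bullet> \<xi> = 0\<close> leaves
  \<open>g \<bullet> cov h \<xi> = 0\<close>.\<close>

lemma cov_in_kernel:
  assumes T: "open T" "T \<subseteq> \<Omega>" and \<xi>: "smooth_on T \<xi>" "\<And>q. q \<in> T \<Longrightarrow> \<xi> q \<in> kernel_at all_rows q"
    and "q \<in> T"
  shows "cov h \<xi> q \<in> kernel_at all_rows q"
  unfolding kernel_at_def mem_Collect_eq
proof
  fix g assume g: "g \<in> all_rows"
  have "dual_cov h g q \<bullet> \<xi> q + g q \<bullet> cov h \<xi> q = 0"
    using \<xi>(2) g by (intro pairing_derivative_zero[OF g T \<xi>(1) _ assms(5)]) (auto simp: kernel_at_def)
  moreover have "dual_cov h g q \<bullet> \<xi> q = 0"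
    using \<xi>(2)[OF assms(5)] dual_cov_all_rows[OF g] by (auto simp: kernel_at_def)
  ultimately show "g q \<bullet> cov h \<xi> q = 0" by simp
qed

subsection \<open>The rank of all equations is locally constant\<close>

text \<open>Each entry is a pairing, so its derivative splits into a part that differentiates the row and a
  part that differentiates the vector field.  The vector fields must be allowed to vary for the
  second part to be a minor of the same kind.\<close>

lemma frechet_derivative_minor:
  assumes g: "\<And>i. i < s \<Longrightarrow> g i differentiable at q" and v: "\<And>i. i < s \<Longrightarrow> v i differentiable at q"
  shows "frechet_derivative (\<lambda>q. minor s (\<lambda>i. g i q) (\<lambda>i. v i q)) (at q) h =
    (\<Sum>a<s. minor s (\<lambda>i. (g(a := dual_cov h (g a))) i q) (\<lambda>i. v i q))
    + (\<Sum>b<s. minor s (\<lambda>i. g i q) (\<lambda>i. (v(b := cov h (v b))) i q))"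
proof -
  define S where "S = {\<sigma>. \<sigma> permutes {..<s}}"
  define P where "P \<sigma> a = (\<Prod>i\<in>{..<s} - {a}. g i q \<bullet> v (\<sigma> i) q)" for \<sigma> a
  have lt: "\<sigma> i < s" if "\<sigma> \<in> S" "i < s" for \<sigma> i
    using that permutes_in_image[of \<sigma> "{..<s}" i] by (simp add: S_def)
  have pair: "((\<lambda>q. g i q \<bullet> v j q) has_derivative
      (\<lambda>h. dual_cov h (g i) q \<bullet> v j q + g i q \<bullet> cov h (v j) q)) (at q)" if "i < s" "j < s" for i j
  proof -
    have "(\<lambda>q. g i q \<bullet> v j q) differentiable at q"
      using g[OF that(1)] v[OF that(2)] unfolding differentiable_def by (blast intro: has_derivative_inner)
    moreover have "(\<lambda>h. dual_cov h (g i) q \<bullet> v j q + g i q \<bullet> cov h (v j) q)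
        = frechet_derivative (\<lambda>q. g i q \<bullet> v j q) (at q)"
      by (rule ext) (simp add: frechet_derivative_pairing[OF g[OF that(1)] v[OF that(2)]])
    ultimately show ?thesis by (simp add: frechet_derivative_works)
  qed
  have "((\<lambda>q. \<Prod>i<s. g i q \<bullet> v (\<sigma> i) q) has_derivative (\<lambda>h.
      \<Sum>a<s. (dual_cov h (g a) q \<bullet> v (\<sigma> a) q + g a q \<bullet> cov h (v (\<sigma> a)) q) * P \<sigma> a)) (at q)"
    if "\<sigma> \<in> S" for \<sigma>
    unfolding P_def
    by (rule has_derivative_prod[where f = "\<lambda>i q. g i q \<bullet> v (\<sigma> i) q"
          and f' = "\<lambda>i h. dual_cov h (g i) q \<bullet> v (\<sigma> i) q + g i q \<bullet> cov h (v (\<sigma> i)) q"])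
      (simp add: pair lt[OF that])
  then have "((\<lambda>q. minor s (\<lambda>i. g i q) (\<lambda>i. v i q)) has_derivative (\<lambda>h. \<Sum>\<sigma>\<in>S. of_int (sign \<sigma>) *
      (\<Sum>a<s. (dual_cov h (g a) q \<bullet> v (\<sigma> a) q + g a q \<bullet> cov h (v (\<sigma> a)) q) * P \<sigma> a))) (at q)"
    unfolding minor_def S_def[symmetric]
    by (rule has_derivative_sum[OF has_derivative_mult_right])
  then have "frechet_derivative (\<lambda>q. minor s (\<lambda>i. g i q) (\<lambda>i. v i q)) (at q) h
      = (\<Sum>\<sigma>\<in>S. of_int (sign \<sigma>) *
        (\<Sum>a<s. (dual_cov h (g a) q \<bullet> v (\<sigma> a) q + g a q \<bullet> cov h (v (\<sigma> a)) q) * P \<sigma> a))"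
    by (rule frechet_derivative_eqI[THEN fun_cong])
  also have "\<dots> = (\<Sum>\<sigma>\<in>S. \<Sum>a<s. of_int (sign \<sigma>) * ((dual_cov h (g a) q \<bullet> v (\<sigma> a) q) * P \<sigma> a))
      + (\<Sum>\<sigma>\<in>S. \<Sum>a<s. of_int (sign \<sigma>) * ((g a q \<bullet> cov h (v (\<sigma> a)) q) * P \<sigma> a))"
    by (simp add: sum_distrib_left distrib_left distrib_right sum.distrib)
  also have "(\<Sum>\<sigma>\<in>S. \<Sum>a<s. of_int (sign \<sigma>) * ((dual_cov h (g a) q \<bullet> v (\<sigma> a) q) * P \<sigma> a))
      = (\<Sum>a<s. minor s (\<lambda>i. (g(a := dual_cov h (g a))) i q) (\<lambda>i. v i q))"
    unfolding sum.swap[of _ "{..<s}" S]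
  proof (intro sum.cong refl)
    fix a assume a: "a \<in> {..<s}"
    have "(\<lambda>i. (g(a := dual_cov h (g a))) i q) = (\<lambda>i. g i q)(a := dual_cov h (g a) q)" by auto
    with a show "(\<Sum>\<sigma>\<in>S. of_int (sign \<sigma>) * ((dual_cov h (g a) q \<bullet> v (\<sigma> a) q) * P \<sigma> a))
        = minor s (\<lambda>i. (g(a := dual_cov h (g a))) i q) (\<lambda>i. v i q)"
      by (simp add: minor_update_row S_def P_def)
  qed
  also have "(\<Sum>\<sigma>\<in>S. \<Sum>a<s. of_int (sign \<sigma>) * ((g a q \<bullet> cov h (v (\<sigma> a)) q) * P \<sigma> a))
      = (\<Sum>b<s. minor s (\<lambda>i. g i q) (\<lambda>i. (v(b := cov h (v b))) i q))"
    unfolding minor_def S_def[symmetric] sum.swap[of _ S "{..<s}"]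
  proof (rule sum.cong[OF refl])
    fix \<sigma> assume "\<sigma> \<in> S"
    then have \<sigma>: "\<sigma> permutes {..<s}" by (simp add: S_def)
    have "(\<Sum>b<s. of_int (sign \<sigma>) * (\<Prod>i<s. g i q \<bullet> (v(b := cov h (v b))) (\<sigma> i) q))
        = (\<Sum>a<s. of_int (sign \<sigma>) * (\<Prod>i<s. g i q \<bullet> (v(\<sigma> a := cov h (v (\<sigma> a)))) (\<sigma> i) q))"
      by (subst sum.permute[OF \<sigma>]) (simp add: o_def)
    also have "\<dots> = (\<Sum>a<s. of_int (sign \<sigma>) * ((g a q \<bullet> cov h (v (\<sigma> a)) q) * P \<sigma> a))"
    proof (intro sum.cong refl arg_cong2[where f = "(*)"])
      fix a assume a: "a \<in> {..<s}"
      have "\<sigma> i \<noteq> \<sigma> a" if "i \<noteq> a" for i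
        using permutes_inj[OF \<sigma>] that by (meson injD)
      then show "(\<Prod>i<s. g i q \<bullet> (v(\<sigma> a := cov h (v (\<sigma> a)))) (\<sigma> i) q) = (g a q \<bullet> cov h (v (\<sigma> a)) q) * P \<sigma> a"
        unfolding P_def using a by (subst prod.remove[of _ a]) (auto intro!: prod.cong)
    qed
    finally show "(\<Sum>a<s. of_int (sign \<sigma>) * ((g a q \<bullet> cov h (v (\<sigma> a)) q) * P \<sigma> a))
        = (\<Sum>b<s. of_int (sign \<sigma>) * (\<Prod>i<s. g i q \<bullet> (v(b := cov h (v b))) (\<sigma> i) q))" by simp
  qed
  finally show ?thesis .
qed

text \<open>Sums are included to make the family closed under differentiation.\<close>

inductive_set minor_sums :: "real^'n \<Rightarrow> real \<Rightarrow> nat \<Rightarrow> (real^'n \<Rightarrow> real) set"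
  for p r s where
    minor: "(\<And>i. i < s \<Longrightarrow> g i \<in> all_rows) \<Longrightarrow> (\<And>i. i < s \<Longrightarrow> vec_power_series_on p r (v i)) \<Longrightarrow>
      (\<lambda>q. minor s (\<lambda>i. g i q) (\<lambda>i. v i q)) \<in> minor_sums p r s"
  | zero: "(\<lambda>_. 0) \<in> minor_sums p r s"
  | add: "f \<in> minor_sums p r s \<Longrightarrow> g \<in> minor_sums p r s \<Longrightarrow> (\<lambda>q. f q + g q) \<in> minor_sums p r s"

lemma minor_sums_sum:
  "(\<And>i. i \<in> I \<Longrightarrow> f i \<in> minor_sums p r s) \<Longrightarrow> (\<lambda>q. \<Sum>i\<in>I. f i q) \<in> minor_sums p r s"
  by (induction I rule: infinite_finite_induct) (auto intro: minor_sums.intros)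

text \<open>If the rows have rank \<open>\<rho>\<close> at \<open>p\<close>, all their minors of size \<open>\<rho> + 1\<close> vanish at \<open>p\<close>, and so do all
  derivatives of these minors.  By analyticity the minors vanish near \<open>p\<close>, where the rank
  therefore does not exceed \<open>\<rho>\<close>.\<close>

proposition rank_upper_semicontinuous:
  assumes "p \<in> \<Omega>"
  shows "\<exists>r>0. ball p r \<subseteq> \<Omega> \<and> (\<forall>q\<in>ball p r. dim (rows_at all_rows q) \<le> dim (rows_at all_rows p))"
proof -
  obtain r where r: "0 < r" "ball p r \<subseteq> \<Omega>" and C: "\<And>h w. vec_power_series_on p r (\<lambda>q. C q h w)"
    and rows: "\<And>g. g \<in> all_rows \<Longrightarrow> vec_power_series_on p r g"
    by (rule analytic_rows[OF assms]) blast
  define s where "s = Suc (dim (rows_at all_rows p))"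
  have ps: "power_series_on p r f" if "f \<in> minor_sums p r s" for f
    using that
  proof induction
    case (minor g v)
    have "power_series_on p r (\<lambda>q. g i q \<bullet> v (\<sigma> i) q)" if "i \<in> {..<s}" "\<sigma> \<in> {\<sigma>. \<sigma> permutes {..<s}}" for i \<sigma>
      using that permutes_in_image[of \<sigma> "{..<s}" i]
      by (intro vec_power_series_on_inner rows minor) auto
    then show ?case
      unfolding minor_def by (intro power_series_on_sum power_series_on_cmult power_series_on_prod)
  qed (auto intro: power_series_on_add)
  have zero: "f p = 0" if "f \<in> minor_sums p r s" for f
    using that
  proof induction
    case (minor g v)
    have "\<not> independent_family s (\<lambda>i. g i p)"
    proof
      assume "independent_family s (\<lambda>i. g i p)"
      then have "s \<le> dim (rows_at all_rows p)"
        by (rule independent_family_le_dim) (use minor in auto)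
      then show False by (simp add: s_def)
    qed
    then show ?case by (rule minor_eq_0_if_dependent)
  qed auto
  have diff: "f differentiable at q" if "vec_power_series_on p r f" "q \<in> ball p r" for f :: "real^'n \<Rightarrow> 'e" and q
    by (rule smooth_on_differentiable[OF vec_power_series_on_smooth[OF that(1)] that(2)])
  have deriv: "\<exists>g\<in>minor_sums p r s. \<forall>q\<in>ball p r. frechet_derivative f (at q) h = g q"
    if "f \<in> minor_sums p r s" for f h
    using that
  proof induction
    case (minor g v)
    let ?D = "\<lambda>q. (\<Sum>a<s. minor s (\<lambda>i. (g(a := dual_cov h (g a))) i q) (\<lambda>i. v i q))
      + (\<Sum>b<s. minor s (\<lambda>i. g i q) (\<lambda>i. (v(b := cov h (v b))) i q))"
    have "?D \<in> minor_sums p r s"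
      using minor dual_cov_all_rows connection_power_series(1)[OF C]
      by (intro minor_sums.add minor_sums_sum minor_sums.minor) auto
    moreover have "frechet_derivative (\<lambda>q. minor s (\<lambda>i. g i q) (\<lambda>i. v i q)) (at q) h = ?D q"
      if "q \<in> ball p r" for q
      by (rule frechet_derivative_minor; rule diff[OF _ that]) (use minor rows in auto)
    ultimately show ?case by (intro bexI[of _ ?D]) auto
  next
    case zero
    show ?case by (rule bexI[OF _ minor_sums.zero]) simp
  next
    case (add f g)
    then obtain f' g' where fg: "f' \<in> minor_sums p r s" "g' \<in> minor_sums p r s"
      "\<And>q. q \<in> ball p r \<Longrightarrow> frechet_derivative f (at q) h = f' q"
      "\<And>q. q \<in> ball p r \<Longrightarrow> frechet_derivative g (at q) h = g' q" by blast
    have "frechet_derivative (\<lambda>q. f q + g q) (at q) h = f' q + g' q" if q: "q \<in> ball p r" for q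
    proof -
      have "f differentiable at q" "g differentiable at q"
        using power_series_on_differentiable ps add.hyps q by blast+
      then have "((\<lambda>q. f q + g q) has_derivative
          (\<lambda>h. frechet_derivative f (at q) h + frechet_derivative g (at q) h)) (at q)"
        unfolding frechet_derivative_works by (rule has_derivative_add)
      from frechet_derivative_eqI[OF this] show ?thesis using fg(3,4)[OF q] by simp
    qed
    then show ?case using minor_sums.add[OF fg(1,2)] by (intro bexI[of _ "\<lambda>q. f' q + g' q"]) auto
  qed
  have "dim (rows_at all_rows q) \<le> dim (rows_at all_rows p)" if q: "q \<in> ball p r" for q
  proof (rule ccontr)
    assume "\<not> ?thesis"
    then have s: "s \<le> dim (rows_at all_rows q)" by (simp add: s_def)
    obtain h where h: "\<And>i. i < dim (rows_at all_rows q) \<Longrightarrow> h i \<in> all_rows"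
      "independent_family (dim (rows_at all_rows q)) (\<lambda>i. h i q)"
      by (rule rank_family_exists[where \<G> = all_rows and p = q]) blast
    then obtain v where v: "minor s (\<lambda>i. h i q) v \<noteq> 0"
      using minor_nonzero_exists[OF independent_family_mono[OF h(2) s]] by blast
    have "(\<lambda>q. minor s (\<lambda>i. h i q) (\<lambda>i. (\<lambda>i _. v i) i q)) \<in> minor_sums p r s"
      using s by (intro minor_sums.minor h) auto
    then have mem: "(\<lambda>q. minor s (\<lambda>i. h i q) v) \<in> minor_sums p r s" by simp
    have "minor s (\<lambda>i. h i q) v = 0"
    proof (rule power_series_family_vanishes[where \<F> = "minor_sums p r s" and r = r and p = p and q = q
            and f = "\<lambda>q. minor s (\<lambda>i. h i q) v"])
      show "power_series_on p r f" "f p = 0"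
        "\<exists>g\<in>minor_sums p r s. \<forall>q\<in>ball p r. frechet_derivative f (at q) h = g q"
        if "f \<in> minor_sums p r s" for f h
        by (rule ps[OF that], rule zero[OF that], rule deriv[OF that])
    qed (rule r(1) mem q)+
    with v show False by contradiction
  qed
  with r show ?thesis by blast
qed

subsection \<open>Finitely many derivatives suffice on a dense set\<close>

text \<open>If a generation of equations adds nothing on an open set where the rank is constant, then no later
  one does: a solution \<open>w\<close> extends to a section of solutions, the covariant derivative of the section
  is again a solution, and differentiating \<open>g \<bullet> \<xi> = 0\<close> yields the next generation of equations for
  \<open>w\<close>.\<close>

lemma kernel_stabilizes:
  assumes T: "open T" "T \<subseteq> \<Omega>" and eq: "\<And>q. q \<in> T \<Longrightarrow> kernel_at (rows_upto i) q = kernel_at (rows_upto (Suc i)) q"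
    and rank: "\<And>q q'. q \<in> T \<Longrightarrow> q' \<in> T \<Longrightarrow> dim (rows_at (rows_upto i) q) = dim (rows_at (rows_upto i) q')"
    and "q \<in> T"
  shows "kernel_at (rows_upto i) q = kernel_at all_rows q"
proof -
  have step: "kernel_at (rows_upto i) q \<subseteq> kernel_at (rows_upto (Suc i + j)) q" if "q \<in> T" for j q
    using that
  proof (induction j arbitrary: q)
    case 0
    then show ?case using eq by simp
  next
    case (Suc j)
    show ?case
    proof
      fix w assume w: "w \<in> kernel_at (rows_upto i) q"
      have "smooth_on T g" if "g \<in> rows_upto i" for g
        using smooth_rows rows_upto_subset_all that smooth_on_subset[OF _ T(2)] by blast
      then obtain T' \<xi> where T': "open T'" "q \<in> T'" "T' \<subseteq> T" "smooth_on T' \<xi>" "\<xi> q = w"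
        and \<xi>: "\<And>q. q \<in> T' \<Longrightarrow> \<xi> q \<in> kernel_at (rows_upto i) q"
        using smooth_section_of_kernel[OF T(1) Suc.prems, of "rows_upto i" w] rank Suc.prems w by (metis le_refl)
      have ker: "\<xi> q' \<in> kernel_at (rows_upto (Suc i + j)) q'" if "q' \<in> T'" for q'
        using Suc.IH[of q'] \<xi>[OF that] T'(3) that by blast
      have deriv: "dual_cov h g q \<bullet> w + g q \<bullet> cov h \<xi> q = 0" if "g \<in> rows_upto (Suc i + j)" for g h
        using pairing_derivative_zero[of g T' \<xi> q h] that ker T' T(2) rows_upto_subset_all
        unfolding kernel_at_def by blast
      have "cov h \<xi> q \<in> kernel_at (rows_upto i) q" for h
        unfolding kernel_at_def mem_Collect_eq
      proof
        fix g assume g: "g \<in> rows_upto i"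
        then have "dual_cov h g \<in> rows_upto (Suc i + j)"
          using dual_cov_rows_upto rows_upto_mono[of "Suc i" "Suc i + j"] by auto
        then have "dual_cov h g q \<bullet> w = 0"
          using ker[OF T'(2)] T'(5) unfolding kernel_at_def by blast
        moreover have "g \<in> rows_upto (Suc i + j)"
          using g rows_upto_mono[of i "Suc i + j"] by auto
        ultimately show "g q \<bullet> cov h \<xi> q = 0" using deriv[where g = g and h = h] by simp
      qed
      then have cov: "cov h \<xi> q \<in> kernel_at (rows_upto (Suc i + j)) q" for h
        using Suc.IH[OF Suc.prems] by blast
      show "w \<in> kernel_at (rows_upto (Suc i + Suc j)) q"
        unfolding kernel_at_def mem_Collect_eq
      proof
        fix g assume "g \<in> rows_upto (Suc i + Suc j)"
        then have "g \<in> rows_upto (Suc i + j) \<or> (\<exists>h f. g = dual_cov h f \<and> f \<in> rows_upto (Suc i + j))"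
          by (intro rows_upto_SucE) simp
        then show "g q \<bullet> w = 0"
        proof (elim disjE exE conjE)
          assume "g \<in> rows_upto (Suc i + j)"
          then show ?thesis using ker[OF T'(2)] T'(5) unfolding kernel_at_def by blast
        next
          fix h f assume f: "g = dual_cov h f" "f \<in> rows_upto (Suc i + j)"
          then have "f q \<bullet> cov h \<xi> q = 0" using cov unfolding kernel_at_def by blast
          then show ?thesis using deriv[OF f(2), of h] f(1) by simp
        qed
      qed
    qed
  qed
  show ?thesis
  proof (rule antisym)
    show "kernel_at (rows_upto i) q \<subseteq> kernel_at all_rows q"
    proof
      fix w assume w: "w \<in> kernel_at (rows_upto i) q"
      have "g q \<bullet> w = 0" if "g \<in> rows j" for g j
      proof -
        have "g \<in> rows_upto (Suc i + j)" using that by (auto simp: rows_upto_def)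
        then show ?thesis using step[OF assms(5), of j] w unfolding kernel_at_def by blast
      qed
      then show "w \<in> kernel_at all_rows q" by (auto simp: kernel_at_def all_rows_def)
    qed
    show "kernel_at all_rows q \<subseteq> kernel_at (rows_upto i) q"
      by (rule kernel_at_antimono[OF rows_upto_subset_all])
  qed
qed

text \<open>At a point where the sum of the ranks of the first systems is maximal in \<open>U\<close>, all these
  ranks are locally constant.  There are more of them than dimensions, so two consecutive ones
  coincide.\<close>

lemma kernel_stabilizes_somewhere:
  assumes U: "open U" "U \<subseteq> \<Omega>" "U \<noteq> {}"
  shows "\<exists>y\<in>U. kernel_at (rows_upto (Suc DIM('e))) y = kernel_at all_rows y"
proof -
  let ?N = "Suc DIM('e)"
  define \<rho> where "\<rho> i q = dim (rows_at (rows_upto i) q)" for i q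
  have le: "\<rho> i q \<le> DIM('e)" for i q by (simp add: \<rho>_def dim_subset_UNIV)
  have "(\<Sum>i\<le>?N. \<rho> i q) < Suc (Suc ?N * DIM('e))" for q
    using sum_bounded_above[of "{..?N}" "\<lambda>i. \<rho> i q" "DIM('e)"] le by simp
  moreover obtain q0 where "q0 \<in> U" using U(3) by blast
  ultimately obtain y where y: "y \<in> U" "\<And>q. q \<in> U \<Longrightarrow> (\<Sum>i\<le>?N. \<rho> i q) \<le> (\<Sum>i\<le>?N. \<rho> i y)"
    using ex_has_greatest_nat[of "\<lambda>q. q \<in> U" q0 "\<lambda>q. \<Sum>i\<le>?N. \<rho> i q"] by blast
  have "\<exists>T. open T \<and> y \<in> T \<and> T \<subseteq> U \<and> (\<forall>q\<in>T. \<rho> i y \<le> \<rho> i q)" for i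
  proof -
    have "continuous_on U g" if "g \<in> rows_upto i" for g
      using smooth_on_continuous_on[OF smooth_on_subset[OF smooth_rows U(2)]] that rows_upto_subset_all by blast
    from rank_lower_semicontinuous[OF U(1) y(1) this] show ?thesis unfolding \<rho>_def by metis
  qed
  then have "\<exists>T. \<forall>i. open (T i) \<and> y \<in> T i \<and> T i \<subseteq> U \<and> (\<forall>q\<in>T i. \<rho> i y \<le> \<rho> i q)"
    by (rule choice[OF allI])
  then obtain T where T: "\<And>i. open (T i)" "\<And>i. y \<in> T i" "\<And>i. T i \<subseteq> U"
    "\<And>i q. q \<in> T i \<Longrightarrow> \<rho> i y \<le> \<rho> i q" by blast
  define T' where "T' = (\<Inter>i\<le>?N. T i)"
  have T': "open T'" "y \<in> T'" "T' \<subseteq> U"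
    using T(1,2) T(3)[of 0] unfolding T'_def by (auto intro!: open_INT)
  have const: "\<rho> i q = \<rho> i y" if q: "q \<in> T'" and i: "i \<le> ?N" for i q
  proof (rule antisym[OF _ T(4)])
    show "q \<in> T i" using q i by (auto simp: T'_def)
    show "\<rho> i q \<le> \<rho> i y"
    proof (rule ccontr)
      assume "\<not> \<rho> i q \<le> \<rho> i y"
      moreover have "\<rho> j y \<le> \<rho> j q" if "j \<le> ?N" for j using T(4) that q by (auto simp: T'_def)
      ultimately have "(\<Sum>j\<le>?N. \<rho> j y) < (\<Sum>j\<le>?N. \<rho> j q)"
        using i by (intro sum_strict_mono_ex1) (auto intro: bexI[of _ i])
      then show False using y(2)[of q] q T'(3) by auto
    qed
  qed
  have "\<exists>i<?N. \<rho> i y = \<rho> (Suc i) y"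
  proof (rule ccontr)
    assume *: "\<not> ?thesis"
    have "\<rho> i y \<le> \<rho> (Suc i) y" for i
      unfolding \<rho>_def by (intro dim_subset image_mono rows_upto_mono) simp
    then have lt: "\<rho> i y < \<rho> (Suc i) y" if "i < ?N" for i
      using * that by (metis le_neq_implies_less)
    have "i \<le> ?N \<Longrightarrow> i \<le> \<rho> i y" for i
    proof (induction i)
      case (Suc i)
      then show ?case using lt[of i] by simp
    qed simp
    from this[of ?N] le[of ?N y] show False by simp
  qed
  then obtain i where i: "i < ?N" "\<rho> i y = \<rho> (Suc i) y" by blast
  have rank: "\<rho> (Suc i) q = \<rho> i q" if "q \<in> T'" for q
    using const[OF that, of i] const[OF that, of "Suc i"] i by simp
  have "kernel_at (rows_upto i) y = kernel_at all_rows y"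
  proof (rule kernel_stabilizes[OF T'(1) _ _ _ T'(2)])
    show "T' \<subseteq> \<Omega>" using T'(3) U(2) by blast
    show "kernel_at (rows_upto i) q = kernel_at (rows_upto (Suc i)) q" if "q \<in> T'" for q
      using rank[OF that] by (intro kernel_at_eq_if_dim_eq rows_upto_mono) (auto simp: \<rho>_def)
    show "dim (rows_at (rows_upto i) q) = dim (rows_at (rows_upto i) q')" if "q \<in> T'" "q' \<in> T'" for q q'
      using const[OF that(1), of i] const[OF that(2), of i] i(1) by (simp add: \<rho>_def)
  qed
  moreover have "kernel_at (rows_upto ?N) y \<subseteq> kernel_at (rows_upto i) y"
    using i(1) by (intro kernel_at_antimono rows_upto_mono) simp
  moreover have "kernel_at all_rows y \<subseteq> kernel_at (rows_upto ?N) y"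
    by (rule kernel_at_antimono[OF rows_upto_subset_all])
  ultimately show ?thesis using y(1) by (intro bexI[of _ y]) auto
qed

text \<open>Otherwise some equation fails on a nonempty open set, which contains a point where the first
  generations already imply all others.\<close>

lemma section_in_kernel:
  assumes T: "open T" "T \<subseteq> \<Omega>" and \<xi>: "smooth_on T \<xi>"
    "\<And>q. q \<in> T \<Longrightarrow> \<xi> q \<in> kernel_at (rows_upto (Suc DIM('e))) q"
    and q: "q \<in> T"
  shows "\<xi> q \<in> kernel_at all_rows q"
  unfolding kernel_at_def mem_Collect_eq
proof (intro ballI, rule ccontr)
  fix g assume g: "g \<in> all_rows" and nz: "g q \<bullet> \<xi> q \<noteq> 0"
  define U where "U = T \<inter> (\<lambda>q. g q \<bullet> \<xi> q) -` (- {0})"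
  have "continuous_on T (\<lambda>q. g q \<bullet> \<xi> q)"
    using smooth_on_continuous_on[OF smooth_on_subset[OF smooth_rows[OF g] T(2)]]
      smooth_on_continuous_on[OF \<xi>(1)] by (rule continuous_on_inner)
  then have "open U" unfolding U_def using T(1) by (intro continuous_open_preimage) auto
  moreover have "U \<subseteq> \<Omega>" "U \<noteq> {}" using T(2) q nz by (auto simp: U_def)
  ultimately obtain y where y: "y \<in> U" "kernel_at (rows_upto (Suc DIM('e))) y = kernel_at all_rows y"
    using kernel_stabilizes_somewhere by blast
  then have "\<xi> y \<in> kernel_at all_rows y" using \<xi>(2) by (auto simp: U_def)
  then show False using y(1) g by (auto simp: U_def kernel_at_def)
qed

end

(* Charts are pairs but are treated as single objects. *)
declare split_paired_All [simp del] split_paired_Ex [simp del]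

section \<open>Analytic manifolds, tangent vectors and forms in charts\<close>

lemma smooth_on_matrix_mult:
  fixes F :: "'a::real_normed_vector \<Rightarrow> real^'n^'m" and G :: "'a \<Rightarrow> real^'k^'n"
  assumes "open S" "smooth_on S F" "smooth_on S G"
  shows "smooth_on S (\<lambda>p. F p ** G p)"
  by (intro smooth_on_vecI[OF assms(1)])
    (simp add: matrix_matrix_mult_def smooth_on_sum smooth_on_mult smooth_on_vec_nth assms)

lemma smooth_on_matrix_vector_mult:
  fixes F :: "'a::real_normed_vector \<Rightarrow> real^'n^'m" and g :: "'a \<Rightarrow> real^'n"
  assumes "open S" "smooth_on S F" "smooth_on S g"
  shows "smooth_on S (\<lambda>p. F p *v g p)"
  by (intro smooth_on_vecI[OF assms(1)])
    (simp add: matrix_vector_mult_def smooth_on_sum smooth_on_mult smooth_on_vec_nth assms)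

lemma smooth_on_transpose:
  fixes F :: "'a::real_normed_vector \<Rightarrow> real^'n^'m"
  assumes "open S" "smooth_on S F"
  shows "smooth_on S (\<lambda>p. transpose (F p))"
  by (intro smooth_on_vecI[OF assms(1)])
    (simp add: Finite_Cartesian_Product.transpose_def smooth_on_vec_nth assms)

lemma smooth_map_subset: "smooth_map A U f \<Longrightarrow> V \<subseteq> U \<Longrightarrow> smooth_map A V f"
  unfolding smooth_map_def by (blast intro: smooth_on_subset)

lemma vector_field_subset: "vector_field A U Y \<Longrightarrow> V \<subseteq> U \<Longrightarrow> vector_field A V Y"
  unfolding vector_field_def by (blast intro: smooth_map_subset)

lemma form_section_subset: "form_section A U X \<Longrightarrow> V \<subseteq> U \<Longrightarrow> form_section A V X"
  unfolding form_section_def by (blast intro: smooth_map_subset)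

lemma matrix_mult_add_distrib: "(A::real^'n^'m) ** (B + C) = A ** B + A ** C"
  "(D + E) ** (F::real^'n^'m) = D ** F + E ** F"
  by (simp_all add: matrix_matrix_mult_def vec_eq_iff distrib_left distrib_right sum.distrib)

lemma matrix_mult_scaleR: "(A::real^'n^'m) ** (r *\<^sub>R B) = r *\<^sub>R (A ** B)"
  "(r *\<^sub>R D) ** (F::real^'n^'m) = r *\<^sub>R (D ** F)"
  by (simp_all add: matrix_matrix_mult_def vec_eq_iff sum_distrib_left mult_ac)

lemma transpose_linear: "transpose (A + B :: real^'n^'m)
    = transpose A + transpose B"
  "transpose (r *\<^sub>R A) = r *\<^sub>R transpose A"
  "transpose (0 :: real^'n^'m) = 0"
  by (simp_all add: Finite_Cartesian_Product.transpose_def vec_eq_iff)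

lemma tangent_zero: "v \<in> tangent_space A x \<Longrightarrow> c \<notin> charts_at A x \<Longrightarrow> v c = 0"
  and tangent_transform: "v \<in> tangent_space A x \<Longrightarrow> c \<in> charts_at A x \<Longrightarrow> c' \<in> charts_at A x \<Longrightarrow>
    v c' = jac c c' x *v v c"
  unfolding tangent_space_def by blast+

lemma subspace_tangent_space: "subspace (tangent_space A x)"
  unfolding subspace_def
proof (intro conjI ballI allI)
  show "0 \<in> tangent_space A x" by (simp add: tangent_space_def)
  show "u + v \<in> tangent_space A x" if u: "u \<in> tangent_space A x" and v: "v \<in> tangent_space A x" for u v
    unfolding tangent_space_def mem_Collect_eq
    by (intro conjI allI impI ballI)
      (simp_all add: tangent_zero[OF u] tangent_zero[OF v] matrix_vector_right_distrib, metis tangent_transform u v)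
  show "r *\<^sub>R u \<in> tangent_space A x" if u: "u \<in> tangent_space A x" for r u
    unfolding tangent_space_def mem_Collect_eq
    by (simp add: scaleR_fun_def tangent_zero[OF u] matrix_vector_mult_scaleR)
      (metis tangent_transform u)
qed

lemma form_zero: "w \<in> sym_forms A x \<Longrightarrow> c \<notin> charts_at A x \<Longrightarrow> w c = 0"
  and form_transpose: "w \<in> sym_forms A x \<Longrightarrow> c \<in> charts_at A x \<Longrightarrow> transpose (w c) = w c"
  and form_transform: "w \<in> sym_forms A x \<Longrightarrow> c \<in> charts_at A x \<Longrightarrow> c' \<in> charts_at A x \<Longrightarrow>
    w c = transpose (jac c c' x) ** w c' ** jac c c' x"
  unfolding sym_forms_def by blast+

lemma subspace_sym_forms: "subspace (sym_forms A x)"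
  unfolding subspace_def
proof (intro conjI ballI allI)
  show "0 \<in> sym_forms A x" by (simp add: sym_forms_def transpose_linear)
  show "u + v \<in> sym_forms A x" if u: "u \<in> sym_forms A x" and v: "v \<in> sym_forms A x" for u v
    unfolding sym_forms_def mem_Collect_eq
    by (simp add: form_zero[OF u] form_zero[OF v] transpose_linear form_transpose[OF u] form_transpose[OF v]
        matrix_mult_add_distrib) (metis form_transform u v)
  show "r *\<^sub>R u \<in> sym_forms A x" if u: "u \<in> sym_forms A x" for r u
    unfolding sym_forms_def mem_Collect_eq
    by (simp add: scaleR_fun_def form_zero[OF u] transpose_linear form_transpose[OF u] matrix_mult_scaleR)
      (metis form_transform u)
qed

lemma linear_fun_apply: "linear (\<lambda>w :: 'a \<Rightarrow> 'b::real_vector. w c)"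
  by (rule linearI) (simp_all add: scaleR_fun_def)

locale atlas =
  fixes A :: "('m::{t2_space, second_countable_topology}, 'n::finite) chart set"
  assumes atlas: "analytic_atlas A"
begin

lemma chart_open: "c \<in> A \<Longrightarrow> open (fst c)" "c \<in> A \<Longrightarrow> open (snd c ` fst c)"
  and chart_homeomorphism: "c \<in> A \<Longrightarrow> homeomorphism (fst c) (snd c ` fst c) (snd c) (chart_inv c)"
  and transition_analytic: "c \<in> A \<Longrightarrow> c' \<in> A \<Longrightarrow>
    real_analytic_on (snd c ` (fst c \<inter> fst c')) (transition c c')"
  using atlas unfolding analytic_atlas_def by blast+

lemma chart_exists: "\<exists>c\<in>A. x \<in> fst c"
  using atlas unfolding analytic_atlas_def by blast

lemma chart_inv_left: "c \<in> A \<Longrightarrow> x \<in> fst c \<Longrightarrow> chart_inv c (snd c x) = x"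
  using chart_homeomorphism by (rule homeomorphism_apply1)

lemma chart_inv_image:
  assumes "c \<in> A" "U \<subseteq> fst c" "p \<in> snd c ` U"
  shows "chart_inv c p \<in> U" "snd c (chart_inv c p) = p"
  using assms chart_inv_left[OF assms(1)] by auto

lemma chart_image_open: "c \<in> A \<Longrightarrow> open U \<Longrightarrow> open (snd c ` (U \<inter> fst c))"
  using homeomorphism_imp_open_map[OF chart_homeomorphism, of c "U \<inter> fst c"]
  by (simp add: openin_open_eq chart_open open_Int)

lemma chart_image_open': "c \<in> A \<Longrightarrow> open U \<Longrightarrow> U \<subseteq> fst c \<Longrightarrow> open (snd c ` U)"
  using chart_image_open[of c U] by (simp add: inf_absorb1)

lemma chart_preimage_open:
  assumes "c \<in> A" "open T"
  shows "open {y \<in> fst c. snd c y \<in> T}"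
proof -
  have "continuous_on (fst c) (snd c)"
    using chart_homeomorphism[OF assms(1)] by (rule homeomorphism_cont1)
  from continuous_open_preimage[OF this chart_open(1)[OF assms(1)] assms(2)]
  show ?thesis by (simp add: vimage_def Int_def)
qed

lemma transition_smooth:
  "c \<in> A \<Longrightarrow> c' \<in> A \<Longrightarrow> smooth_on (snd c ` (fst c \<inter> fst c')) (transition c c')"
  by (intro real_analytic_on_smooth_on transition_analytic)

lemma overlap_open: "c \<in> A \<Longrightarrow> c' \<in> A \<Longrightarrow> open (snd c ` (fst c \<inter> fst c'))"
  using chart_image_open[of c "fst c'"] chart_open by (simp add: Int_commute)

lemma transition_apply: "c \<in> A \<Longrightarrow> x \<in> fst c \<Longrightarrow> transition c c' (snd c x) = snd c' x"
  by (simp add: transition_def chart_inv_left)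

text \<open>Transition maps are smooth, so smoothness may be tested in any one chart that covers \<open>U\<close>.\<close>

lemma smooth_on_chart_change:
  assumes c: "c \<in> A" "c' \<in> A" and U: "open U" "U \<subseteq> fst c"
    and f: "smooth_on (snd c ` U) (\<lambda>p. f (chart_inv c p))"
  shows "smooth_on (snd c' ` (U \<inter> fst c')) (\<lambda>p. f (chart_inv c' p))"
proof -
  have S: "open (snd c' ` (U \<inter> fst c'))" by (rule chart_image_open[OF c(2) U(1)])
  have inv: "chart_inv c' p \<in> U \<inter> fst c'" if "p \<in> snd c' ` (U \<inter> fst c')" for p
    using chart_inv_image(1)[OF c(2) _ that] by auto
  have "smooth_on (snd c' ` (U \<inter> fst c')) (\<lambda>p. (\<lambda>q. f (chart_inv c q)) (transition c' c p))"
  proof (rule smooth_on_compose[OF S chart_image_open'[OF c(1) U] f])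
    show "smooth_on (snd c' ` (U \<inter> fst c')) (transition c' c)"
      by (rule smooth_on_subset[OF transition_smooth[OF c(2,1)]]) (use U in auto)
    show "transition c' c ` snd c' ` (U \<inter> fst c') \<subseteq> snd c ` U"
      using inv unfolding transition_def by blast
  qed
  then show ?thesis
  proof (rule smooth_on_transfer[OF _ S])
    fix p assume "p \<in> snd c' ` (U \<inter> fst c')"
    from inv[OF this] U(2) show "f (chart_inv c' p) = f (chart_inv c (transition c' c p))"
      using chart_inv_left[OF c(1)] unfolding transition_def by auto
  qed
qed

lemma smooth_mapI:
  assumes "c \<in> A" "open U" "U \<subseteq> fst c" "smooth_on (snd c ` U) (\<lambda>p. f (chart_inv c p))"
  shows "smooth_map A U f"
  unfolding smooth_map_def using smooth_on_chart_change[OF assms(1) _ assms(2-)] by blast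

lemma smooth_mapD: "smooth_map A U f \<Longrightarrow> c \<in> A \<Longrightarrow> smooth_on (snd c ` (U \<inter> fst c)) (\<lambda>p. f (chart_inv c p))"
  unfolding smooth_map_def by blast

lemma smooth_mapD': "smooth_map A U f \<Longrightarrow> c \<in> A \<Longrightarrow> U \<subseteq> fst c \<Longrightarrow> smooth_on (snd c ` U) (\<lambda>p. f (chart_inv c p))"
  using smooth_mapD[of U f c] by (simp add: inf_absorb1)

subsection \<open>Jacobians\<close>

lemma transition_has_derivative:
  assumes "c \<in> A" "c' \<in> A" "x \<in> fst c" "x \<in> fst c'"
  shows "(transition c c' has_derivative (\<lambda>h. jac c c' x *v h)) (at (snd c x))"
proof -
  have "(transition c c' has_derivative frechet_derivative (transition c c') (at (snd c x))) (at (snd c x))"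
    by (rule smooth_on_has_derivative[OF transition_smooth[OF assms(1,2)]]) (use assms in auto)
  moreover from this have "linear (frechet_derivative (transition c c') (at (snd c x)))"
    by (rule has_derivative_linear)
  ultimately show ?thesis by (simp add: jac_def matrix_works)
qed

lemma jac_apply:
  "c \<in> A \<Longrightarrow> c' \<in> A \<Longrightarrow> x \<in> fst c \<Longrightarrow> x \<in> fst c' \<Longrightarrow>
    jac c c' x *v h = frechet_derivative (transition c c') (at (snd c x)) h"
  using frechet_derivative_eqI[OF transition_has_derivative] by simp

lemma jac_cocycle:
  assumes c: "c \<in> A" "c' \<in> A" "c'' \<in> A" and x: "x \<in> fst c" "x \<in> fst c'" "x \<in> fst c''"
  shows "jac c' c'' x ** jac c c' x = jac c c'' x"
proof -
  let ?S = "snd c ` ((fst c' \<inter> fst c'') \<inter> fst c)"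
  have "((\<lambda>p. transition c' c'' (transition c c' p)) has_derivative (\<lambda>h. jac c' c'' x *v (jac c c' x *v h))) (at (snd c x))"
    using diff_chain_at[OF transition_has_derivative[OF c(1,2) x(1,2)], of "transition c' c''" "\<lambda>h. jac c' c'' x *v h"]
      transition_has_derivative[OF c(2,3) x(2,3)] by (simp add: transition_apply c x o_def)
  moreover have "open ?S" by (intro chart_image_open c open_Int chart_open)
  moreover have "snd c x \<in> ?S" using x by auto
  moreover have "transition c' c'' (transition c c' p) = transition c c'' p" if "p \<in> ?S" for p
    using that by (auto simp: transition_apply c transition_def chart_inv_left)
  ultimately have "(transition c c'' has_derivative (\<lambda>h. jac c' c'' x *v (jac c c' x *v h))) (at (snd c x))"
    by (rule has_derivative_transform_within_open)
  from frechet_derivative_eqI[OF this] show ?thesis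
    using c x by (subst matrix_eq) (simp add: jac_apply[OF c(1,3) x(1,3)] matrix_vector_mul_assoc)
qed

lemma jac_self: 
  assumes "c \<in> A" "x \<in> fst c"
  shows "jac c c x = mat 1"
proof -
  have "frechet_derivative (transition c c) (at (snd c x)) = frechet_derivative (\<lambda>p. p) (at (snd c x))"
    by (rule frechet_derivative_cong_open[OF chart_open(2)[OF assms(1)]])
      (use assms in \<open>auto simp: transition_apply\<close>)
  then show ?thesis by (simp add: jac_def matrix_id_mat_1[unfolded id_def])
qed

lemma jac_inverse:
  "c \<in> A \<Longrightarrow> c' \<in> A \<Longrightarrow> x \<in> fst c \<Longrightarrow> x \<in> fst c' \<Longrightarrow> jac c' c x ** jac c c' x = mat 1"
  by (simp add: jac_cocycle jac_self)

lemma jac_smooth: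
  assumes "c \<in> A" "c' \<in> A"
  shows "smooth_on (snd c ` (fst c \<inter> fst c')) (\<lambda>p. jac c c' (chart_inv c p))"
proof -
  let ?S = "snd c ` (fst c \<inter> fst c')"
  have S: "open ?S" by (rule overlap_open[OF assms])
  have eq: "jac c c' (chart_inv c p) $ i $ j = frechet_derivative (transition c c') (at p) (axis j 1) $ i"
    if "p \<in> ?S" for p i j
  proof -
    have "chart_inv c p \<in> fst c \<inter> fst c'" "snd c (chart_inv c p) = p"
      using chart_inv_image[OF assms(1) _ that] by auto
    then have "jac c c' (chart_inv c p) *v axis j 1 = frechet_derivative (transition c c') (at p) (axis j 1)"
      using jac_apply[OF assms, of "chart_inv c p"] by simp
    moreover have "jac c c' (chart_inv c p) $ i $ j = (jac c c' (chart_inv c p) *v axis j 1) $ i"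
      by (simp add: matrix_vector_mult_basis column_def)
    ultimately show ?thesis by simp
  qed
  have "smooth_on ?S (\<lambda>p. frechet_derivative (transition c c') (at p) (axis j 1) $ i)" for i j
    by (intro smooth_on_vec_nth S smooth_on_frechet_derivative transition_smooth assms)
  from smooth_on_transfer[OF this S eq]
  have "smooth_on ?S (\<lambda>p. jac c c' (chart_inv c p) $ i $ j)" for i j by blast
  then show ?thesis by (intro smooth_on_vecI S)
qed

lemma jac_smooth_map: "c \<in> A \<Longrightarrow> c' \<in> A \<Longrightarrow> smooth_map A (fst c \<inter> fst c') (jac c c')"
  by (rule smooth_mapI[of c]) (auto intro: jac_smooth chart_open)

subsection \<open>Tangent vectors\<close>

lemma tangent_change:
  "v \<in> tangent_space A x \<Longrightarrow> c \<in> A \<Longrightarrow> c' \<in> A \<Longrightarrow> x \<in> fst c \<Longrightarrow> x \<in> fst c' \<Longrightarrow> v c' = jac c c' x *v v c"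
  by (rule tangent_transform) (auto simp: charts_at_def)

lemma coord_field_apply: "c' \<in> A \<Longrightarrow> x \<in> fst c' \<Longrightarrow> coord_field A c h x c' = jac c c' x *v h"
  by (simp add: coord_field_def charts_at_def)

lemma coord_field_self: "c \<in> A \<Longrightarrow> x \<in> fst c \<Longrightarrow> coord_field A c h x c = h"
  by (simp add: coord_field_apply jac_self)

lemma coord_field_tangent:
  "c \<in> A \<Longrightarrow> x \<in> fst c \<Longrightarrow> coord_field A c h x \<in> tangent_space A x"
  by (auto simp: tangent_space_def coord_field_def charts_at_def matrix_vector_mul_assoc jac_cocycle)

lemma coord_field_vector_field:
  assumes "c \<in> A"
  shows "vector_field A (fst c) (coord_field A c h)"
  unfolding vector_field_def
proof (intro conjI ballI)
  fix c' assume c': "c' \<in> A"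
  have S: "open (fst c \<inter> fst c')" by (intro open_Int chart_open assms c')
  show "smooth_map A (fst c \<inter> fst c') (\<lambda>x. coord_field A c h x c')"
  proof (rule smooth_mapI[OF assms S])
    have "smooth_on (snd c ` (fst c \<inter> fst c')) (\<lambda>p. jac c c' (chart_inv c p) *v h)"
      by (intro smooth_on_matrix_vector_mult smooth_on_const overlap_open jac_smooth assms c')
    then show "smooth_on (snd c ` (fst c \<inter> fst c')) (\<lambda>p. coord_field A c h (chart_inv c p) c')"
    proof (rule smooth_on_transfer[OF _ overlap_open[OF assms c']])
      fix p assume "p \<in> snd c ` (fst c \<inter> fst c')"
      from chart_inv_image(1)[OF assms _ this]
      show "coord_field A c h (chart_inv c p) c' = jac c c' (chart_inv c p) *v h"
        by (simp add: coord_field_apply c')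
    qed
  qed auto
qed (use coord_field_tangent[OF assms] in auto)

lemma tangent_eqI:
  assumes "v \<in> tangent_space A x" "v' \<in> tangent_space A x" "c \<in> A" "x \<in> fst c" "v c = v' c"
  shows "v = v'"
proof
  fix c'
  show "v c' = v' c'"
  proof (cases "c' \<in> charts_at A x")
    case True
    then show ?thesis
      using tangent_change[OF assms(1,3), of c'] tangent_change[OF assms(2,3), of c'] assms(4,5)
      by (simp add: charts_at_def)
  next
    case False
    then show ?thesis using tangent_zero assms(1,2) by metis
  qed
qed

lemma sum_fun_apply: "(\<Sum>k\<in>K. f k) c = (\<Sum>k\<in>K. f k c)"
  by (induction K rule: infinite_finite_induct) auto

lemma tangent_expansion:
  assumes "v \<in> tangent_space A x" "c \<in> A" "x \<in> fst c"
  shows "v = (\<Sum>k\<in>UNIV. (v c $ k) *\<^sub>R coord_field A c (axis k 1) x)"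
proof (rule tangent_eqI[OF assms(1) _ assms(2,3)])
  show "(\<Sum>k\<in>UNIV. (v c $ k) *\<^sub>R coord_field A c (axis k 1) x) \<in> tangent_space A x"
    by (intro subspace_sum subspace_scale subspace_tangent_space coord_field_tangent assms)
  show "v c = (\<Sum>k\<in>UNIV. (v c $ k) *\<^sub>R coord_field A c (axis k 1) x) c"
    by (simp add: sum_fun_apply scaleR_fun_def coord_field_self assms basis_expansion
        flip: scalar_mult_eq_scaleR)
qed

lemma tangent_coord_field:
  assumes "v \<in> tangent_space A x" "c \<in> A" "x \<in> fst c"
  shows "coord_field A c (v c) x = v"
  by (rule tangent_eqI[OF _ assms]) (simp_all add: assms coord_field_self coord_field_tangent)

lemma vector_field_smooth:
  assumes "vector_field A U Y" "c \<in> A" "open U" "U \<subseteq> fst c"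
  shows "smooth_on (snd c ` U) (\<lambda>p. Y (chart_inv c p) c)"
proof -
  have "smooth_map A (U \<inter> fst c) (\<lambda>x. Y x c)"
    using assms(1,2) unfolding vector_field_def by blast
  then show ?thesis
    using smooth_mapD'[OF _ assms(2)] assms(4) by (simp add: inf_absorb1)
qed

subsection \<open>Symmetric forms\<close>

lemma form_change:
  "w \<in> sym_forms A x \<Longrightarrow> c \<in> A \<Longrightarrow> c' \<in> A \<Longrightarrow> x \<in> fst c \<Longrightarrow> x \<in> fst c' \<Longrightarrow>
    w c = transpose (jac c c' x) ** w c' ** jac c c' x"
  by (rule form_transform) (auto simp: charts_at_def)

lemma form_symmetric: "w \<in> sym_forms A x \<Longrightarrow> c \<in> A \<Longrightarrow> x \<in> fst c \<Longrightarrow> transpose (w c) = w c"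
  by (rule form_transpose) (auto simp: charts_at_def)

lemma form_eqI:
  assumes "w \<in> sym_forms A x" "w' \<in> sym_forms A x" "c \<in> A" "x \<in> fst c" "w c = w' c"
  shows "w = w'"
proof
  fix c'
  show "w c' = w' c'"
  proof (cases "c' \<in> charts_at A x")
    case True
    then show ?thesis
      using form_change[OF assms(1) _ assms(3) _ assms(4), of c'] form_change[OF assms(2) _ assms(3) _ assms(4), of c'] assms(5)
      by (simp add: charts_at_def)
  next
    case False
    then show ?thesis using form_zero assms(1,2) by metis
  qed
qed

lemma coord_form_apply: "c' \<in> A \<Longrightarrow> x \<in> fst c' \<Longrightarrow>
    coord_form A c m x c' = transpose (jac c' c x) ** m ** jac c' c x"
  by (simp add: coord_form_def charts_at_def)

lemma coord_form_self: "c \<in> A \<Longrightarrow> x \<in> fst c \<Longrightarrow> coord_form A c m x c = m"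
  by (simp add: coord_form_apply jac_self Finite_Cartesian_Product.transpose_mat)

lemma coord_form_sym:
  assumes "c \<in> A" "x \<in> fst c" "transpose m = m"
  shows "coord_form A c m x \<in> sym_forms A x"
  unfolding sym_forms_def mem_Collect_eq
proof (intro conjI ballI allI impI)
  fix c' assume c': "c' \<in> charts_at A x"
  show "transpose (coord_form A c m x c') = coord_form A c m x c'"
    using c' by (simp add: coord_form_apply charts_at_def matrix_transpose_mul assms matrix_mul_assoc)
  fix c'' assume c'': "c'' \<in> charts_at A x"
  show "coord_form A c m x c' = transpose (jac c' c'' x) ** coord_form A c m x c'' ** jac c' c'' x"
  proof -
    have J: "jac c' c x = jac c'' c x ** jac c' c'' x"
      using c' c'' assms by (simp add: jac_cocycle charts_at_def)
    show ?thesis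
      using c' c'' by (simp add: coord_form_apply charts_at_def J matrix_transpose_mul matrix_mul_assoc)
  qed
qed (simp add: coord_form_def)

lemma form_coord_form:
  assumes "w \<in> sym_forms A x" "c \<in> A" "x \<in> fst c"
  shows "coord_form A c (w c) x = w"
  by (rule form_eqI[OF coord_form_sym[OF assms(2,3) form_symmetric[OF assms]] assms])
    (simp add: assms coord_form_self)

lemma linear_coord_form: "linear (\<lambda>m. coord_form A c m x)"
  by (rule linearI) (auto simp: coord_form_def fun_eq_iff scaleR_fun_def matrix_mult_add_distrib matrix_mult_scaleR)

lemma form_section_smooth:
  assumes "form_section A U X" "c \<in> A" "open U" "U \<subseteq> fst c"
  shows "smooth_on (snd c ` U) (\<lambda>p. X (chart_inv c p) c)"
proof -
  have "smooth_map A (U \<inter> fst c) (\<lambda>x. X x c)"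
    using assms(1,2) unfolding form_section_def by blast
  then show ?thesis
    using smooth_mapD'[OF _ assms(2)] assms(4) by (simp add: inf_absorb1)
qed

text \<open>The components in one chart determine the others through the Jacobians, which are smooth.\<close>

lemma form_sectionI:
  assumes c: "c \<in> A" and U: "open U" "U \<subseteq> fst c" and sym: "\<And>y. y \<in> U \<Longrightarrow> X y \<in> sym_forms A y"
    and smooth: "smooth_on (snd c ` U) (\<lambda>p. X (chart_inv c p) c)"
  shows "form_section A U X"
  unfolding form_section_def
proof (intro conjI ballI)
  fix c' assume c': "c' \<in> A"
  let ?S = "snd c ` (U \<inter> fst c')"
  have UU: "open (U \<inter> fst c')" "U \<inter> fst c' \<subseteq> fst c" using U chart_open(1)[OF c'] by auto
  have S: "open ?S" by (rule chart_image_open'[OF c UU])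
  show "smooth_map A (U \<inter> fst c') (\<lambda>x. X x c')"
  proof (rule smooth_mapI[OF c UU])
    have J: "smooth_on ?S (\<lambda>p. jac c' c (chart_inv c p))"
      by (rule smooth_on_subset[OF smooth_mapD[OF jac_smooth_map[OF c' c] c]]) (use UU in auto)
    have "smooth_on ?S (\<lambda>p. X (chart_inv c p) c)"
      by (rule smooth_on_subset[OF smooth]) auto
    then have "smooth_on ?S (\<lambda>p. transpose (jac c' c (chart_inv c p)) ** X (chart_inv c p) c ** jac c' c (chart_inv c p))"
      by (intro smooth_on_matrix_mult smooth_on_transpose S J)
    then show "smooth_on ?S (\<lambda>p. X (chart_inv c p) c')"
    proof (rule smooth_on_transfer[OF _ S])
      fix p assume "p \<in> ?S"
      then have "chart_inv c p \<in> U \<inter> fst c'" by (rule chart_inv_image(1)[OF c UU(2)])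
      then show "X (chart_inv c p) c' = transpose (jac c' c (chart_inv c p)) ** X (chart_inv c p) c ** jac c' c (chart_inv c p)"
        using U by (intro form_change sym c c') auto
    qed
  qed
qed (use sym in auto)

lemma coord_form_section:
  assumes c: "c \<in> A" and U: "open U" "U \<subseteq> fst c" and \<xi>: "smooth_on (snd c ` U) \<xi>"
    and sym: "\<And>y. y \<in> U \<Longrightarrow> transpose (\<xi> (snd c y)) = \<xi> (snd c y)"
  shows "form_section A U (\<lambda>y. coord_form A c (\<xi> (snd c y)) y)"
proof (rule form_sectionI[OF c U])
  show "coord_form A c (\<xi> (snd c y)) y \<in> sym_forms A y" if "y \<in> U" for y
    by (rule coord_form_sym) (use that c U sym in auto)
  show "smooth_on (snd c ` U) (\<lambda>p. coord_form A c (\<xi> (snd c (chart_inv c p))) (chart_inv c p) c)"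
  proof (rule smooth_on_transfer[OF \<xi> chart_image_open'[OF c U]])
    fix p assume "p \<in> snd c ` U"
    from chart_inv_image[OF c U(2) this] U(2)
    show "coord_form A c (\<xi> (snd c (chart_inv c p))) (chart_inv c p) c = \<xi> p"
      using coord_form_self[OF c] by auto
  qed
qed

lemma form_apply_chart_independent:
  assumes "w \<in> sym_forms A x" "u \<in> tangent_space A x" "v \<in> tangent_space A x"
    and "c \<in> A" "c' \<in> A" "x \<in> fst c" "x \<in> fst c'"
  shows "form_apply c w u v = form_apply c' w u v"
proof -
  have "u c' = jac c c' x *v u c" "v c' = jac c c' x *v v c"
    using tangent_change assms by blast+
  moreover have "w c = transpose (jac c c' x) ** w c' ** jac c c' x"
    using form_change assms by blast
  moreover have "u c \<bullet> (transpose (jac c c' x) *v z) = (jac c c' x *v u c) \<bullet> z" for z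
    by (metis dot_lmul_matrix inner_commute transpose_matrix_vector)
  ultimately show ?thesis
    by (simp add: form_apply_def matrix_vector_mul_assoc[symmetric])
qed

end

section \<open>The induced connection in charts\<close>

lemma vec_power_series_second_derivative_symmetric:
  fixes f :: "real^'n::finite \<Rightarrow> 'e::euclidean_space"
  assumes f: "vec_power_series_on p r f" and q: "q \<in> ball p r"
  shows "frechet_derivative (\<lambda>q. frechet_derivative f (at q) h) (at q) k
    = frechet_derivative (\<lambda>q. frechet_derivative f (at q) k) (at q) h"
proof -
  have D2: "frechet_derivative (\<lambda>q. frechet_derivative f (at q) h) (at q) k \<bullet> e
      = frechet_derivative (\<lambda>q. frechet_derivative (\<lambda>q. f q \<bullet> e) (at q) h) (at q) k" for h k e
  proof -
    have diff: "f differentiable at q'" if "q' \<in> ball p r" for q'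
      by (rule smooth_on_differentiable[OF vec_power_series_on_smooth[OF f] that])
    have "(\<lambda>q. frechet_derivative f (at q) h) differentiable at q"
      by (rule smooth_on_differentiable[OF smooth_on_frechet_derivative[OF vec_power_series_on_smooth[OF f]] q])
    then have "frechet_derivative (\<lambda>q. frechet_derivative f (at q) h) (at q) k \<bullet> e
        = frechet_derivative (\<lambda>q. frechet_derivative f (at q) h \<bullet> e) (at q) k"
      by (rule frechet_derivative_inner[symmetric])
    also have "\<dots> = frechet_derivative (\<lambda>q. frechet_derivative (\<lambda>q. f q \<bullet> e) (at q) h) (at q) k"
      by (rule frechet_derivative_cong_open[THEN fun_cong, OF open_ball q])
        (rule frechet_derivative_inner[symmetric, OF diff])
    finally show ?thesis .
  qed
  show ?thesis
  proof (rule euclidean_eqI)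
    fix b :: 'e
    have "power_series_on p r (\<lambda>q. f q \<bullet> b)" using f by (simp add: vec_power_series_on_def)
    from power_series_on_second_derivative_symmetric[OF this q]
    show "frechet_derivative (\<lambda>q. frechet_derivative f (at q) h) (at q) k \<bullet> b
      = frechet_derivative (\<lambda>q. frechet_derivative f (at q) k) (at q) h \<bullet> b"
      unfolding D2 .
  qed
qed

lemma vec_power_series_on_matrixI:
  fixes F :: "real^'n::finite \<Rightarrow> real^'a^'b"
  assumes "\<And>i j. power_series_on p r (\<lambda>q. F q $ i $ j)"
  shows "vec_power_series_on p r F"
  unfolding vec_power_series_on_def inner_vec_def
  by (auto intro!: power_series_on_sum power_series_on_mult assms)

lemma bilinear_basis_expansion:
  fixes M :: "real^'n^'n" and x y :: "real^'n" and b d :: "'n \<Rightarrow> real^'n"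
  shows "(\<Sum>i\<in>UNIV. x $ i *\<^sub>R b i) \<bullet> (M *v (\<Sum>j\<in>UNIV. y $ j *\<^sub>R d j))
    = (\<Sum>i\<in>UNIV. \<Sum>j\<in>UNIV. x $ i * y $ j * (b i \<bullet> (M *v d j)))"
proof -
  have "M *v (\<Sum>j\<in>UNIV. y $ j *\<^sub>R d j) = (\<Sum>j\<in>UNIV. y $ j *\<^sub>R (M *v d j))"
    by (simp add: linear_sum[OF matrix_vector_mul_linear] matrix_vector_mult_scaleR)
  then have "(\<Sum>i\<in>UNIV. x $ i *\<^sub>R b i) \<bullet> (M *v (\<Sum>j\<in>UNIV. y $ j *\<^sub>R d j))
      = (\<Sum>j\<in>UNIV. \<Sum>i\<in>UNIV. x $ i * y $ j * (b i \<bullet> (M *v d j)))"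
    by (simp add: inner_sum_left inner_sum_right sum_distrib_left mult_ac)
  also have "\<dots> = (\<Sum>i\<in>UNIV. \<Sum>j\<in>UNIV. x $ i * y $ j * (b i \<bullet> (M *v d j)))"
    by (rule sum.swap)
  finally show ?thesis .
qed

lemma axis_expansion: "(\<Sum>k\<in>UNIV. x $ k *\<^sub>R axis k 1) = (x :: real^'n)"
  using basis_expansion[of x] by (simp add: scalar_mult_eq_scaleR)

lemma axis_inner_matrix: "axis i 1 \<bullet> (M *v axis j 1) = (M :: real^'n^'n) $ i $ j"
  by (simp add: inner_axis' matrix_vector_mult_basis column_def)

lemma inner_matrix_expansion:
  "x \<bullet> ((M :: real^'n^'n) *v y) = (\<Sum>i\<in>UNIV. \<Sum>j\<in>UNIV. x $ i * y $ j * M $ i $ j)"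
  using bilinear_basis_expansion[of x "\<lambda>i. axis i 1" M y "\<lambda>j. axis j 1"]
  by (simp add: axis_expansion axis_inner_matrix)

lemma congruence_entry:
  fixes J N :: "real^'n^'n"
  shows "(transpose J ** N ** J) $ i $ j = (J *v axis i 1) \<bullet> (N *v (J *v axis j 1))"
proof -
  have "(transpose J ** N ** J) $ i $ j
      = axis i 1 \<bullet> (transpose J *v (N *v (J *v axis j 1)))"
    by (simp add: matrix_vector_mul_assoc axis_inner_matrix matrix_mul_assoc)
  also have "\<dots> = (J *v axis i 1) \<bullet> (N *v (J *v axis j 1))"
    by (metis dot_lmul_matrix inner_commute transpose_matrix_vector)
  finally show ?thesis .
qed

lemma form_apply_commute:
  assumes "transpose (w c) = w c"
  shows "form_apply c w u v = form_apply c w v u"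
  unfolding form_apply_def using assms by (metis dot_lmul_matrix inner_commute transpose_matrix_vector)

locale atlas_connection = atlas A
  for A :: "('m::{t2_space, second_countable_topology}, 'n::finite) chart set" +
  fixes D :: "('m, 'n) cov_deriv"
  assumes analytic_connection: "analytic_connection A D"
begin

lemma connection: "connection A D"
  using analytic_connection by (simp add: analytic_connection_def)

lemma
  assumes "open U" "vector_field A U Y" "x \<in> U"
  shows D_tangent: "v \<in> tangent_space A x \<Longrightarrow> D x v Y \<in> tangent_space A x"
    and D_add_direction: "v \<in> tangent_space A x \<Longrightarrow> v' \<in> tangent_space A x \<Longrightarrow>
      D x (v + v') Y = D x v Y + D x v' Y"
    and D_scale_direction: "v \<in> tangent_space A x \<Longrightarrow> D x (r *\<^sub>R v) Y = r *\<^sub>R D x v Y"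
    and D_leibniz: "smooth_map A U f \<Longrightarrow> v \<in> tangent_space A x \<Longrightarrow> c \<in> A \<Longrightarrow> x \<in> fst c \<Longrightarrow>
      D x v (\<lambda>y. f y *\<^sub>R Y y) = chart_deriv c f x (v c) *\<^sub>R Y x + f x *\<^sub>R D x v Y"
    and D_add_field: "vector_field A U Z \<Longrightarrow> v \<in> tangent_space A x \<Longrightarrow>
      D x v (\<lambda>y. Y y + Z y) = D x v Y + D x v Z"
    and D_cong: "vector_field A U Z \<Longrightarrow> v \<in> tangent_space A x \<Longrightarrow> (\<And>y. y \<in> U \<Longrightarrow> Y y = Z y) \<Longrightarrow>
      D x v Y = D x v Z"
proof -
  note C = connection[unfolded connection_def, THEN spec, THEN mp, OF assms(1)]
  note C1 = C[THEN conjunct1, THEN spec, THEN mp, OF assms(2)]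
    and C2 = C[THEN conjunct2, THEN spec, THEN spec, THEN mp, OF conjI, OF assms(2)]
  show "v \<in> tangent_space A x \<Longrightarrow> D x v Y \<in> tangent_space A x"
    by (rule C1[THEN conjunct1, THEN bspec, THEN bspec, OF assms(3)])
  show "v \<in> tangent_space A x \<Longrightarrow> v' \<in> tangent_space A x \<Longrightarrow> D x (v + v') Y = D x v Y + D x v' Y"
    by (rule C1[THEN conjunct2, THEN conjunct1, THEN bspec, THEN bspec, THEN bspec, OF assms(3)])
  show "v \<in> tangent_space A x \<Longrightarrow> D x (r *\<^sub>R v) Y = r *\<^sub>R D x v Y"
    by (rule C1[THEN conjunct2, THEN conjunct2, THEN conjunct1, THEN bspec, THEN bspec, THEN spec, OF assms(3)])
  show "D x v (\<lambda>y. f y *\<^sub>R Y y) = chart_deriv c f x (v c) *\<^sub>R Y x + f x *\<^sub>R D x v Y"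
    if "smooth_map A U f" "v \<in> tangent_space A x" "c \<in> A" "x \<in> fst c"
    by (rule C1[THEN conjunct2, THEN conjunct2, THEN conjunct2, THEN conjunct2, THEN spec, THEN mp,
          THEN bspec, THEN bspec, THEN bspec, OF that(1) assms(3) that(2)])
      (simp add: charts_at_def that)
  show "vector_field A U Z \<Longrightarrow> v \<in> tangent_space A x \<Longrightarrow> D x v (\<lambda>y. Y y + Z y) = D x v Y + D x v Z"
    by (rule C2[THEN conjunct1, THEN bspec, THEN bspec, OF _ assms(3)])
  show "D x v Y = D x v Z"
    if "vector_field A U Z" "v \<in> tangent_space A x" "\<And>y. y \<in> U \<Longrightarrow> Y y = Z y"
    by (rule C2[THEN conjunct2, THEN mp, THEN bspec, THEN bspec, OF that(1) _ assms(3) that(2)])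
      (use that(3) in blast)
qed

lemma D_vector_field:
  assumes "open U" "vector_field A U Y" "vector_field A U V"
  shows "vector_field A U (\<lambda>x. D x (V x) Y)"
proof -
  note C = connection[unfolded connection_def, THEN spec, THEN mp, OF assms(1)]
  show ?thesis
    by (rule C[THEN conjunct1, THEN spec, THEN mp, OF assms(2), THEN conjunct2, THEN conjunct2,
          THEN conjunct2, THEN conjunct1, THEN spec, THEN mp, OF assms(3)])
qed

lemma D_sum_direction:
  assumes "open U" "vector_field A U Y" "x \<in> U" "\<And>k. k \<in> K \<Longrightarrow> v k \<in> tangent_space A x" "finite K"
  shows "D x (\<Sum>k\<in>K. a k *\<^sub>R v k) Y = (\<Sum>k\<in>K. a k *\<^sub>R D x (v k) Y)"
  using assms(5,4)
proof (induction K)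
  case empty
  have "D x (0 *\<^sub>R 0) Y = 0 *\<^sub>R D x 0 Y"
    by (rule D_scale_direction[OF assms(1-3)]) (simp add: subspace_0 subspace_tangent_space)
  then show ?case by (simp only: scaleR_zero_left sum.empty)
next
  case (insert k K)
  have K: "(\<Sum>k\<in>K. a k *\<^sub>R v k) \<in> tangent_space A x"
    using insert by (intro subspace_sum subspace_scale subspace_tangent_space) auto
  have k: "v k \<in> tangent_space A x" using insert by simp
  have "D x (a k *\<^sub>R v k + (\<Sum>k\<in>K. a k *\<^sub>R v k)) Y = D x (a k *\<^sub>R v k) Y + D x (\<Sum>k\<in>K. a k *\<^sub>R v k) Y"
    by (rule D_add_direction[OF assms(1-3) subspace_scale[OF subspace_tangent_space k] K])
  also have "D x (a k *\<^sub>R v k) Y = a k *\<^sub>R D x (v k) Y"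
    by (rule D_scale_direction[OF assms(1-3) k])
  also have "D x (\<Sum>k\<in>K. a k *\<^sub>R v k) Y = (\<Sum>k\<in>K. a k *\<^sub>R D x (v k) Y)"
    by (rule insert.IH) (use insert.prems in blast)
  finally show ?case by (simp only: sum.insert[OF insert.hyps])
qed

lemma smooth_map_mult:
  fixes f :: "'m \<Rightarrow> real" and g :: "'m \<Rightarrow> 'b::real_normed_vector"
  assumes "open U" "smooth_map A U f" "smooth_map A U g"
  shows "smooth_map A U (\<lambda>x. f x *\<^sub>R g x)"
  using assms chart_image_open unfolding smooth_map_def by (auto intro!: smooth_on_scaleR)

lemma smooth_map_add:
  assumes "open U" "smooth_map A U f" "smooth_map A U g"
  shows "smooth_map A U (\<lambda>x. f x + g x)"
  using assms chart_image_open unfolding smooth_map_def by (auto intro!: smooth_on_add)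

lemma smooth_map_const: "open U \<Longrightarrow> smooth_map A U (\<lambda>x. k)"
  using chart_image_open unfolding smooth_map_def by (auto intro!: smooth_on_const)

lemma vector_field_scale:
  assumes "open U" "smooth_map A U f" "vector_field A U Y"
  shows "vector_field A U (\<lambda>y. f y *\<^sub>R Y y)"
  unfolding vector_field_def
proof (intro conjI ballI)
  show "f x *\<^sub>R Y x \<in> tangent_space A x" if "x \<in> U" for x
    using assms(3) that unfolding vector_field_def by (blast intro: subspace_scale subspace_tangent_space)
  show "smooth_map A (U \<inter> fst c) (\<lambda>x. (f x *\<^sub>R Y x) c)" if "c \<in> A" for c
    using assms that smooth_map_subset[OF assms(2)] chart_open(1)[OF that] unfolding vector_field_def scaleR_fun_def
    by (intro smooth_map_mult) auto
qed

lemma vector_field_add: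
  assumes "open U" "vector_field A U Y" "vector_field A U Z"
  shows "vector_field A U (\<lambda>y. Y y + Z y)"
  unfolding vector_field_def
proof (intro conjI ballI)
  show "Y x + Z x \<in> tangent_space A x" if "x \<in> U" for x
    using assms(2,3) that unfolding vector_field_def by (blast intro: subspace_add subspace_tangent_space)
  show "smooth_map A (U \<inter> fst c) (\<lambda>x. (Y x + Z x) c)" if "c \<in> A" for c
    using assms that chart_open(1)[OF that] unfolding vector_field_def plus_fun_apply
    by (intro smooth_map_add) auto
qed

lemma vector_field_zero: "open U \<Longrightarrow> vector_field A U (\<lambda>y. 0)"
  unfolding vector_field_def
  using chart_open subspace_0[OF subspace_tangent_space]
  by (auto intro!: smooth_map_const[of _ 0, folded zero_fun_apply])

lemma vector_field_sum:
  assumes "open U" "finite K" "\<And>k. k \<in> K \<Longrightarrow> vector_field A U (Y k)"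
  shows "vector_field A U (\<lambda>y. \<Sum>k\<in>K. Y k y)"
  using assms(2,3) by (induction K) (auto intro: vector_field_zero vector_field_add assms(1))

lemma D_sum_field:
  assumes U: "open U" "x \<in> U" and v: "v \<in> tangent_space A x" and c: "c \<in> A" "x \<in> fst c"
    and K: "finite K" "\<And>k. k \<in> K \<Longrightarrow> vector_field A U (Y k)" "\<And>k. k \<in> K \<Longrightarrow> smooth_map A U (f k)"
  shows "D x v (\<lambda>y. \<Sum>k\<in>K. f k y *\<^sub>R Y k y)
    = (\<Sum>k\<in>K. chart_deriv c (f k) x (v c) *\<^sub>R Y k x + f k x *\<^sub>R D x v (Y k))"
  using K
proof (induction K)
  case empty
  have "D x v (\<lambda>y. 0 + 0) = D x v (\<lambda>y. 0) + D x v (\<lambda>y. 0)"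
    by (rule D_add_field[OF U(1) vector_field_zero[OF U(1)] U(2) vector_field_zero[OF U(1)] v])
  then show ?case by (simp only: add_0_left sum.empty add_cancel_right_right)
next
  case (insert k K)
  have k: "vector_field A U (Y k)" "smooth_map A U (f k)" using insert.prems by auto
  have vf: "vector_field A U (\<lambda>y. f k y *\<^sub>R Y k y)"
    by (rule vector_field_scale[OF U(1) k(2,1)])
  have "vector_field A U (\<lambda>y. \<Sum>k\<in>K. f k y *\<^sub>R Y k y)"
    using insert by (intro vector_field_sum vector_field_scale U) auto
  from D_add_field[OF U(1) vf U(2) this v]
  have "D x v (\<lambda>y. f k y *\<^sub>R Y k y + (\<Sum>k\<in>K. f k y *\<^sub>R Y k y))
      = D x v (\<lambda>y. f k y *\<^sub>R Y k y) + D x v (\<lambda>y. \<Sum>k\<in>K. f k y *\<^sub>R Y k y)" .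
  also have "D x v (\<lambda>y. f k y *\<^sub>R Y k y) = chart_deriv c (f k) x (v c) *\<^sub>R Y k x + f k x *\<^sub>R D x v (Y k)"
    by (rule D_leibniz[OF U(1) k(1) U(2) k(2) v c])
  also have "D x v (\<lambda>y. \<Sum>k\<in>K. f k y *\<^sub>R Y k y)
      = (\<Sum>k\<in>K. chart_deriv c (f k) x (v c) *\<^sub>R Y k x + f k x *\<^sub>R D x v (Y k))"
    by (rule insert.IH) (use insert.prems in blast)+
  finally show ?case by (simp only: sum.insert[OF insert.hyps])
qed

abbreviation frame :: "('m, 'n) chart \<Rightarrow> 'n \<Rightarrow> 'm \<Rightarrow> ('m, 'n) vec_family"
  where "frame c k \<equiv> coord_field A c (axis k 1)"

abbreviation in_chart :: "('m, 'n) chart \<Rightarrow> ('m \<Rightarrow> ('m, 'n) chart \<Rightarrow> 'b) \<Rightarrow> real^'n \<Rightarrow> 'b"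
  where "in_chart c X \<equiv> \<lambda>p. X (chart_inv c p) c"

text \<open>The Leibniz rule for the expansion of \<open>Y\<close> in the coordinate frame.\<close>

lemma D_in_chart:
  assumes c: "c \<in> A" and U: "open U" "U \<subseteq> fst c" and Y: "vector_field A U Y"
    and x: "x \<in> U" and v: "v \<in> tangent_space A x"
  shows "D x v Y c = frechet_derivative (in_chart c Y) (at (snd c x)) (v c)
    + (\<Sum>k\<in>UNIV. (Y x c $ k) *\<^sub>R D x v (frame c k) c)"
proof -
  have xc: "x \<in> fst c" using x U by auto
  have smooth: "smooth_on (snd c ` U) (in_chart c Y)" by (rule vector_field_smooth[OF Y c U])
  have S: "open (snd c ` U)" by (rule chart_image_open'[OF c U])
  have f: "smooth_map A U (\<lambda>y. Y y c $ k)" for k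
    by (rule smooth_mapI[OF c U]) (intro smooth_on_vec_nth S smooth)
  have E: "vector_field A U (frame c k)" for k
    by (rule vector_field_subset[OF coord_field_vector_field[OF c] U(2)])
  have "D x v Y = D x v (\<lambda>y. \<Sum>k\<in>UNIV. (Y y c $ k) *\<^sub>R frame c k y)"
  proof (rule D_cong[OF U(1) Y x _ v])
    show "vector_field A U (\<lambda>y. \<Sum>k\<in>UNIV. (Y y c $ k) *\<^sub>R frame c k y)"
      by (intro vector_field_sum vector_field_scale U E f) simp
    show "Y y = (\<Sum>k\<in>UNIV. (Y y c $ k) *\<^sub>R frame c k y)" if "y \<in> U" for y
      by (rule tangent_expansion[OF _ c]) (use Y that U in \<open>auto simp: vector_field_def\<close>)
  qed
  also have "\<dots> = (\<Sum>k\<in>UNIV. chart_deriv c (\<lambda>y. Y y c $ k) x (v c) *\<^sub>R frame c k x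
      + (Y x c $ k) *\<^sub>R D x v (frame c k))"
    by (rule D_sum_field[OF U(1) x v c xc]) (auto intro: E f)
  finally have "D x v Y c = (\<Sum>k\<in>UNIV. chart_deriv c (\<lambda>y. Y y c $ k) x (v c) *\<^sub>R axis k 1)
      + (\<Sum>k\<in>UNIV. (Y x c $ k) *\<^sub>R D x v (frame c k) c)"
    by (simp add: sum_fun_apply scaleR_fun_def coord_field_self c xc sum.distrib)
  moreover have "chart_deriv c (\<lambda>y. Y y c $ k) x (v c) = frechet_derivative (in_chart c Y) (at (snd c x)) (v c) $ k" for k
  proof -
    have "in_chart c Y differentiable at (snd c x)"
      using smooth_on_differentiable[OF smooth] x by blast
    then show ?thesis unfolding chart_deriv_def
      using frechet_derivative_inner[of "in_chart c Y" "snd c x" "axis k 1" "v c"] by (simp add: inner_axis)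
  qed
  ultimately show ?thesis by (simp add: axis_expansion)
qed

subsection \<open>The covariant derivative of a form is a form\<close>

lemma form_cov_deriv_entry:
  assumes "c \<in> A" "x \<in> fst c"
  shows "form_cov_deriv A D x v X c $ i $ j
    = chart_deriv c (\<lambda>y. form_apply c (X y) (frame c i y) (frame c j y)) x (v c)
      - form_apply c (X x) (D x v (frame c i)) (frame c j x)
      - form_apply c (X x) (frame c i x) (D x v (frame c j))"
  using assms by (simp add: form_cov_deriv_def charts_at_def Let_def)

lemma form_cov_deriv_entry':
  assumes c: "c \<in> A" and U: "open U" "U \<subseteq> fst c" and X: "smooth_on (snd c ` U) (in_chart c X)" and x: "x \<in> U"
  shows "form_cov_deriv A D x v X c $ i $ j
    = frechet_derivative (in_chart c X) (at (snd c x)) (v c) $ i $ j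
      - D x v (frame c i) c \<bullet> (X x c *v axis j 1) - axis i 1 \<bullet> (X x c *v D x v (frame c j) c)"
proof -
  have S: "open (snd c ` U)" by (rule chart_image_open'[OF c U])
  have xS: "snd c x \<in> snd c ` U" and xc: "x \<in> fst c" using x U by auto
  have "chart_deriv c (\<lambda>y. form_apply c (X y) (frame c i y) (frame c j y)) x (v c)
      = frechet_derivative (\<lambda>p. in_chart c X p $ i $ j) (at (snd c x)) (v c)"
    unfolding chart_deriv_def
  proof (rule frechet_derivative_cong_open[OF S xS, THEN fun_cong])
    fix p assume "p \<in> snd c ` U"
    then have "chart_inv c p \<in> fst c" using chart_inv_image(1)[OF c U(2)] U(2) by blast
    then show "form_apply c (X (chart_inv c p)) (frame c i (chart_inv c p)) (frame c j (chart_inv c p))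
        = in_chart c X p $ i $ j"
      by (simp add: form_apply_def coord_field_self c axis_inner_matrix)
  qed
  also have "\<dots> = frechet_derivative (in_chart c X) (at (snd c x)) (v c) $ i $ j"
    using frechet_derivative_inner[of "in_chart c X" "snd c x" "axis i (axis j 1)" "v c"]
      smooth_on_differentiable[OF X xS] by (simp add: inner_axis)
  finally show ?thesis
    by (simp add: form_cov_deriv_entry[OF c xc] form_apply_def coord_field_self c xc)
qed

text \<open>The left-hand side is the defining expression of \<open>(\<nabla>\<^sub>vX)(Y, Z)\<close> for arbitrary fields \<open>Y\<close> and \<open>Z\<close>.
  The derivatives of their components cancel, so it depends only on \<open>Y x\<close> and \<open>Z x\<close>.\<close>

lemma cov_deriv_bilinear:
  assumes c: "c \<in> A" and U: "open U" "U \<subseteq> fst c" and X: "form_section A U X"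
    and Y: "vector_field A U Y" and Z: "vector_field A U Z"
    and x: "x \<in> U" and v: "v \<in> tangent_space A x"
  shows "chart_deriv c (\<lambda>y. form_apply c (X y) (Y y) (Z y)) x (v c)
      - form_apply c (X x) (D x v Y) (Z x) - form_apply c (X x) (Y x) (D x v Z)
    = Y x c \<bullet> (form_cov_deriv A D x v X c *v Z x c)"
proof -
  define p where "p = snd c x"
  have p: "p \<in> snd c ` U" "chart_inv c p = x"
    using x U chart_inv_left[OF c] by (auto simp: p_def)
  define \<xi> where "\<xi> = in_chart c X"
  define \<eta> where "\<eta> = in_chart c Y"
  define \<zeta> where "\<zeta> = in_chart c Z"
  have smooth: "smooth_on (snd c ` U) \<xi>" "smooth_on (snd c ` U) \<eta>" "smooth_on (snd c ` U) \<zeta>"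
    unfolding \<xi>_def \<eta>_def \<zeta>_def
    by (rule form_section_smooth[OF X c U] vector_field_smooth[OF Y c U] vector_field_smooth[OF Z c U])+
  have at: "\<xi> p = X x c" "\<eta> p = Y x c" "\<zeta> p = Z x c" using p by (simp_all add: \<xi>_def \<eta>_def \<zeta>_def)
  define \<xi>' where "\<xi>' = frechet_derivative \<xi> (at p) (v c)"
  define \<eta>' where "\<eta>' = frechet_derivative \<eta> (at p) (v c)"
  define \<zeta>' where "\<zeta>' = frechet_derivative \<zeta> (at p) (v c)"
  have \<eta>': "\<eta>' = frechet_derivative (in_chart c Y) (at (snd c x)) (v c)"
    and \<zeta>': "\<zeta>' = frechet_derivative (in_chart c Z) (at (snd c x)) (v c)"
    by (simp_all add: \<eta>'_def \<zeta>'_def \<eta>_def \<zeta>_def p_def)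
  define b where "b k = D x v (frame c k) c" for k
  have bilinear: "bounded_bilinear (\<lambda>(M::real^'n^'n) z. M *v z)"
    by (rule bilinear_conv_bounded_bilinear[THEN iffD1])
      (auto simp: bilinear_def linear_iff matrix_vector_mult_add_rdistrib matrix_vector_right_distrib
        matrix_vector_mult_scaleR scaleR_matrix_vector_assoc)
  have "((\<lambda>p. \<eta> p \<bullet> (\<xi> p *v \<zeta> p)) has_derivative (\<lambda>h.
      \<eta> p \<bullet> (\<xi> p *v frechet_derivative \<zeta> (at p) h + frechet_derivative \<xi> (at p) h *v \<zeta> p)
      + frechet_derivative \<eta> (at p) h \<bullet> (\<xi> p *v \<zeta> p))) (at p)"
    by (intro has_derivative_inner bounded_bilinear.FDERIV[OF bilinear]
        smooth_on_has_derivative[OF smooth(1) p(1)] smooth_on_has_derivative[OF smooth(2) p(1)]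
        smooth_on_has_derivative[OF smooth(3) p(1)])
  from frechet_derivative_eqI[OF this]
  have "chart_deriv c (\<lambda>y. form_apply c (X y) (Y y) (Z y)) x (v c)
      = \<eta> p \<bullet> (\<xi> p *v \<zeta>' + \<xi>' *v \<zeta> p) + \<eta>' \<bullet> (\<xi> p *v \<zeta> p)"
    unfolding chart_deriv_def form_apply_def
    by (simp add: \<xi>_def \<eta>_def \<zeta>_def \<xi>'_def \<eta>'_def \<zeta>'_def p_def[symmetric])
  moreover have "form_apply c (X x) (D x v Y) (Z x) = (\<eta>' + (\<Sum>k\<in>UNIV. \<eta> p $ k *\<^sub>R b k)) \<bullet> (\<xi> p *v \<zeta> p)"
    "form_apply c (X x) (Y x) (D x v Z) = \<eta> p \<bullet> (\<xi> p *v (\<zeta>' + (\<Sum>k\<in>UNIV. \<zeta> p $ k *\<^sub>R b k)))"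
    unfolding form_apply_def D_in_chart[OF c U Y x v] D_in_chart[OF c U Z x v]
    by (simp_all add: at b_def \<eta>' \<zeta>')
  ultimately have lhs: "chart_deriv c (\<lambda>y. form_apply c (X y) (Y y) (Z y)) x (v c)
      - form_apply c (X x) (D x v Y) (Z x) - form_apply c (X x) (Y x) (D x v Z)
    = \<eta> p \<bullet> (\<xi>' *v \<zeta> p) - (\<Sum>k\<in>UNIV. \<eta> p $ k *\<^sub>R b k) \<bullet> (\<xi> p *v \<zeta> p)
      - \<eta> p \<bullet> (\<xi> p *v (\<Sum>k\<in>UNIV. \<zeta> p $ k *\<^sub>R b k))"
    by (simp add: inner_add_left inner_add_right matrix_vector_right_distrib)
  have "form_cov_deriv A D x v X c $ i $ j = \<xi>' $ i $ j - b i \<bullet> (\<xi> p *v axis j 1) - axis i 1 \<bullet> (\<xi> p *v b j)" for i j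
    using form_cov_deriv_entry'[where X = X, OF c U smooth(1)[unfolded \<xi>_def] x, of v i j]
    by (simp add: \<xi>'_def \<xi>_def b_def p_def at[unfolded \<xi>_def p_def])
  then have "\<eta> p \<bullet> (form_cov_deriv A D x v X c *v \<zeta> p)
      = \<eta> p \<bullet> (\<xi>' *v \<zeta> p)
      - (\<Sum>i\<in>UNIV. \<Sum>j\<in>UNIV. \<eta> p $ i * \<zeta> p $ j * (b i \<bullet> (\<xi> p *v axis j 1)))
      - (\<Sum>i\<in>UNIV. \<Sum>j\<in>UNIV. \<eta> p $ i * \<zeta> p $ j * (axis i 1 \<bullet> (\<xi> p *v b j)))"
    by (simp add: inner_matrix_expansion[of "\<eta> p" _ "\<zeta> p"] right_diff_distrib sum_subtractf)
  then show ?thesis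
    unfolding lhs bilinear_basis_expansion[symmetric] axis_expansion at by simp
qed

lemma chart_deriv_change:
  assumes c: "c \<in> A" "c' \<in> A" and x: "x \<in> fst c" "x \<in> fst c'" and v: "v \<in> tangent_space A x"
    and f: "(\<lambda>p. f (chart_inv c' p)) differentiable at (snd c' x)"
  shows "chart_deriv c f x (v c) = chart_deriv c' f x (v c')"
proof -
  let ?S = "snd c ` (fst c \<inter> fst c')"
  have "((\<lambda>p. f (chart_inv c' p)) has_derivative frechet_derivative (\<lambda>p. f (chart_inv c' p)) (at (snd c' x)))
      (at (transition c c' (snd c x)))"
    using f by (simp add: frechet_derivative_works transition_apply c x)
  from diff_chain_at[OF transition_has_derivative[OF c x] this]
  have 1: "((\<lambda>p. f (chart_inv c' (transition c c' p))) has_derivative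
      (\<lambda>h. frechet_derivative (\<lambda>p. f (chart_inv c' p)) (at (snd c' x)) (jac c c' x *v h))) (at (snd c x))"
    by (simp add: o_def)
  have 2: "f (chart_inv c' (transition c c' p)) = f (chart_inv c p)" if "p \<in> ?S" for p
    using that by (auto simp: transition_apply c chart_inv_left)
  have 3: "snd c x \<in> ?S" using x by auto
  have "((\<lambda>p. f (chart_inv c p)) has_derivative
      (\<lambda>h. frechet_derivative (\<lambda>p. f (chart_inv c' p)) (at (snd c' x)) (jac c c' x *v h))) (at (snd c x))"
    by (rule has_derivative_transform_within_open[OF 1 overlap_open[OF c] 3 2])
  from frechet_derivative_eqI[OF this] show ?thesis
    using tangent_change[OF v c x] by (simp add: chart_deriv_def)
qed

text \<open>Tensoriality: in the chart \<open>c'\<close> the bilinear expression is evaluated on the coordinate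
  fields of \<open>c\<close>, for which it is by definition the component in \<open>c\<close>.\<close>

proposition form_cov_deriv_sym_form:
  assumes U: "open U" "x \<in> U" and X: "form_section A U X" and v: "v \<in> tangent_space A x"
  shows "form_cov_deriv A D x v X \<in> sym_forms A x"
  unfolding sym_forms_def mem_Collect_eq
proof (intro conjI ballI allI impI)
  fix c assume "c \<in> charts_at A x"
  then have c: "c \<in> A" "x \<in> fst c" by (auto simp: charts_at_def)
  have Xsym: "X y \<in> sym_forms A y" if "y \<in> U" for y
    using X that by (simp add: form_section_def)
  have comm: "form_apply c (X y) a b = form_apply c (X y) b a" if "y \<in> U" "y \<in> fst c" for y a b
    by (rule form_apply_commute[where w = "X y" and c = c, OF form_symmetric[OF Xsym[OF that(1)] c(1) that(2)]])
  have UU: "open (U \<inter> fst c)" "U \<inter> fst c \<subseteq> fst c" "x \<in> U \<inter> fst c"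
    using U chart_open(1)[OF c(1)] c by auto
  have "chart_deriv c (\<lambda>y. form_apply c (X y) (frame c i y) (frame c j y)) x (v c)
      = chart_deriv c (\<lambda>y. form_apply c (X y) (frame c j y) (frame c i y)) x (v c)" for i j
    unfolding chart_deriv_def
  proof (rule frechet_derivative_cong_open[THEN fun_cong, OF chart_image_open'[OF c(1) UU(1,2)]])
    show "snd c x \<in> snd c ` (U \<inter> fst c)" using UU(3) by blast
    show "form_apply c (X (chart_inv c p)) (frame c i (chart_inv c p)) (frame c j (chart_inv c p))
        = form_apply c (X (chart_inv c p)) (frame c j (chart_inv c p)) (frame c i (chart_inv c p))"
      if "p \<in> snd c ` (U \<inter> fst c)" for p
      using chart_inv_image(1)[OF c(1) UU(2) that] by (intro comm) auto
  qed
  then have "form_cov_deriv A D x v X c $ i $ j = form_cov_deriv A D x v X c $ j $ i" for i j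
    unfolding form_cov_deriv_entry[OF c] using comm[OF U(2) c(2)] by simp
  then show "transpose (form_cov_deriv A D x v X c) = form_cov_deriv A D x v X c"
    by (simp add: Finite_Cartesian_Product.transpose_def vec_eq_iff)
  fix c' assume "c' \<in> charts_at A x"
  then have c': "c' \<in> A" "x \<in> fst c'" by (auto simp: charts_at_def)
  define U' where "U' = U \<inter> fst c \<inter> fst c'"
  have U': "open U'" "U' \<subseteq> fst c'" "U' \<subseteq> fst c" "U' \<subseteq> U" "x \<in> U'"
    using U c c' chart_open(1)[OF c(1)] chart_open(1)[OF c'(1)] by (auto simp: U'_def)
  have X': "form_section A U' X" by (rule form_section_subset[OF X U'(4)])
  have E: "vector_field A U' (frame c i)" for i
    by (rule vector_field_subset[OF coord_field_vector_field[OF c(1)] U'(3)])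
  have tang: "frame c i y \<in> tangent_space A y" if "y \<in> U'" for i y
    using coord_field_tangent[OF c(1)] that U'(3) by blast
  have fx: "D x v (frame c i) \<in> tangent_space A x" for i
    by (rule D_tangent[OF U'(1) E U'(5) v])
  have change: "form_apply c (X y) a b = form_apply c' (X y) a b"
    if "y \<in> U'" "a \<in> tangent_space A y" "b \<in> tangent_space A y" for y a b
    by (rule form_apply_chart_independent[OF Xsym]) (use that c c' U' in auto)
  have "form_cov_deriv A D x v X c $ i $ j
      = (jac c c' x *v axis i 1) \<bullet> (form_cov_deriv A D x v X c' *v (jac c c' x *v axis j 1))" for i j
  proof -
    have "chart_deriv c (\<lambda>y. form_apply c (X y) (frame c i y) (frame c j y)) x (v c)
        = chart_deriv c (\<lambda>y. form_apply c' (X y) (frame c i y) (frame c j y)) x (v c)"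
      unfolding chart_deriv_def
    proof (rule frechet_derivative_cong_open[THEN fun_cong, OF chart_image_open'[OF c(1) U'(1,3)]])
      show "snd c x \<in> snd c ` U'" using U'(5) by blast
      show "form_apply c (X (chart_inv c p)) (frame c i (chart_inv c p)) (frame c j (chart_inv c p))
        = form_apply c' (X (chart_inv c p)) (frame c i (chart_inv c p)) (frame c j (chart_inv c p))"
        if "p \<in> snd c ` U'" for p
        using chart_inv_image(1)[OF c(1) U'(3) that] by (intro change tang) auto
    qed
    also have "\<dots> = chart_deriv c' (\<lambda>y. form_apply c' (X y) (frame c i y) (frame c j y)) x (v c')"
    proof (rule chart_deriv_change[OF c(1) c'(1) c(2) c'(2) v])
      have "smooth_on (snd c' ` U') (\<lambda>p. in_chart c' (frame c i) p \<bullet> (in_chart c' X p *v in_chart c' (frame c j) p))"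
        by (intro smooth_on_inner smooth_on_matrix_vector_mult chart_image_open' c' U'
            form_section_smooth[OF X'] vector_field_smooth[OF E])
      then show "(\<lambda>p. form_apply c' (X (chart_inv c' p)) (frame c i (chart_inv c' p)) (frame c j (chart_inv c' p)))
          differentiable at (snd c' x)"
        unfolding form_apply_def by (rule smooth_on_differentiable) (use U' in blast)
    qed
    finally have "form_cov_deriv A D x v X c $ i $ j
        = chart_deriv c' (\<lambda>y. form_apply c' (X y) (frame c i y) (frame c j y)) x (v c')
          - form_apply c' (X x) (D x v (frame c i)) (frame c j x)
          - form_apply c' (X x) (frame c i x) (D x v (frame c j))"
      by (simp add: form_cov_deriv_entry[OF c] change U' tang fx)
    also have "\<dots> = frame c i x c' \<bullet> (form_cov_deriv A D x v X c' *v frame c j x c')"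
      by (rule cov_deriv_bilinear[OF c'(1) U'(1,2) X' E E U'(5) v])
    finally show ?thesis by (simp add: coord_field_apply c')
  qed
  then show "form_cov_deriv A D x v X c
      = transpose (jac c c' x) ** form_cov_deriv A D x v X c' ** jac c c' x"
    by (simp add: vec_eq_iff congruence_entry)
qed (simp add: form_cov_deriv_def)

lemma form_cov_deriv_section:
  assumes c: "c \<in> A" and U: "open U" "U \<subseteq> fst c" and X: "form_section A U X" and V: "vector_field A U V"
  shows "form_section A U (\<lambda>y. form_cov_deriv A D y (V y) X)"
proof (rule form_sectionI[OF c U])
  show "form_cov_deriv A D y (V y) X \<in> sym_forms A y" if "y \<in> U" for y
    by (rule form_cov_deriv_sym_form[OF U(1) that X]) (use V that in \<open>simp add: vector_field_def\<close>)
  have S: "open (snd c ` U)" by (rule chart_image_open'[OF c U])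
  have \<xi>: "smooth_on (snd c ` U) (in_chart c X)" by (rule form_section_smooth[OF X c U])
  have \<beta>: "smooth_on (snd c ` U) (in_chart c V)" by (rule vector_field_smooth[OF V c U])
  have "vector_field A U (\<lambda>y. D y (V y) (frame c i))" for i
    by (rule D_vector_field[OF U(1) vector_field_subset[OF coord_field_vector_field[OF c] U(2)] V])
  from vector_field_smooth[OF this c U]
  have b: "smooth_on (snd c ` U) (\<lambda>p. D (chart_inv c p) (V (chart_inv c p)) (frame c i) c)" for i .
  have d: "smooth_on (snd c ` U) (\<lambda>p. frechet_derivative (in_chart c X) (at p) (in_chart c V p))"
  proof (rule smooth_on_transfer[OF _ S])
    show "smooth_on (snd c ` U) (\<lambda>p. \<Sum>e\<in>Basis. (in_chart c V p \<bullet> e) *\<^sub>R frechet_derivative (in_chart c X) (at p) e)"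
      by (intro smooth_on_sum smooth_on_scaleR smooth_on_inner smooth_on_const smooth_on_frechet_derivative S \<xi> \<beta>)
    show "frechet_derivative (in_chart c X) (at p) (in_chart c V p)
        = (\<Sum>e\<in>Basis. (in_chart c V p \<bullet> e) *\<^sub>R frechet_derivative (in_chart c X) (at p) e)"
      if "p \<in> snd c ` U" for p
      by (intro linear_Basis_expansion linear_frechet_derivative smooth_on_differentiable[OF \<xi> that])
  qed
  show "smooth_on (snd c ` U) (\<lambda>p. form_cov_deriv A D (chart_inv c p) (V (chart_inv c p)) X c)"
  proof (rule smooth_on_vecI[OF S], rule smooth_on_vecI[OF S])
    fix i j
    let ?b = "\<lambda>k p. D (chart_inv c p) (V (chart_inv c p)) (frame c k) c"
    have "smooth_on (snd c ` U) (\<lambda>p. frechet_derivative (in_chart c X) (at p) (in_chart c V p) $ i $ j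
        - ?b i p \<bullet> (in_chart c X p *v axis j 1) - axis i 1 \<bullet> (in_chart c X p *v ?b j p))"
      by (intro smooth_on_diff smooth_on_vec_nth smooth_on_inner smooth_on_matrix_vector_mult smooth_on_const S \<xi> b d)
    then show "smooth_on (snd c ` U) (\<lambda>p. form_cov_deriv A D (chart_inv c p) (V (chart_inv c p)) X c $ i $ j)"
    proof (rule smooth_on_transfer[OF _ S])
      fix p assume "p \<in> snd c ` U"
      from chart_inv_image[OF c U(2) this]
      show "form_cov_deriv A D (chart_inv c p) (V (chart_inv c p)) X c $ i $ j
        = frechet_derivative (in_chart c X) (at p) (in_chart c V p) $ i $ j
        - ?b i p \<bullet> (in_chart c X p *v axis j 1) - axis i 1 \<bullet> (in_chart c X p *v ?b j p)"
        using form_cov_deriv_entry'[where X = X, OF c U \<xi>, of "chart_inv c p" "V (chart_inv c p)" i j] by simp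
    qed
  qed
qed

end

section \<open>Curvature in charts\<close>

lemma common_radius:
  fixes P :: "'a \<Rightarrow> real \<Rightarrow> bool"
  assumes "finite T" "\<And>t. t \<in> T \<Longrightarrow> \<exists>r>0. P t r" "\<And>t r s. P t r \<Longrightarrow> s \<le> r \<Longrightarrow> P t s"
  shows "\<exists>r>0. \<forall>t\<in>T. P t r"
  using assms(1,2)
proof (induction T)
  case empty
  show ?case by (intro exI[of _ 1]) simp
next
  case (insert t T)
  obtain r where r: "r > 0" "\<forall>t\<in>T. P t r" using insert by blast
  obtain s where s: "s > 0" "P t s" using insert.prems by blast
  have "P t' (min r s)" if "t' \<in> insert t T" for t'
    using that r s by (auto intro: assms(3))
  then show ?case using r s by (intro exI[of _ "min r s"]) auto
qed

context atlas_connection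
begin

definition christoffel :: "('m, 'n) chart \<Rightarrow> real^'n \<Rightarrow> 'n \<Rightarrow> 'n \<Rightarrow> real^'n"
  where "christoffel c q l i = D (chart_inv c q) (frame c l (chart_inv c q)) (frame c i) c"

definition frame_deriv :: "('m, 'n) chart \<Rightarrow> real^'n \<Rightarrow> real^'n \<Rightarrow> 'n \<Rightarrow> real^'n"
  where "frame_deriv c q h i = (\<Sum>l\<in>UNIV. h $ l *\<^sub>R christoffel c q l i)"

definition conn :: "('m, 'n) chart \<Rightarrow> real^'n \<Rightarrow> real^'n \<Rightarrow> real^'n^'n \<Rightarrow> real^'n^'n"
  where "conn c q h m = (\<chi> i j. frame_deriv c q h i \<bullet> (m *v axis j 1)
    + axis i 1 \<bullet> (m *v frame_deriv c q h j))"

lemma linear_frame_deriv: "linear (\<lambda>h. frame_deriv c q h i)"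
  by (rule linearI) (simp_all add: frame_deriv_def scaleR_left_distrib sum.distrib scaleR_sum_right)

lemma linear_conn: "linear (conn c q h)"
  by (rule linearI)
    (simp_all add: conn_def vec_eq_iff matrix_vector_mult_add_rdistrib inner_add_right
      scaleR_matrix_vector_assoc[symmetric] algebra_simps)

lemma linear_conn_direction: "linear (\<lambda>h. conn c q h m)"
  by (rule linearI)
    (simp_all add: conn_def vec_eq_iff linear_add[OF linear_frame_deriv] linear_scale[OF linear_frame_deriv]
      matrix_vector_right_distrib matrix_vector_mult_scaleR inner_add_left inner_add_right algebra_simps)

lemma D_frame:
  assumes "c \<in> A" "x \<in> fst c" "v \<in> tangent_space A x"
  shows "D x v (frame c i) c = frame_deriv c (snd c x) (v c) i"
proof -
  have "D x v (frame c i) = D x (\<Sum>l\<in>UNIV. (v c $ l) *\<^sub>R frame c l x) (frame c i)"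
    using tangent_expansion[OF assms(3,1,2)] by simp
  also have "\<dots> = (\<Sum>l\<in>UNIV. (v c $ l) *\<^sub>R D x (frame c l x) (frame c i))"
    by (rule D_sum_direction[OF chart_open(1)[OF assms(1)] coord_field_vector_field[OF assms(1)] assms(2)])
      (auto intro: coord_field_tangent assms)
  finally show ?thesis
    by (simp add: sum_fun_apply scaleR_fun_def frame_deriv_def christoffel_def chart_inv_left assms)
qed

lemma form_cov_deriv_in_chart:
  assumes c: "c \<in> A" and U: "open U" "U \<subseteq> fst c" and X: "smooth_on (snd c ` U) (in_chart c X)"
    and x: "x \<in> U" and v: "v \<in> tangent_space A x"
  shows "form_cov_deriv A D x v X c
    = frechet_derivative (in_chart c X) (at (snd c x)) (v c) - conn c (snd c x) (v c) (X x c)"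
proof -
  have "x \<in> fst c" using x U by auto
  then show ?thesis
    using form_cov_deriv_entry'[where X = X, OF c U X x, of v]
    by (simp add: vec_eq_iff conn_def D_frame[OF c _ v])
qed

text \<open>Finitely many Christoffel symbols determine the connection form, so that all quantities
  derived from it are given by power series on a common ball.\<close>

lemma christoffel_power_series:
  assumes c: "c \<in> A" and p: "p \<in> snd c ` fst c"
  shows "\<exists>r>0. ball p r \<subseteq> snd c ` fst c \<and> (\<forall>l i k. power_series_on p r (\<lambda>q. christoffel c q l i $ k))"
proof -
  have "\<exists>r>0. \<forall>t\<in>UNIV. power_series_on p r (\<lambda>q. christoffel c q (fst t) (fst (snd t)) $ snd (snd t))"
  proof (rule common_radius)
    fix t :: "'n \<times> 'n \<times> 'n"
    obtain l i k where t: "t = (l, i, k)" by (metis prod.collapse)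
    have "real_analytic_on (snd c ` fst c) (\<lambda>q. christoffel c q l i $ k)"
      using analytic_connection c by (auto simp: analytic_connection_def christoffel_def Let_def)
    from real_analytic_on_power_series[OF this p] obtain r where
      "r > 0" "\<forall>b. power_series_on p r (\<lambda>q. christoffel c q l i $ k \<bullet> b)" by blast
    then have "power_series_on p r (\<lambda>q. christoffel c q l i $ k \<bullet> 1)" by blast
    then show "\<exists>r>0. power_series_on p r (\<lambda>q. christoffel c q (fst t) (fst (snd t)) $ snd (snd t))"
      using \<open>r > 0\<close> by (auto simp: t)
  qed (auto intro: power_series_on_mono)
  then obtain r where "r > 0" and *: "\<forall>t\<in>UNIV. power_series_on p r (\<lambda>q. christoffel c q (fst t) (fst (snd t)) $ snd (snd t))"
    by blast
  have r: "r > 0" "power_series_on p r (\<lambda>q. christoffel c q l i $ k)" for l i k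
    using \<open>r > 0\<close> bspec[OF *, of "(l, i, k)"] by simp_all
  obtain s where "s > 0" "ball p s \<subseteq> snd c ` fst c"
    using chart_open(2)[OF c] p open_contains_ball by blast
  moreover have "power_series_on p (min r s) (\<lambda>q. christoffel c q l i $ k)" for l i k
    by (rule power_series_on_mono[OF r(2)]) simp
  ultimately show ?thesis
    using r(1) by (intro exI[of _ "min r s"]) auto
qed

lemma conn_power_series:
  assumes "\<And>l i k. power_series_on p r (\<lambda>q. christoffel c q l i $ k)"
  shows "vec_power_series_on p r (\<lambda>q. conn c q h m)"
proof (rule vec_power_series_on_matrixI)
  fix i j
  have fd: "power_series_on p r (\<lambda>q. frame_deriv c q h i \<bullet> w)" for i w
    unfolding frame_deriv_def inner_vec_def
    by (simp add: power_series_on_sum power_series_on_mult assms)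
  have "axis i 1 \<bullet> (m *v frame_deriv c q h j) = frame_deriv c q h j \<bullet> m $ i" for q
    by (simp add: inner_axis' matrix_vector_mul_component inner_commute)
  then show "power_series_on p r (\<lambda>q. conn c q h m $ i $ j)"
    unfolding conn_def by (simp add: power_series_on_add fd)
qed

lemma conn_differentiable:
  assumes "c \<in> A" "p \<in> snd c ` fst c"
  shows "(\<lambda>q. conn c q h m) differentiable at p"
proof -
  obtain r where "r > 0" "\<And>l i k. power_series_on p r (\<lambda>q. christoffel c q l i $ k)"
    using christoffel_power_series[OF assms] by blast
  then show ?thesis
    by (intro smooth_on_differentiable[OF vec_power_series_on_smooth[OF conn_power_series]]) auto
qed

text \<open>The curvature of the connection \<open>\<partial> - conn\<close> in the directions \<open>a\<close> and \<open>b\<close>.\<close>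

definition curv :: "('m, 'n) chart \<Rightarrow> real^'n \<Rightarrow> real^'n \<Rightarrow> real^'n \<Rightarrow> real^'n^'n \<Rightarrow> real^'n^'n"
  where "curv c q a b m = frechet_derivative (\<lambda>q. conn c q a m) (at q) b
    - frechet_derivative (\<lambda>q. conn c q b m) (at q) a
    + conn c q a (conn c q b m) - conn c q b (conn c q a m)"

lemma linear_curv:
  assumes c: "c \<in> A" "q \<in> snd c ` fst c"
  shows "linear (curv c q a b)"
proof -
  have D: "(\<lambda>m. frechet_derivative (\<lambda>q. conn c q h m) (at q) k) = (\<lambda>m. \<Sum>e\<in>Basis. (m \<bullet> e) *\<^sub>R
      frechet_derivative (\<lambda>q. conn c q h e) (at q) k)" for h k
  proof
    fix m
    have "((\<lambda>q. \<Sum>e\<in>Basis. (m \<bullet> e) *\<^sub>R conn c q h e) has_derivative (\<lambda>k. \<Sum>e\<in>Basis. (m \<bullet> e) *\<^sub>R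
      frechet_derivative (\<lambda>q. conn c q h e) (at q) k)) (at q)"
      by (intro has_derivative_sum has_derivative_scaleR_right
          conn_differentiable[OF c, unfolded frechet_derivative_works])
    from frechet_derivative_eqI[OF this]
    show "frechet_derivative (\<lambda>q. conn c q h m) (at q) k
        = (\<Sum>e\<in>Basis. (m \<bullet> e) *\<^sub>R frechet_derivative (\<lambda>q. conn c q h e) (at q) k)"
      unfolding linear_Basis_expansion[OF linear_conn, symmetric] by simp
  qed
  have "linear (\<lambda>m. frechet_derivative (\<lambda>q. conn c q h m) (at q) k)" for h k
    unfolding D by (rule linearI) (simp_all add: inner_add_left scaleR_left_distrib sum.distrib scaleR_sum_right)
  moreover have "linear (\<lambda>m. conn c q h (conn c q k m))" for h k
    using linear_compose[OF linear_conn linear_conn] by (simp add: o_def)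
  ultimately show ?thesis
    unfolding curv_def[abs_def] by (intro linear_compose_add linear_compose_sub)
qed

subsection \<open>Chart independence of the curvature\<close>

lemma double_cov_deriv:
  assumes c: "c \<in> A" and U: "open U" "U \<subseteq> fst c" and X: "form_section A U X" and V: "vector_field A U V"
    and x: "x \<in> U" and u: "u \<in> tangent_space A x"
    and p: "p = snd c x" and \<xi>: "\<xi> = in_chart c X" and \<beta>: "\<beta> = in_chart c V"
  shows "form_cov_deriv A D x u (\<lambda>y. form_cov_deriv A D y (V y) X) c =
    frechet_derivative (\<lambda>q. frechet_derivative \<xi> (at q) (\<beta> p)) (at p) (u c)
    + frechet_derivative \<xi> (at p) (frechet_derivative \<beta> (at p) (u c))
    - (frechet_derivative (\<lambda>q. conn c q (\<beta> p) (\<xi> p)) (at p) (u c)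
      + conn c p (frechet_derivative \<beta> (at p) (u c)) (\<xi> p)
      + conn c p (\<beta> p) (frechet_derivative \<xi> (at p) (u c)))
    - conn c p (u c) (frechet_derivative \<xi> (at p) (\<beta> p) - conn c p (\<beta> p) (\<xi> p))"
proof -
  let ?S = "snd c ` U"
  let ?Z = "\<lambda>y. form_cov_deriv A D y (V y) X"
  have S: "open ?S" by (rule chart_image_open'[OF c U])
  have pS: "p \<in> ?S" and p\<Omega>: "p \<in> snd c ` fst c" using x U by (auto simp: p)
  have sm: "smooth_on ?S \<xi>" "smooth_on ?S \<beta>"
    unfolding \<xi> \<beta> by (rule form_section_smooth[OF X c U] vector_field_smooth[OF V c U])+
  have Vt: "V y \<in> tangent_space A y" if "y \<in> U" for y using V that by (simp add: vector_field_def)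
  have Z: "in_chart c ?Z q = frechet_derivative \<xi> (at q) (\<beta> q) - conn c q (\<beta> q) (\<xi> q)" if "q \<in> ?S" for q
  proof -
    note inv = chart_inv_image[OF c U(2) that]
    show ?thesis
      using form_cov_deriv_in_chart[where X = X, OF c U _ inv(1) Vt[OF inv(1)]] sm(1) inv(2)
      by (simp add: \<xi> \<beta>)
  qed
  have \<xi>_diff: "(\<lambda>q. frechet_derivative \<xi> (at q) h) differentiable at p" for h
    by (rule smooth_on_differentiable[OF smooth_on_frechet_derivative[OF sm(1)] pS])
  have \<beta>_diff: "\<beta> differentiable at p" and \<xi>_diff': "\<xi> differentiable at p"
    by (rule smooth_on_differentiable[OF _ pS]; rule sm)+
  have 1: "((\<lambda>q. frechet_derivative \<xi> (at q) (\<beta> q)) has_derivative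
      (\<lambda>a. frechet_derivative (\<lambda>q. frechet_derivative \<xi> (at q) (\<beta> p)) (at p) a
        + frechet_derivative \<xi> (at p) (frechet_derivative \<beta> (at p) a))) (at p)"
    by (rule has_derivative_linear_family_on[OF S pS _ \<xi>_diff \<beta>_diff])
      (rule linear_frechet_derivative[OF smooth_on_differentiable[OF sm(1)]])
  have 2: "((\<lambda>q. conn c q (\<beta> q) m) has_derivative
      (\<lambda>a. frechet_derivative (\<lambda>q. conn c q (\<beta> p) m) (at p) a
        + conn c p (frechet_derivative \<beta> (at p) a) m)) (at p)" for m
    by (rule has_derivative_linear_family[OF linear_conn_direction conn_differentiable[OF c p\<Omega>] \<beta>_diff])
  then have "(\<lambda>q. conn c q (\<beta> q) m) differentiable at p" for m
    unfolding differentiable_def by blast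
  from has_derivative_linear_family[where \<Phi> = "\<lambda>q. conn c q (\<beta> q)", OF linear_conn this \<xi>_diff']
  have 3: "((\<lambda>q. conn c q (\<beta> q) (\<xi> q)) has_derivative
      (\<lambda>a. frechet_derivative (\<lambda>q. conn c q (\<beta> p) (\<xi> p)) (at p) a
        + conn c p (frechet_derivative \<beta> (at p) a) (\<xi> p)
        + conn c p (\<beta> p) (frechet_derivative \<xi> (at p) a))) (at p)"
    unfolding frechet_derivative_eqI[OF 2] .
  have "frechet_derivative (in_chart c ?Z) (at p)
      = frechet_derivative (\<lambda>q. frechet_derivative \<xi> (at q) (\<beta> q) - conn c q (\<beta> q) (\<xi> q)) (at p)"
    by (rule frechet_derivative_cong_open[OF S pS Z])
  then have "frechet_derivative (in_chart c ?Z) (at p) (u c) =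
    frechet_derivative (\<lambda>q. frechet_derivative \<xi> (at q) (\<beta> p)) (at p) (u c)
    + frechet_derivative \<xi> (at p) (frechet_derivative \<beta> (at p) (u c))
    - (frechet_derivative (\<lambda>q. conn c q (\<beta> p) (\<xi> p)) (at p) (u c)
      + conn c p (frechet_derivative \<beta> (at p) (u c)) (\<xi> p)
      + conn c p (\<beta> p) (frechet_derivative \<xi> (at p) (u c)))"
    using frechet_derivative_eqI[OF has_derivative_diff[OF 1 3]] by simp
  moreover have "form_cov_deriv A D x u ?Z c
      = frechet_derivative (in_chart c ?Z) (at p) (u c) - conn c p (u c) (?Z x c)"
    unfolding p
    by (rule form_cov_deriv_in_chart[OF c U _ x u])
      (rule form_section_smooth[OF form_cov_deriv_section[OF c U X V] c U])
  moreover have "?Z x c = frechet_derivative \<xi> (at p) (\<beta> p) - conn c p (\<beta> p) (\<xi> p)"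
    using Z[OF pS] x U by (simp add: p chart_inv_left c subset_iff)
  ultimately show ?thesis by simp
qed

text \<open>Since the second derivatives of the section are symmetric and the two fields commute, all terms
  that differentiate the section or the fields cancel.\<close>

lemma ricci_identity:
  assumes c: "c \<in> A" and U: "open U" "U \<subseteq> fst c" and X: "form_section A U X"
    and V: "vector_field A U V" and V': "vector_field A U V'"
    and x: "x \<in> U" and p: "p = snd c x" and \<xi>: "\<xi> = in_chart c X"
    and sym: "\<And>h k. frechet_derivative (\<lambda>q. frechet_derivative \<xi> (at q) h) (at p) k
      = frechet_derivative (\<lambda>q. frechet_derivative \<xi> (at q) k) (at p) h"
    and bracket: "frechet_derivative (in_chart c V) (at p) (V' x c)
      = frechet_derivative (in_chart c V') (at p) (V x c)"
  shows "form_cov_deriv A D x (V x) (\<lambda>y. form_cov_deriv A D y (V' y) X) c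
    - form_cov_deriv A D x (V' x) (\<lambda>y. form_cov_deriv A D y (V y) X) c
    = curv c p (V x c) (V' x c) (X x c)"
proof -
  have t: "V x \<in> tangent_space A x" "V' x \<in> tangent_space A x"
    using V V' x by (simp_all add: vector_field_def)
  have at: "\<xi> p = X x c" "in_chart c V p = V x c" "in_chart c V' p = V' x c"
    using x U by (auto simp: p \<xi> chart_inv_left c subset_iff)
  show ?thesis
    unfolding double_cov_deriv[OF c U X V' x t(1) p \<xi> refl] double_cov_deriv[OF c U X V x t(2) p \<xi> refl]
    unfolding at curv_def bracket linear_diff[OF linear_conn]
    by (simp add: sym[of "V x c" "V' x c"])
qed

lemma transition_power_series:
  assumes c: "c \<in> A" "c' \<in> A" and x: "x \<in> fst c" "x \<in> fst c'"
  shows "\<exists>r>0. ball (snd c x) r \<subseteq> snd c ` (fst c \<inter> fst c') \<and> vec_power_series_on (snd c x) r (transition c c')"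
proof -
  have xS: "snd c x \<in> snd c ` (fst c \<inter> fst c')" using x by auto
  obtain r where r: "r > 0" "\<forall>b. power_series_on (snd c x) r (\<lambda>q. transition c c' q \<bullet> b)"
    using real_analytic_on_power_series[OF transition_analytic[OF c] xS] by blast
  obtain s where "s > 0" "ball (snd c x) s \<subseteq> snd c ` (fst c \<inter> fst c')"
    using overlap_open[OF c] xS open_contains_ball by blast
  then show ?thesis
    using r by (intro exI[of _ "min r s"]) (auto simp: vec_power_series_on_def intro: power_series_on_mono)
qed

text \<open>In another chart the components of a form with constant components are polynomials in the first
  derivatives of the transition map, hence power series.\<close>

lemma coord_form_second_derivative_symmetric:
  assumes c: "c \<in> A" "c' \<in> A" and x: "x \<in> fst c" "x \<in> fst c'"
  shows "frechet_derivative (\<lambda>q. frechet_derivative (in_chart c' (coord_form A c m)) (at q) h) (at (snd c' x)) k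
    = frechet_derivative (\<lambda>q. frechet_derivative (in_chart c' (coord_form A c m)) (at q) k) (at (snd c' x)) h"
proof -
  let ?\<phi> = "transition c' c"
  obtain r where r: "r > 0" "ball (snd c' x) r \<subseteq> snd c' ` (fst c' \<inter> fst c)"
    and \<phi>: "vec_power_series_on (snd c' x) r ?\<phi>"
    using transition_power_series[OF c(2,1) x(2,1)] by blast
  have "vec_power_series_on (snd c' x) r (in_chart c' (coord_form A c m))"
  proof (rule vec_power_series_on_matrixI)
    fix i j
    let ?f = "\<lambda>i q. frechet_derivative ?\<phi> (at q) (axis i 1)"
    have f: "vec_power_series_on (snd c' x) r (?f i)" for i
      by (rule vec_power_series_on_frechet_derivative[OF \<phi>])
    have "vec_power_series_on (snd c' x) r (\<lambda>q. m *v ?f j q)"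
      by (rule vec_power_series_on_linear_family[OF matrix_vector_mul_linear _ f]) simp
    then have "power_series_on (snd c' x) r (\<lambda>q. ?f i q \<bullet> (m *v ?f j q))"
      by (rule vec_power_series_on_inner[OF f])
    then show "power_series_on (snd c' x) r (\<lambda>q. in_chart c' (coord_form A c m) q $ i $ j)"
    proof (rule power_series_on_cong)
      fix q assume "q \<in> ball (snd c' x) r"
      then have q: "q \<in> snd c' ` (fst c' \<inter> fst c)" using r(2) by blast
      have inv: "chart_inv c' q \<in> fst c'" "chart_inv c' q \<in> fst c" "snd c' (chart_inv c' q) = q"
        using chart_inv_image[OF c(2) _ q] by auto
      show "?f i q \<bullet> (m *v ?f j q) = in_chart c' (coord_form A c m) q $ i $ j"
        using jac_apply[OF c(2,1) inv(1,2)] inv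
        by (simp add: coord_form_apply[OF c(2) inv(1)] congruence_entry)
    qed
  qed
  from vec_power_series_second_derivative_symmetric[OF this] r(1) show ?thesis by simp
qed

text \<open>In the chart \<open>c'\<close> the derivative of a coordinate field of \<open>c\<close> along another one is a second
  derivative of the transition map; its symmetry says that coordinate fields commute.\<close>

lemma coord_field_derivative:
  assumes c: "c \<in> A" "c' \<in> A" and x: "x \<in> fst c" "x \<in> fst c'"
  shows "frechet_derivative (in_chart c' (coord_field A c h)) (at (snd c' x)) (jac c c' x *v k)
    = frechet_derivative (\<lambda>q. frechet_derivative (transition c c') (at q) h) (at (snd c x)) k"
proof -
  let ?\<phi> = "transition c' c" and ?\<psi> = "transition c c'"
  let ?S = "snd c' ` (fst c' \<inter> fst c)"
  have xS: "snd c' x \<in> ?S" using x by auto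
  have "frechet_derivative (in_chart c' (coord_field A c h)) (at (snd c' x))
      = frechet_derivative (\<lambda>q. frechet_derivative ?\<psi> (at (?\<phi> q)) h) (at (snd c' x))"
  proof (rule frechet_derivative_cong_open[OF overlap_open[OF c(2,1)] xS])
    fix q assume "q \<in> ?S"
    then have "chart_inv c' q \<in> fst c'" "chart_inv c' q \<in> fst c" "snd c' (chart_inv c' q) = q"
      using chart_inv_image[OF c(2) _ \<open>q \<in> ?S\<close>] by auto
    then show "in_chart c' (coord_field A c h) q = frechet_derivative ?\<psi> (at (?\<phi> q)) h"
      by (simp add: coord_field_apply[OF c(2)] jac_apply[OF c] transition_def)
  qed
  moreover have "(\<lambda>q. frechet_derivative ?\<psi> (at q) h) differentiable at (snd c x)"
    by (rule smooth_on_differentiable[OF smooth_on_frechet_derivative[OF transition_smooth[OF c]]]) (use x in auto)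
  then have "((\<lambda>q. frechet_derivative ?\<psi> (at q) h) has_derivative
      frechet_derivative (\<lambda>q. frechet_derivative ?\<psi> (at q) h) (at (snd c x))) (at (?\<phi> (snd c' x)))"
    by (simp add: frechet_derivative_works transition_apply c x)
  from frechet_derivative_eqI[OF diff_chain_at[OF transition_has_derivative[OF c(2,1) x(2,1)] this]]
  have "frechet_derivative (\<lambda>q. frechet_derivative ?\<psi> (at (?\<phi> q)) h) (at (snd c' x))
      = (\<lambda>k. frechet_derivative (\<lambda>q. frechet_derivative ?\<psi> (at q) h) (at (snd c x)) (jac c' c x *v k))"
    by (simp add: o_def)
  ultimately show ?thesis
    by (simp add: matrix_vector_mul_assoc jac_inverse c x)
qed

lemma coord_form_constant_section:
  assumes "c \<in> A" "open U" "U \<subseteq> fst c" "transpose m = m"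
  shows "form_section A U (coord_form A c m)"
  using coord_form_section[OF assms(1-3) smooth_on_const[OF chart_image_open'[OF assms(1-3)]], of m] assms(4)
  by simp

text \<open>The fields with constant components in \<open>c\<close> satisfy the hypotheses of the Ricci identity in every
  chart \<open>c'\<close>.  The left-hand side is the value at \<open>c'\<close> of one and the same form.\<close>

lemma coord_curvature:
  assumes c: "c \<in> A" "c' \<in> A" and x: "x \<in> fst c" "x \<in> fst c'"
    and u: "u \<in> tangent_space A x" and v: "v \<in> tangent_space A x" and w: "w \<in> sym_forms A x"
  shows "form_cov_deriv A D x u (\<lambda>y. form_cov_deriv A D y (coord_field A c (v c) y) (coord_form A c (w c))) c'
    - form_cov_deriv A D x v (\<lambda>y. form_cov_deriv A D y (coord_field A c (u c) y) (coord_form A c (w c))) c'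
    = curv c' (snd c' x) (u c') (v c') (w c')"
proof -
  let ?U = "fst c \<inter> fst c'"
  have U: "open ?U" "?U \<subseteq> fst c'" "?U \<subseteq> fst c" "x \<in> ?U"
    using chart_open(1)[OF c(1)] chart_open(1)[OF c(2)] x by auto
  have X: "form_section A ?U (coord_form A c (w c))"
    by (rule coord_form_constant_section[OF c(1) U(1,3) form_symmetric[OF w c(1) x(1)]])
  have E: "vector_field A ?U (coord_field A c h)" for h
    by (rule vector_field_subset[OF coord_field_vector_field[OF c(1)] U(3)])
  have at: "coord_field A c (u c) x = u" "coord_field A c (v c) x = v" "coord_form A c (w c) x = w"
    by (simp_all add: tangent_coord_field form_coord_form u v w c x)
  have change: "u c' = jac c c' x *v u c" "v c' = jac c c' x *v v c"
    using tangent_change c x u v by blast+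
  obtain r where r: "r > 0" "vec_power_series_on (snd c x) r (transition c c')"
    using transition_power_series[OF c x] by blast
  have "frechet_derivative (in_chart c' (coord_field A c (u c))) (at (snd c' x)) (v c')
      = frechet_derivative (in_chart c' (coord_field A c (v c))) (at (snd c' x)) (u c')"
    unfolding change coord_field_derivative[OF c x]
    by (rule vec_power_series_second_derivative_symmetric[OF r(2)]) (use r in simp)
  then show ?thesis
    using ricci_identity[OF c(2) U(1,2) X E E U(4) refl refl coord_form_second_derivative_symmetric[OF c x],
        of "u c" "v c"] at by simp
qed

text \<open>The curvature is computed in each chart from extensions that are adapted to this chart.  Those
  adapted to one chart \<open>c\<close> produce a form \<open>P\<close> whose components in every chart are the curvature computed
  there; and a form vanishes if its components in \<open>c\<close> do.\<close>

lemma form_curvature_zero_iff: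
  assumes c: "c \<in> A" "x \<in> fst c" and w: "w \<in> sym_forms A x"
  shows "(\<forall>u\<in>tangent_space A x. \<forall>v\<in>tangent_space A x. form_curvature A D x u v w = 0)
    \<longleftrightarrow> (\<forall>a b. curv c (snd c x) a b (w c) = 0)"
proof -
  have entry: "form_curvature A D x u v w c' = curv c' (snd c' x) (u c') (v c') (w c')"
    if "c' \<in> A" "x \<in> fst c'" "u \<in> tangent_space A x" "v \<in> tangent_space A x" for c' u v
    using coord_curvature[OF that(1,1,2,2,3,4) w] that by (simp add: form_curvature_def charts_at_def Let_def)
  show ?thesis
  proof
    assume *: "\<forall>u\<in>tangent_space A x. \<forall>v\<in>tangent_space A x. form_curvature A D x u v w = 0"
    show "\<forall>a b. curv c (snd c x) a b (w c) = 0"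
    proof (intro allI)
      fix a b
      have t: "coord_field A c a x \<in> tangent_space A x" "coord_field A c b x \<in> tangent_space A x"
        by (rule coord_field_tangent[OF c])+
      have "form_curvature A D x (coord_field A c a x) (coord_field A c b x) w c = 0"
        using * t by (metis zero_fun_apply)
      then show "curv c (snd c x) a b (w c) = 0" by (simp add: entry[OF c t] coord_field_self c)
    qed
  next
    assume *: "\<forall>a b. curv c (snd c x) a b (w c) = 0"
    show "\<forall>u\<in>tangent_space A x. \<forall>v\<in>tangent_space A x. form_curvature A D x u v w = 0"
    proof (intro ballI)
      fix u v assume t: "u \<in> tangent_space A x" "v \<in> tangent_space A x"
      define X where "X = coord_form A c (w c)"
      define P where "P = form_cov_deriv A D x u (\<lambda>y. form_cov_deriv A D y (coord_field A c (v c) y) X)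
        - form_cov_deriv A D x v (\<lambda>y. form_cov_deriv A D y (coord_field A c (u c) y) X)"
      have U: "open (fst c)" by (rule chart_open[OF c(1)])
      have X: "form_section A (fst c) X"
        unfolding X_def by (rule coord_form_constant_section[OF c(1) U order_refl form_symmetric[OF w c]])
      have P: "P \<in> sym_forms A x"
        unfolding P_def
        by (intro subspace_diff subspace_sym_forms form_cov_deriv_sym_form[OF U c(2) _ t(1)]
            form_cov_deriv_sym_form[OF U c(2) _ t(2)]
            form_cov_deriv_section[OF c(1) U order_refl X coord_field_vector_field[OF c(1)]])
      have P_entry: "P c' = curv c' (snd c' x) (u c') (v c') (w c')" if "c' \<in> A" "x \<in> fst c'" for c'
        using coord_curvature[OF c(1) that(1) c(2) that(2) t w] by (simp add: P_def X_def)
      have "P = 0"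
        by (rule form_eqI[OF P _ c]) (simp_all add: subspace_0 subspace_sym_forms P_entry c *)
      show "form_curvature A D x u v w = 0"
      proof
        fix c'
        show "form_curvature A D x u v w c' = 0 c'"
        proof (cases "c' \<in> charts_at A x")
          case True
          then have c': "c' \<in> A" "x \<in> fst c'" by (auto simp: charts_at_def)
          then show ?thesis using entry[OF c' t] P_entry[OF c'] \<open>P = 0\<close> by simp
        qed (simp add: form_curvature_def)
      qed
    qed
  qed
qed

subsection \<open>The equations of the derived flag in a chart\<close>

text \<open>The row vector that represents the linear form \<open>m \<mapsto> curv c q a b m \<bullet> e\<close>.\<close>

definition curv_row :: "('m, 'n) chart \<Rightarrow> real^'n \<Rightarrow> real^'n \<Rightarrow> real^'n^'n \<Rightarrow> real^'n \<Rightarrow> real^'n^'n"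
  where "curv_row c a b e q = (\<Sum>\<beta>\<in>Basis. (curv c q a b \<beta> \<bullet> e) *\<^sub>R \<beta>)"

text \<open>Symmetry of the matrix is imposed by equations too, so that the kernels consist of components of
  elements of \<open>W\<close>.\<close>

definition flat_symmetric_rows :: "('m, 'n) chart \<Rightarrow> (real^'n \<Rightarrow> real^'n^'n) set"
  where "flat_symmetric_rows c = {curv_row c a b e | a b e. True}
    \<union> {(\<lambda>_. e - transpose e) | e. True}"

lemma inner_curv_row:
  assumes "c \<in> A" "q \<in> snd c ` fst c"
  shows "curv_row c a b e q \<bullet> m = curv c q a b m \<bullet> e"
  by (subst linear_Basis_expansion[OF linear_curv[OF assms], of _ _ m])
    (simp add: curv_row_def inner_sum_left inner_commute[of m] mult.commute)

lemma inner_transpose: "(transpose a :: real^'k^'k) \<bullet> b = a \<bullet> transpose b"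
  unfolding inner_vec_def by (simp add: Finite_Cartesian_Product.transpose_def) (rule sum.swap)

lemma kernel_flat_symmetric_rows:
  assumes "c \<in> A" "q \<in> snd c ` fst c"
  shows "m \<in> kernel_at (flat_symmetric_rows c) q
    \<longleftrightarrow> transpose m = m \<and> (\<forall>a b. curv c q a b m = 0)"
proof -
  have "(\<forall>e. (e - transpose e) \<bullet> m = 0) \<longleftrightarrow> transpose m = m"
  proof
    assume *: "\<forall>e. (e - transpose e) \<bullet> m = 0"
    have "e \<bullet> (m - transpose m) = 0" for e
      using * by (simp add: inner_diff_left inner_diff_right inner_transpose)
    then have "m - transpose m = 0" by (metis inner_eq_zero_iff)
    then show "transpose m = m" by simp
  qed (simp add: inner_diff_left inner_transpose)
  moreover have "(\<forall>e. curv_row c a b e q \<bullet> m = 0) \<longleftrightarrow> curv c q a b m = 0" for a b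
    unfolding inner_curv_row[OF assms] by (metis inner_eq_zero_iff inner_zero_left)
  moreover have "m \<in> kernel_at (flat_symmetric_rows c) q \<longleftrightarrow>
      (\<forall>a b e. curv_row c a b e q \<bullet> m = 0) \<and> (\<forall>e. (e - transpose e) \<bullet> m = 0)"
  proof -
    have rows: "curv_row c a b e \<in> flat_symmetric_rows c"
      "(\<lambda>_. e - transpose e) \<in> flat_symmetric_rows c" for a b e
      unfolding flat_symmetric_rows_def by blast+
    have "(\<exists>a b e. g = curv_row c a b e) \<or> (\<exists>e. g = (\<lambda>_. e - transpose e))"
      if "g \<in> flat_symmetric_rows c" for g
      using that unfolding flat_symmetric_rows_def by blast
    with rows show ?thesis unfolding kernel_at_def mem_Collect_eq by metis
  qed
  ultimately show ?thesis by auto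
qed

lemma curv_power_series:
  assumes chr: "\<And>l i k. power_series_on p r (\<lambda>q. christoffel c q l i $ k)"
  shows "vec_power_series_on p r (\<lambda>q. curv c q a b m)"
proof -
  note conn = conn_power_series[OF chr]
  have "vec_power_series_on p r (\<lambda>q. conn c q h (conn c q k m))" for h k
    by (rule vec_power_series_on_linear_family[OF linear_conn conn conn])
  then show ?thesis
    unfolding curv_def
    by (intro vec_power_series_on_add vec_power_series_on_diff vec_power_series_on_frechet_derivative conn)
qed

lemma curv_row_power_series:
  assumes "\<And>l i k. power_series_on p r (\<lambda>q. christoffel c q l i $ k)"
  shows "vec_power_series_on p r (curv_row c a b e)"
proof -
  have "power_series_on p r (\<lambda>q. curv c q a b \<beta> \<bullet> e)" for \<beta>
    using curv_power_series[OF assms] by (simp add: vec_power_series_on_def)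
  then show ?thesis
    unfolding vec_power_series_on_def curv_row_def inner_sum_left inner_scaleR_left
    by (intro allI power_series_on_sum power_series_on_mult) auto
qed

lemma bundle_equations:
  assumes c: "c \<in> A"
  shows "analytic_bundle_equations (snd c ` fst c) (conn c) (flat_symmetric_rows c)"
proof (rule analytic_bundle_equations.intro)
  show "open (snd c ` fst c)" by (rule chart_open[OF c])
  show "linear (conn c q h)" for q h by (rule linear_conn)
  fix p assume "p \<in> snd c ` fst c"
  then obtain r where r: "r > 0" "ball p r \<subseteq> snd c ` fst c"
    and chr: "\<And>l i k. power_series_on p r (\<lambda>q. christoffel c q l i $ k)"
    using christoffel_power_series[OF c] by blast
  have "vec_power_series_on p r g" if "g \<in> flat_symmetric_rows c" for g
    using that curv_row_power_series[OF chr] by (auto simp: flat_symmetric_rows_def)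
  then show "\<exists>r>0. ball p r \<subseteq> snd c ` fst c \<and> (\<forall>h w. vec_power_series_on p r (\<lambda>q. conn c q h w))
      \<and> (\<forall>g\<in>flat_symmetric_rows c. vec_power_series_on p r g)"
    using r conn_power_series[OF chr] by blast
qed

end

section \<open>The derived flag\<close>

context atlas_connection
begin

lemma form_section_add:
  assumes "open U" "form_section A U X" "form_section A U Z"
  shows "form_section A U (\<lambda>y. X y + Z y)"
  unfolding form_section_def
proof (intro conjI ballI)
  show "X x + Z x \<in> sym_forms A x" if "x \<in> U" for x
    using assms(2,3) that unfolding form_section_def by (blast intro: subspace_add subspace_sym_forms)
  show "smooth_map A (U \<inter> fst c) (\<lambda>x. (X x + Z x) c)" if "c \<in> A" for c
    using assms that chart_open(1)[OF that] unfolding form_section_def plus_fun_apply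
    by (intro smooth_map_add) auto
qed

lemma form_section_scale:
  assumes "open U" "form_section A U X"
  shows "form_section A U (\<lambda>y. r *\<^sub>R X y)"
  unfolding form_section_def
proof (intro conjI ballI)
  show "r *\<^sub>R X x \<in> sym_forms A x" if "x \<in> U" for x
    using assms(2) that unfolding form_section_def by (blast intro: subspace_scale subspace_sym_forms)
  show "smooth_map A (U \<inter> fst c) (\<lambda>x. (r *\<^sub>R X x) c)" if "c \<in> A" for c
    using assms that chart_open(1)[OF that] unfolding form_section_def scaleR_fun_def
    by (intro smooth_map_mult smooth_map_const) auto
qed

lemma form_section_zero:
  assumes "open U"
  shows "form_section A U (\<lambda>y. 0)"
  unfolding form_section_def
proof (intro conjI ballI)
  show "0 \<in> sym_forms A x" for x by (rule subspace_0[OF subspace_sym_forms])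
  have "smooth_map A (U \<inter> fst c) (\<lambda>x. 0 :: real^'n^'n)" if "c \<in> A" for c
    by (rule smooth_map_const) (use assms chart_open(1)[OF that] in auto)
  then show "smooth_map A (U \<inter> fst c) (\<lambda>x. (0 :: ('m, 'n) form_family) c)" if "c \<in> A" for c
    using that by simp
qed

lemma form_cov_deriv_add:
  assumes U: "open U" "x \<in> U" and X: "form_section A U X" and Z: "form_section A U Z"
    and v: "v \<in> tangent_space A x"
  shows "form_cov_deriv A D x v (\<lambda>y. X y + Z y) = form_cov_deriv A D x v X + form_cov_deriv A D x v Z"
proof -
  obtain c where c: "c \<in> A" "x \<in> fst c" using chart_exists by blast
  let ?U = "U \<inter> fst c"
  have U': "open ?U" "?U \<subseteq> fst c" "x \<in> ?U" using U c chart_open(1)[OF c(1)] by auto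
  have X': "smooth_on (snd c ` ?U) (in_chart c X)" and Z': "smooth_on (snd c ` ?U) (in_chart c Z)"
    using form_section_smooth[OF form_section_subset[OF X] c(1) U'(1,2)]
      form_section_smooth[OF form_section_subset[OF Z] c(1) U'(1,2)] by auto
  have XZ: "smooth_on (snd c ` ?U) (in_chart c (\<lambda>y. X y + Z y))"
    unfolding plus_fun_apply by (rule smooth_on_add[OF chart_image_open'[OF c(1) U'(1,2)] X' Z'])
  have p: "snd c x \<in> snd c ` ?U" using U'(3) by blast
  have "((\<lambda>p. in_chart c X p + in_chart c Z p) has_derivative (\<lambda>h. frechet_derivative (in_chart c X) (at (snd c x)) h
      + frechet_derivative (in_chart c Z) (at (snd c x)) h)) (at (snd c x))"
    by (intro has_derivative_add smooth_on_has_derivative[OF X' p] smooth_on_has_derivative[OF Z' p])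
  from frechet_derivative_eqI[OF this]
  have "form_cov_deriv A D x v (\<lambda>y. X y + Z y) c = form_cov_deriv A D x v X c + form_cov_deriv A D x v Z c"
    unfolding form_cov_deriv_in_chart[where X = X, OF c(1) U'(1,2) X' U'(3) v]
      form_cov_deriv_in_chart[where X = Z, OF c(1) U'(1,2) Z' U'(3) v]
      form_cov_deriv_in_chart[where X = "\<lambda>y. X y + Z y", OF c(1) U'(1,2) XZ U'(3) v]
    by (simp add: linear_add[OF linear_conn])
  then show ?thesis
    by (intro form_eqI[OF form_cov_deriv_sym_form[OF U form_section_add[OF U(1) X Z] v]
          subspace_add[OF subspace_sym_forms form_cov_deriv_sym_form[OF U X v] form_cov_deriv_sym_form[OF U Z v]] c])
      simp
qed

lemma form_cov_deriv_scale:
  assumes U: "open U" "x \<in> U" and X: "form_section A U X" and v: "v \<in> tangent_space A x"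
  shows "form_cov_deriv A D x v (\<lambda>y. r *\<^sub>R X y) = r *\<^sub>R form_cov_deriv A D x v X"
proof -
  obtain c where c: "c \<in> A" "x \<in> fst c" using chart_exists by blast
  let ?U = "U \<inter> fst c"
  have U': "open ?U" "?U \<subseteq> fst c" "x \<in> ?U" using U c chart_open(1)[OF c(1)] by auto
  have X': "smooth_on (snd c ` ?U) (in_chart c X)"
    using form_section_smooth[OF form_section_subset[OF X] c(1) U'(1,2)] by auto
  have rX: "smooth_on (snd c ` ?U) (in_chart c (\<lambda>y. r *\<^sub>R X y))"
    using form_section_smooth[OF form_section_subset[OF form_section_scale[OF U(1) X]] c(1) U'(1,2)] by auto
  have p: "snd c x \<in> snd c ` ?U" using U'(3) by blast
  have "((\<lambda>p. r *\<^sub>R in_chart c X p) has_derivative (\<lambda>h. r *\<^sub>R frechet_derivative (in_chart c X) (at (snd c x)) h)) (at (snd c x))"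
    by (intro has_derivative_scaleR_right smooth_on_has_derivative[OF X' p])
  from frechet_derivative_eqI[OF this]
  have "form_cov_deriv A D x v (\<lambda>y. r *\<^sub>R X y) c = r *\<^sub>R form_cov_deriv A D x v X c"
    unfolding form_cov_deriv_in_chart[where X = X, OF c(1) U'(1,2) X' U'(3) v]
      form_cov_deriv_in_chart[where X = "\<lambda>y. r *\<^sub>R X y", OF c(1) U'(1,2) rX U'(3) v]
    by (simp add: linear_scale[OF linear_conn] scaleR_fun_def scaleR_diff_right)
  then show ?thesis
    by (intro form_eqI[OF form_cov_deriv_sym_form[OF U form_section_scale[OF U(1) X] v]
          subspace_scale[OF subspace_sym_forms form_cov_deriv_sym_form[OF U X v]] c])
      (simp add: scaleR_fun_def)
qed

subsection \<open>Fibres of the flag\<close>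

lemma mem_smooth_part:
  "w \<in> fib (smooth_part A V) x \<longleftrightarrow> (\<exists>U X. x \<in> U \<and> local_section A V U X \<and> X x = w)"
  unfolding fib_def smooth_part_def local_section_def by auto

lemma local_section_smooth_part: "local_section A V U X \<Longrightarrow> local_section A (smooth_part A V) U X"
  using mem_smooth_part unfolding local_section_def by blast

lemma subspace_smooth_part:
  assumes V: "\<And>y. subspace (fib V y)"
  shows "subspace (fib (smooth_part A V) x)"
  unfolding subspace_def
proof (intro conjI ballI allI)
  have "local_section A V UNIV (\<lambda>_. 0)"
    unfolding local_section_def using form_section_zero[OF open_UNIV] subspace_0[OF V] by simp
  then show "0 \<in> fib (smooth_part A V) x" unfolding mem_smooth_part by blast
next
  fix u w assume "u \<in> fib (smooth_part A V) x" "w \<in> fib (smooth_part A V) x"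
  then obtain U X U' X' where X: "x \<in> U" "local_section A V U X" "X x = u"
    and X': "x \<in> U'" "local_section A V U' X'" "X' x = w"
    unfolding mem_smooth_part by blast
  have "local_section A V (U \<inter> U') (\<lambda>y. X y + X' y)"
    using X(2) X'(2) unfolding local_section_def
    by (auto intro!: form_section_add subspace_add[OF V] intro: form_section_subset)
  then show "u + w \<in> fib (smooth_part A V) x"
    using X X' unfolding mem_smooth_part by (intro exI[of _ "U \<inter> U'"] exI[of _ "\<lambda>y. X y + X' y"]) auto
next
  fix r u assume "u \<in> fib (smooth_part A V) x"
  then obtain U X where X: "x \<in> U" "local_section A V U X" "X x = u"
    unfolding mem_smooth_part by blast
  have "local_section A V U (\<lambda>y. r *\<^sub>R X y)"
    using X(2) unfolding local_section_def by (auto intro!: form_section_scale subspace_scale[OF V])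
  then show "r *\<^sub>R u \<in> fib (smooth_part A V) x"
    using X unfolding mem_smooth_part by blast
qed

text \<open>A coset of the fibre is the zero coset exactly if its representative lies in the fibre.\<close>

lemma mem_kernel:
  assumes V: "subspace (fib V x)"
  shows "w \<in> fib (kernel_second_fundamental_form A D V) x \<longleftrightarrow>
    (\<exists>U X. x \<in> U \<and> local_section A V U X \<and> X x = w \<and>
      (\<forall>v\<in>tangent_space A x. form_cov_deriv A D x v X \<in> fib V x))"
proof -
  have coset: "{z' + z | z. z \<in> fib V x} = fib V x \<longleftrightarrow> z' \<in> fib V x" for z'
  proof
    assume *: "{z' + z | z. z \<in> fib V x} = fib V x"
    have "z' + 0 \<in> {z' + z | z. z \<in> fib V x}" using subspace_0[OF V] by blast
    then show "z' \<in> fib V x" unfolding * by simp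
  next
    assume z': "z' \<in> fib V x"
    show "{z' + z | z. z \<in> fib V x} = fib V x"
    proof (intro antisym subsetI)
      fix y assume "y \<in> {z' + z | z. z \<in> fib V x}"
      then show "y \<in> fib V x" using subspace_add[OF V z'] by blast
    next
      fix y assume "y \<in> fib V x"
      then have "y = z' + (y - z') \<and> y - z' \<in> fib V x" using subspace_diff[OF V _ z'] by simp
      then show "y \<in> {z' + z | z. z \<in> fib V x}" by blast
    qed
  qed
  have restrict: "(\<lambda>v\<in>tangent_space A x. fib V x)
      = (\<lambda>v\<in>tangent_space A x. {form_cov_deriv A D x v X + z | z. z \<in> fib V x})
    \<longleftrightarrow> (\<forall>v\<in>tangent_space A x. form_cov_deriv A D x v X \<in> fib V x)" for X
  proof -
    have "(\<lambda>v\<in>tangent_space A x. fib V x)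
      = (\<lambda>v\<in>tangent_space A x. {form_cov_deriv A D x v X + z | z. z \<in> fib V x})
      \<longleftrightarrow> (\<forall>v\<in>tangent_space A x. {form_cov_deriv A D x v X + z | z. z \<in> fib V x} = fib V x)"
      unfolding restrict_def fun_eq_iff by (metis (no_types, lifting))
    then show ?thesis unfolding coset .
  qed
  have "w \<in> fib V x" if "local_section A V U X" "x \<in> U" "X x = w" for U X
    using that unfolding local_section_def by blast
  moreover have "w \<in> fib (kernel_second_fundamental_form A D V) x \<longleftrightarrow>
      w \<in> fib V x \<and> second_fundamental_form A D V x w (\<lambda>v\<in>tangent_space A x. fib V x)"
    by (simp add: fib_def kernel_second_fundamental_form_def)
  ultimately show ?thesis
    unfolding second_fundamental_form_def restrict by metis
qed

lemma subspace_kernel: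
  assumes V: "\<And>y. subspace (fib V y)"
  shows "subspace (fib (kernel_second_fundamental_form A D V) x)"
  unfolding subspace_def
proof (intro conjI ballI allI)
  have "local_section A V UNIV (\<lambda>_. 0)"
    unfolding local_section_def using form_section_zero[OF open_UNIV] subspace_0[OF V] by simp
  moreover have "form_cov_deriv A D x v (\<lambda>_. 0) = 0" if v: "v \<in> tangent_space A x" for v
    using form_cov_deriv_scale[OF open_UNIV UNIV_I form_section_zero[OF open_UNIV] v, of 0]
    by (simp only: scaleR_zero_left)
  ultimately show "0 \<in> fib (kernel_second_fundamental_form A D V) x"
    unfolding mem_kernel[OF V] using subspace_0[OF V]
    by (intro exI[of _ UNIV] exI[of _ "\<lambda>_. 0"]) simp
next
  fix u w assume "u \<in> fib (kernel_second_fundamental_form A D V) x" "w \<in> fib (kernel_second_fundamental_form A D V) x"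
  then obtain U X U' X' where X: "x \<in> U" "local_section A V U X" "X x = u"
      "\<And>v. v \<in> tangent_space A x \<Longrightarrow> form_cov_deriv A D x v X \<in> fib V x"
    and X': "x \<in> U'" "local_section A V U' X'" "X' x = w"
      "\<And>v. v \<in> tangent_space A x \<Longrightarrow> form_cov_deriv A D x v X' \<in> fib V x"
    unfolding mem_kernel[OF V] by blast
  have sections: "open (U \<inter> U')" "x \<in> U \<inter> U'" "form_section A (U \<inter> U') X" "form_section A (U \<inter> U') X'"
    using X X' unfolding local_section_def by (auto intro: form_section_subset)
  have "local_section A V (U \<inter> U') (\<lambda>y. X y + X' y)"
    using X(2) X'(2) sections unfolding local_section_def
    by (auto intro!: form_section_add subspace_add[OF V])
  moreover have "form_cov_deriv A D x v (\<lambda>y. X y + X' y) \<in> fib V x" if v: "v \<in> tangent_space A x" for v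
    unfolding form_cov_deriv_add[OF sections v] by (rule subspace_add[OF V X(4)[OF v] X'(4)[OF v]])
  ultimately show "u + w \<in> fib (kernel_second_fundamental_form A D V) x"
    unfolding mem_kernel[OF V] using X X'
    by (intro exI[of _ "U \<inter> U'"] exI[of _ "\<lambda>y. X y + X' y"]) simp
next
  fix r u assume "u \<in> fib (kernel_second_fundamental_form A D V) x"
  then obtain U X where X: "x \<in> U" "local_section A V U X" "X x = u"
      "\<And>v. v \<in> tangent_space A x \<Longrightarrow> form_cov_deriv A D x v X \<in> fib V x"
    unfolding mem_kernel[OF V] by blast
  have sections: "open U" "form_section A U X" using X unfolding local_section_def by auto
  have "local_section A V U (\<lambda>y. r *\<^sub>R X y)"
    using X(2) unfolding local_section_def by (auto intro!: form_section_scale subspace_scale[OF V])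
  moreover have "form_cov_deriv A D x v (\<lambda>y. r *\<^sub>R X y) \<in> fib V x" if v: "v \<in> tangent_space A x" for v
    unfolding form_cov_deriv_scale[OF sections(1) X(1) sections(2) v] by (rule subspace_scale[OF V X(4)[OF v]])
  ultimately show "r *\<^sub>R u \<in> fib (kernel_second_fundamental_form A D V) x"
    unfolding mem_kernel[OF V] using X
    by (intro exI[of _ U] exI[of _ "\<lambda>y. r *\<^sub>R X y"]) simp
qed

lemma mem_derived_V_0:
  assumes "c \<in> A" "x \<in> fst c"
  shows "w \<in> fib (derived_V A D 0) x \<longleftrightarrow> w \<in> sym_forms A x \<and> (\<forall>a b. curv c (snd c x) a b (w c) = 0)"
  using form_curvature_zero_iff[OF assms, of w] by (auto simp: fib_def)

lemma subspace_derived_V: "subspace (fib (derived_V A D i) x)"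
proof (induction i arbitrary: x)
  case 0
  obtain c where c: "c \<in> A" "x \<in> fst c" using chart_exists by blast
  have lin: "linear (curv c (snd c x) a b)" for a b
    by (rule linear_curv) (use c in auto)
  have eq: "fib (derived_V A D 0) x = {w \<in> sym_forms A x. \<forall>a b. curv c (snd c x) a b (w c) = 0}"
    using mem_derived_V_0[OF c] by blast
  have scale: "(r *\<^sub>R w) c = r *\<^sub>R w c" for r and w :: "('m, 'n) form_family"
    by (simp add: scaleR_fun_def)
  show ?case
    unfolding eq subspace_def mem_Collect_eq
    by (simp add: subspace_0[OF subspace_sym_forms] subspace_add[OF subspace_sym_forms]
        subspace_scale[OF subspace_sym_forms] scale linear_0[OF lin] linear_add[OF lin] linear_scale[OF lin])
next
  case (Suc i)
  then show ?case by (simp add: subspace_kernel subspace_smooth_part)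
qed

lemma subspace_derived_W: "subspace (fib (derived_W A D i) x)"
  unfolding derived_W_def by (rule subspace_smooth_part[OF subspace_derived_V])

lemma derived_W_subset_V: "w \<in> fib (derived_W A D i) x \<Longrightarrow> w \<in> fib (derived_V A D i) x"
  unfolding derived_W_def mem_smooth_part local_section_def by auto

lemma mem_derived_V_Suc:
  "w \<in> fib (derived_V A D (Suc i)) x \<longleftrightarrow>
    (\<exists>U X. x \<in> U \<and> local_section A (derived_W A D i) U X \<and> X x = w \<and>
      (\<forall>v\<in>tangent_space A x. form_cov_deriv A D x v X \<in> fib (derived_W A D i) x))"
  using mem_kernel[OF subspace_derived_W[of i x]] by (simp add: derived_W_def)

subsection \<open>The flag in a chart\<close>

abbreviation kernel_upto :: "('m, 'n) chart \<Rightarrow> nat \<Rightarrow> real^'n \<Rightarrow> (real^'n^'n) set"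
  where "kernel_upto c k \<equiv> kernel_at (analytic_bundle_equations.rows_upto (conn c) (flat_symmetric_rows c) k)"

abbreviation kernel_all :: "('m, 'n) chart \<Rightarrow> real^'n \<Rightarrow> (real^'n^'n) set"
  where "kernel_all c \<equiv> kernel_at (analytic_bundle_equations.all_rows (conn c) (flat_symmetric_rows c))"

lemma kernel_upto_0: "c \<in> A \<Longrightarrow> kernel_upto c 0 q = kernel_at (flat_symmetric_rows c) q"
  by (simp add: analytic_bundle_equations.rows_upto_def[OF bundle_equations]
      analytic_bundle_equations.rows.simps[OF bundle_equations])

lemma kernel_all_subset: "c \<in> A \<Longrightarrow> kernel_all c q \<subseteq> kernel_at (flat_symmetric_rows c) q"
  using kernel_at_antimono[OF analytic_bundle_equations.rows_upto_subset_all[OF bundle_equations, of c 0]]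
  by (simp add: kernel_upto_0)

lemma cov_in_chart:
  assumes c: "c \<in> A" and U: "open U" "U \<subseteq> fst c" and X: "form_section A U X"
    and x: "x \<in> U" and v: "v \<in> tangent_space A x"
  shows "analytic_bundle_equations.cov (conn c) (v c) (in_chart c X) (snd c x) = form_cov_deriv A D x v X c"
proof -
  have "x \<in> fst c" using x U by auto
  then show ?thesis
    using form_cov_deriv_in_chart[where X = X, OF c U form_section_smooth[OF X c U] x v]
    by (simp add: analytic_bundle_equations.cov_def[OF bundle_equations[OF c]] chart_inv_left c)
qed

text \<open>Differentiating the equations along a section: each step of the flag satisfies one more
  generation of equations, whether or not the ranks jump.\<close>

lemma derived_W_in_kernel_upto:
  assumes c: "c \<in> A"
  shows "x \<in> fst c \<Longrightarrow> w \<in> fib (derived_W A D i) x \<Longrightarrow> w c \<in> kernel_upto c i (snd c x)"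
proof (induction i arbitrary: x w)
  case 0
  then have "w \<in> sym_forms A x" "\<forall>a b. curv c (snd c x) a b (w c) = 0"
    using derived_W_subset_V mem_derived_V_0[OF c] by blast+
  then show ?case
    using 0 by (simp add: kernel_upto_0 c kernel_flat_symmetric_rows form_symmetric)
next
  case (Suc i)
  interpret eq: analytic_bundle_equations "snd c ` fst c" "conn c" "flat_symmetric_rows c"
    by (rule bundle_equations[OF c])
  obtain U X where U: "x \<in> U" and X: "local_section A (derived_W A D i) U X" "X x = w"
    and nabla: "\<And>v. v \<in> tangent_space A x \<Longrightarrow> form_cov_deriv A D x v X \<in> fib (derived_W A D i) x"
    using derived_W_subset_V[OF Suc.prems(2)] unfolding mem_derived_V_Suc by blast
  let ?U = "U \<inter> fst c"
  have U': "open ?U" "?U \<subseteq> fst c" "x \<in> ?U" and X': "form_section A ?U X"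
    using X(1) U Suc.prems(1) chart_open(1)[OF c] unfolding local_section_def by (auto intro: form_section_subset)
  let ?T = "snd c ` ?U"
  have T: "open ?T" "?T \<subseteq> snd c ` fst c" "snd c x \<in> ?T"
    using chart_image_open'[OF c U'(1,2)] U'(3) by auto
  have \<xi>: "smooth_on ?T (in_chart c X)" by (rule form_section_smooth[OF X' c U'(1,2)])
  have ker: "in_chart c X q \<in> kernel_upto c i q" if "q \<in> ?T" for q
  proof -
    note inv = chart_inv_image[OF c U'(2) that]
    have "X (chart_inv c q) \<in> fib (derived_W A D i) (chart_inv c q)"
      using X(1) inv(1) unfolding local_section_def by blast
    then show ?thesis using Suc.IH[of "chart_inv c q"] inv by auto
  qed
  have at: "in_chart c X (snd c x) = w c" using X(2) Suc.prems(1) by (simp add: chart_inv_left c)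
  have cov: "eq.cov h (in_chart c X) (snd c x) \<in> kernel_upto c i (snd c x)" for h
  proof -
    have v: "coord_field A c h x \<in> tangent_space A x" by (rule coord_field_tangent[OF c Suc.prems(1)])
    show ?thesis
      using Suc.IH[OF Suc.prems(1) nabla[OF v]] cov_in_chart[OF c U'(1,2) X' U'(3) v]
      by (simp add: coord_field_self c Suc.prems(1))
  qed
  show ?case
    unfolding kernel_at_def mem_Collect_eq
  proof
    fix g assume "g \<in> eq.rows_upto (Suc i)"
    then consider "g \<in> eq.rows_upto i" | h f where "g = eq.dual_cov h f" "f \<in> eq.rows_upto i"
      using eq.rows_upto_SucE by blast
    then show "g (snd c x) \<bullet> w c = 0"
    proof cases
      case 1
      then show ?thesis using ker[OF T(3)] at by (simp add: kernel_at_def)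
    next
      case 2
      have "f q \<bullet> in_chart c X q = 0" if "q \<in> ?T" for q
        using ker[OF that] 2(2) by (simp add: kernel_at_def)
      from eq.pairing_derivative_zero[OF _ T(1,2) \<xi> this T(3), of h]
      have "eq.dual_cov h f (snd c x) \<bullet> w c + f (snd c x) \<bullet> eq.cov h (in_chart c X) (snd c x) = 0"
        using 2(2) eq.rows_upto_subset_all at by auto
      then show ?thesis using cov[of h] 2 by (simp add: kernel_at_def)
    qed
  qed
qed

text \<open>The elements of \<open>W\<close> over \<open>x\<close> that satisfy all generations of equations in the chart \<open>c\<close>; it turns out
  to be the same set for every chart.\<close>

definition solution_fibre :: "('m, 'n) chart \<Rightarrow> 'm \<Rightarrow> ('m, 'n) form_family set"
  where "solution_fibre c x = {w \<in> sym_forms A x. w c \<in> kernel_all c (snd c x)}"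

lemma derived_W_in_solution_fibre:
  assumes c: "c \<in> A" "x \<in> fst c" and i: "Suc (DIM(real^'n^'n)) \<le> i" and w: "w \<in> fib (derived_W A D i) x"
  shows "w \<in> solution_fibre c x"
proof -
  interpret eq: analytic_bundle_equations "snd c ` fst c" "conn c" "flat_symmetric_rows c"
    by (rule bundle_equations[OF c(1)])
  obtain U X where U: "x \<in> U" and X: "local_section A (derived_W A D i) U X" "X x = w"
    using w local_section_smooth_part unfolding derived_W_def mem_smooth_part by blast
  let ?U = "U \<inter> fst c"
  have U': "open ?U" "?U \<subseteq> fst c" "x \<in> ?U" and X': "form_section A ?U X"
    using X(1) U c(2) chart_open(1)[OF c(1)] unfolding local_section_def by (auto intro: form_section_subset)
  have "in_chart c X (snd c x) \<in> kernel_all c (snd c x)"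
  proof (rule eq.section_in_kernel[of "snd c ` ?U"])
    show "open (snd c ` ?U)" by (rule chart_image_open'[OF c(1) U'(1,2)])
    show "smooth_on (snd c ` ?U) (in_chart c X)" by (rule form_section_smooth[OF X' c(1) U'(1,2)])
    fix q assume q: "q \<in> snd c ` ?U"
    note inv = chart_inv_image[OF c(1) U'(2) q]
    have "X (chart_inv c q) \<in> fib (derived_W A D i) (chart_inv c q)"
      using X(1) inv(1) unfolding local_section_def by blast
    then have "in_chart c X q \<in> kernel_upto c i q"
      using derived_W_in_kernel_upto[OF c(1), of "chart_inv c q"] inv by auto
    then show "in_chart c X q \<in> kernel_upto c (Suc (DIM(real^'n^'n))) q"
      using kernel_at_antimono[OF eq.rows_upto_mono[OF i]] by blast
  qed (use U' in auto)
  moreover have "w \<in> sym_forms A x"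
    using X U unfolding local_section_def form_section_def by auto
  ultimately show ?thesis
    using X(2) c by (simp add: solution_fibre_def chart_inv_left)
qed

text \<open>Since the rank of all equations is locally constant, their solutions extend to sections, and
  these are closed under covariant differentiation.\<close>

lemma solution_section:
  assumes c: "c \<in> A" "x \<in> fst c" and w: "w \<in> solution_fibre c x"
  obtains U X where "open U" "x \<in> U" "U \<subseteq> fst c" "form_section A U X" "X x = w"
    "\<And>y. y \<in> U \<Longrightarrow> X y \<in> solution_fibre c y"
    "\<And>v. v \<in> tangent_space A x \<Longrightarrow> form_cov_deriv A D x v X \<in> solution_fibre c x"
proof -
  interpret eq: analytic_bundle_equations "snd c ` fst c" "conn c" "flat_symmetric_rows c"
    by (rule bundle_equations[OF c(1)])
  let ?p = "snd c x"
  have p: "?p \<in> snd c ` fst c" using c by auto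
  obtain r where r: "r > 0" "ball ?p r \<subseteq> snd c ` fst c"
    and rank: "\<And>q. q \<in> ball ?p r \<Longrightarrow> dim (rows_at eq.all_rows q) \<le> dim (rows_at eq.all_rows ?p)"
    using eq.rank_upper_semicontinuous[OF p] by blast
  have "smooth_on (ball ?p r) g" if "g \<in> eq.all_rows" for g
    by (rule smooth_on_subset[OF eq.smooth_rows[OF that] r(2)])
  moreover have "w c \<in> kernel_all c ?p" using w by (simp add: solution_fibre_def)
  moreover have "?p \<in> ball ?p r" using r(1) by simp
  ultimately obtain T \<xi> where T: "open T" "?p \<in> T" "T \<subseteq> ball ?p r" "smooth_on T \<xi>" "\<xi> ?p = w c"
    and ker: "\<And>q. q \<in> T \<Longrightarrow> \<xi> q \<in> kernel_all c q"
    using smooth_section_of_kernel[OF open_ball, of ?p ?p r eq.all_rows "w c"] rank by blast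
  define U where "U = {y \<in> fst c. snd c y \<in> T}"
  have U: "open U" "U \<subseteq> fst c" "x \<in> U"
    using chart_preimage_open[OF c(1) T(1)] c(2) T(2) by (auto simp: U_def)
  have UT: "snd c ` U \<subseteq> T" by (auto simp: U_def)
  define X where "X y = coord_form A c (\<xi> (snd c y)) y" for y
  have sym: "transpose (\<xi> (snd c y)) = \<xi> (snd c y)" if "y \<in> U" for y
  proof -
    have "\<xi> (snd c y) \<in> kernel_at (flat_symmetric_rows c) (snd c y)"
      using ker kernel_all_subset[OF c(1)] that by (auto simp: U_def)
    then show ?thesis using kernel_flat_symmetric_rows[OF c(1)] that U(2) by blast
  qed
  have X: "form_section A U X"
    unfolding X_def by (rule coord_form_section[OF c(1) U(1,2) smooth_on_subset[OF T(4) UT] sym])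
  have X_chart: "X y c = \<xi> (snd c y)" if "y \<in> U" for y
    using that U(2) by (auto simp: X_def coord_form_self c)
  have Xs: "X y \<in> solution_fibre c y" if "y \<in> U" for y
    using X that ker X_chart[OF that] by (auto simp: solution_fibre_def form_section_def U_def)
  have "X x = w"
    using w c T(5) by (simp add: X_def solution_fibre_def form_coord_form)
  moreover have "form_cov_deriv A D x v X \<in> solution_fibre c x" if v: "v \<in> tangent_space A x" for v
  proof -
    have "eq.cov (v c) (in_chart c X) ?p \<in> kernel_all c ?p"
    proof (rule eq.cov_in_kernel[of "snd c ` U"])
      show "open (snd c ` U)" by (rule chart_image_open'[OF c(1) U(1,2)])
      show "smooth_on (snd c ` U) (in_chart c X)" by (rule form_section_smooth[OF X c(1) U(1,2)])
      fix q assume q: "q \<in> snd c ` U"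
      note inv = chart_inv_image[OF c(1) U(2) q]
      show "in_chart c X q \<in> kernel_all c q"
        using Xs[OF inv(1)] inv(2) by (simp add: solution_fibre_def)
    qed (use U in auto)
    then show ?thesis
      using cov_in_chart[OF c(1) U(1,2) X U(3) v] form_cov_deriv_sym_form[OF U(1,3) X v]
      by (simp add: solution_fibre_def)
  qed
  ultimately show thesis using that[OF U(1,3,2) X] Xs by blast
qed

lemma solution_fibre_subset_smooth_part:
  assumes c: "c \<in> A" and V: "\<And>y. y \<in> fst c \<Longrightarrow> solution_fibre c y \<subseteq> fib V y"
    and x: "x \<in> fst c" and w: "w \<in> solution_fibre c x"
  shows "w \<in> fib (smooth_part A V) x"
proof -
  obtain U X where X: "open U" "x \<in> U" "U \<subseteq> fst c" "form_section A U X" "X x = w"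
    "\<And>y. y \<in> U \<Longrightarrow> X y \<in> solution_fibre c y"
    by (rule solution_section[OF c x w]) blast
  then have "local_section A V U X" using V unfolding local_section_def by blast
  then show ?thesis using X unfolding mem_smooth_part by blast
qed

lemma solution_fibre_subset_derived_V:
  assumes c: "c \<in> A"
  shows "x \<in> fst c \<Longrightarrow> solution_fibre c x \<subseteq> fib (derived_V A D i) x"
proof (induction i arbitrary: x)
  case 0
  show ?case
  proof
    fix w assume w: "w \<in> solution_fibre c x"
    then have "w c \<in> kernel_at (flat_symmetric_rows c) (snd c x)"
      using kernel_all_subset[OF c] by (auto simp: solution_fibre_def)
    then have "\<forall>a b. curv c (snd c x) a b (w c) = 0"
      using kernel_flat_symmetric_rows[OF c] 0 by blast
    then show "w \<in> fib (derived_V A D 0) x"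
      using w unfolding mem_derived_V_0[OF c 0] by (simp add: solution_fibre_def)
  qed
next
  case (Suc i)
  have W: "solution_fibre c y \<subseteq> fib (derived_W A D i) y" if "y \<in> fst c" for y
    unfolding derived_W_def using solution_fibre_subset_smooth_part[OF c Suc.IH that] by blast
  show ?case
  proof
    fix w assume w: "w \<in> solution_fibre c x"
    obtain U X where X: "open U" "x \<in> U" "U \<subseteq> fst c" "form_section A U X" "X x = w"
      "\<And>y. y \<in> U \<Longrightarrow> X y \<in> solution_fibre c y"
      "\<And>v. v \<in> tangent_space A x \<Longrightarrow> form_cov_deriv A D x v X \<in> solution_fibre c x"
      by (rule solution_section[OF c Suc.prems w]) blast
    then have "local_section A (derived_W A D i) U X" using W unfolding local_section_def by blast
    then show "w \<in> fib (derived_V A D (Suc i)) x"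
      using X W[OF Suc.prems] unfolding mem_derived_V_Suc by blast
  qed
qed

text \<open>The right-hand side does not depend on \<open>i\<close>, so the flag stabilises; the left-hand side does not
  depend on \<open>c\<close>.\<close>

proposition fib_derived_W:
  assumes c: "c \<in> A" "x \<in> fst c" and i: "Suc (DIM(real^'n^'n)) \<le> i"
  shows "fib (derived_W A D i) x = solution_fibre c x"
proof
  show "fib (derived_W A D i) x \<subseteq> solution_fibre c x"
    using derived_W_in_solution_fibre[OF c i] by blast
  show "solution_fibre c x \<subseteq> fib (derived_W A D i) x"
    unfolding derived_W_def
    using solution_fibre_subset_smooth_part[OF c(1) solution_fibre_subset_derived_V[OF c(1)] c(2)] by blast
qed

lemma fib_W_tilde:
  assumes "c \<in> A" "x \<in> fst c"
  shows "fib (W_tilde A D) x = solution_fibre c x"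
proof -
  let ?N = "Suc (DIM(real^'n^'n))"
  have "derived_W A D l = derived_W A D ?N" if "?N \<le> l" for l
  proof -
    have "fib (derived_W A D l) y = fib (derived_W A D ?N) y" for y
    proof -
      obtain c where c: "c \<in> A" "y \<in> fst c" using chart_exists by blast
      show ?thesis using fib_derived_W[OF c that] fib_derived_W[OF c order_refl] by simp
    qed
    then have "z \<in> derived_W A D l \<longleftrightarrow> z \<in> derived_W A D ?N" for z
      by (cases z) (simp add: fib_def set_eq_iff)
    then show ?thesis by blast
  qed
  then have stable: "\<forall>l\<ge>?N. derived_W A D l = derived_W A D ?N" by blast
  define k where "k = (LEAST k. \<forall>l\<ge>k. derived_W A D l = derived_W A D k)"
  have "\<forall>l\<ge>k. derived_W A D l = derived_W A D k"
    unfolding k_def by (rule LeastI[of "\<lambda>k. \<forall>l\<ge>k. derived_W A D l = derived_W A D k", OF stable])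
  \<comment> \<open>The least such index may well be smaller than \<open>?N\<close>, where the fibres are known.\<close>
  then have "derived_W A D (max ?N k) = derived_W A D k" using max.cobounded2 by blast
  also have "\<dots> = W_tilde A D" unfolding W_tilde_def k_def ..
  finally show ?thesis using fib_derived_W[OF assms max.cobounded1, of k] by simp
qed

subsection \<open>The stable term is a vector bundle\<close>

lemma coord_form_kernel:
  assumes c: "c \<in> A" "x \<in> fst c"
  shows "(\<lambda>m. coord_form A c m x) ` kernel_all c (snd c x) = solution_fibre c x"
proof (intro antisym subsetI)
  fix w assume "w \<in> (\<lambda>m. coord_form A c m x) ` kernel_all c (snd c x)"
  then obtain m where m: "m \<in> kernel_all c (snd c x)" "w = coord_form A c m x" by blast
  then have "m \<in> kernel_at (flat_symmetric_rows c) (snd c x)" using kernel_all_subset[OF c(1)] by blast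
  then have "transpose m = m"
    using kernel_flat_symmetric_rows[OF c(1)] c(2) by blast
  then show "w \<in> solution_fibre c x"
    using m c by (simp add: solution_fibre_def coord_form_sym coord_form_self)
next
  fix w assume "w \<in> solution_fibre c x"
  then have "w = coord_form A c (w c) x" "w c \<in> kernel_all c (snd c x)"
    using c by (simp_all add: solution_fibre_def form_coord_form)
  then show "w \<in> (\<lambda>m. coord_form A c m x) ` kernel_all c (snd c x)" by blast
qed

text \<open>The kernels in two charts are the components of the same fibre, related by the linear change of
  components.\<close>

lemma dim_kernel_chart_independent:
  assumes c: "c \<in> A" "x \<in> fst c" and c': "c' \<in> A" "x \<in> fst c'"
  shows "dim (kernel_all c (snd c x)) = dim (kernel_all c' (snd c' x))"
proof -
  have le: "dim (kernel_all c' (snd c' x)) \<le> dim (kernel_all c (snd c x))"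
    if c: "c \<in> A" "x \<in> fst c" and c': "c' \<in> A" "x \<in> fst c'" for c c'
  proof -
    have "kernel_all c' (snd c' x) \<subseteq> (\<lambda>m. coord_form A c m x c') ` kernel_all c (snd c x)"
    proof
      fix m assume m: "m \<in> kernel_all c' (snd c' x)"
      then have "coord_form A c' m x \<in> solution_fibre c' x" using coord_form_kernel[OF c'] by blast
      then have "coord_form A c' m x \<in> solution_fibre c x"
        using fib_W_tilde[OF c] fib_W_tilde[OF c'] by simp
      then obtain m' where "m' \<in> kernel_all c (snd c x)" "coord_form A c' m x = coord_form A c m' x"
        using coord_form_kernel[OF c] by blast
      then show "m \<in> (\<lambda>m. coord_form A c m x c') ` kernel_all c (snd c x)"
        using coord_form_self[OF c', of m] by (intro image_eqI[of _ _ m']) auto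
    qed
    then have "dim (kernel_all c' (snd c' x)) \<le> dim ((\<lambda>m. coord_form A c m x c') ` kernel_all c (snd c x))"
      by (rule dim_subset)
    also have "\<dots> \<le> dim (kernel_all c (snd c x))"
      by (rule dim_image_le) (use linear_compose[OF linear_coord_form linear_fun_apply] in \<open>simp add: o_def\<close>)
    finally show ?thesis .
  qed
  show ?thesis using le[OF c c'] le[OF c' c] by simp
qed

lemma local_frame:
  assumes c: "c \<in> A" "x \<in> fst c" and d: "d = dim (kernel_all c (snd c x))"
  obtains U X where "open U" "x \<in> U" "U \<subseteq> fst c" "\<And>i. i < d \<Longrightarrow> form_section A U (X i)"
    "\<And>y. y \<in> U \<Longrightarrow> inj_on (\<lambda>i. X i y) {..<d} \<and> independent ((\<lambda>i. X i y) ` {..<d})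
      \<and> fib (W_tilde A D) y = span ((\<lambda>i. X i y) ` {..<d})"
    "\<And>y. y \<in> U \<Longrightarrow> dim (kernel_all c (snd c y)) = d"
proof -
  interpret eq: analytic_bundle_equations "snd c ` fst c" "conn c" "flat_symmetric_rows c"
    by (rule bundle_equations[OF c(1)])
  let ?p = "snd c x"
  have p: "?p \<in> snd c ` fst c" using c by auto
  obtain r where r: "r > 0" "ball ?p r \<subseteq> snd c ` fst c"
    and rank: "\<And>q. q \<in> ball ?p r \<Longrightarrow> dim (rows_at eq.all_rows q) \<le> dim (rows_at eq.all_rows ?p)"
    using eq.rank_upper_semicontinuous[OF p] by blast
  have smooth: "smooth_on (ball ?p r) g" if "g \<in> eq.all_rows" for g
    by (rule smooth_on_subset[OF eq.smooth_rows[OF that] r(2)])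
  have "?p \<in> ball ?p r" using r(1) by simp
  from smooth_frame_of_kernel[OF open_ball this smooth rank, folded d]
  obtain T \<xi> where T: "open T" "?p \<in> T" "T \<subseteq> ball ?p r" and \<xi>: "\<And>i. i < d \<Longrightarrow> smooth_on T (\<xi> i)"
    and ind: "\<And>q. q \<in> T \<Longrightarrow> independent_family d (\<lambda>i. \<xi> i q)"
    and span: "\<And>q. q \<in> T \<Longrightarrow> span ((\<lambda>i. \<xi> i q) ` {..<d}) = kernel_all c q"
    by blast
  define U where "U = {y \<in> fst c. snd c y \<in> T}"
  have U: "open U" "U \<subseteq> fst c" "x \<in> U"
    using chart_preimage_open[OF c(1) T(1)] c(2) T(2) by (auto simp: U_def)
  have UT: "snd c ` U \<subseteq> T" by (auto simp: U_def)
  define X where "X i y = coord_form A c (\<xi> i (snd c y)) y" for i y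
  have "form_section A U (X i)" if i: "i < d" for i
    unfolding X_def
  proof (rule coord_form_section[OF c(1) U(1,2) smooth_on_subset[OF \<xi>[OF i] UT]])
    fix y assume y: "y \<in> U"
    then have "\<xi> i (snd c y) \<in> kernel_all c (snd c y)"
      using span[of "snd c y", symmetric] i by (auto simp: U_def intro: span_base)
    then have "\<xi> i (snd c y) \<in> kernel_at (flat_symmetric_rows c) (snd c y)"
      using kernel_all_subset[OF c(1)] by blast
    then show "transpose (\<xi> i (snd c y)) = \<xi> i (snd c y)"
      using kernel_flat_symmetric_rows[OF c(1)] y U(2) by blast
  qed
  moreover have "inj_on (\<lambda>i. X i y) {..<d} \<and> independent ((\<lambda>i. X i y) ` {..<d})
      \<and> fib (W_tilde A D) y = span ((\<lambda>i. X i y) ` {..<d})" if y: "y \<in> U" for y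
  proof -
    have yc: "y \<in> fst c" and yT: "snd c y \<in> T" using y by (auto simp: U_def)
    let ?L = "\<lambda>m. coord_form A c m y"
    have inj: "inj ?L"
      by (rule injI) (metis coord_form_self[OF c(1) yc])
    have im: "(\<lambda>i. X i y) ` {..<d} = ?L ` ((\<lambda>i. \<xi> i (snd c y)) ` {..<d})" by (auto simp: X_def)
    have "inj_on (\<lambda>i. \<xi> i (snd c y)) {..<d}" "independent ((\<lambda>i. \<xi> i (snd c y)) ` {..<d})"
      using ind[OF yT] by (auto simp: independent_family_iff)
    then have "inj_on (\<lambda>i. X i y) {..<d}"
      using inj unfolding X_def by (auto simp: inj_on_def)
    moreover have "independent ((\<lambda>i. X i y) ` {..<d})"
      unfolding im
      by (rule linear_independent_injective_image[OF linear_coord_form \<open>independent _\<close> inj_on_subset[OF inj]]) simp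
    moreover have "span ((\<lambda>i. X i y) ` {..<d}) = fib (W_tilde A D) y"
      unfolding im linear_span_image[OF linear_coord_form] span[OF yT] coord_form_kernel[OF c(1) yc]
      by (rule fib_W_tilde[OF c(1) yc, symmetric])
    ultimately show ?thesis by simp
  qed
  moreover have "dim (kernel_all c (snd c y)) = d" if "y \<in> U" for y
  proof -
    have yT: "snd c y \<in> T" using that by (auto simp: U_def)
    have "inj_on (\<lambda>i. \<xi> i (snd c y)) {..<d}" "independent ((\<lambda>i. \<xi> i (snd c y)) ` {..<d})"
      using ind[OF yT] by (auto simp: independent_family_iff)
    then have "dim ((\<lambda>i. \<xi> i (snd c y)) ` {..<d}) = d"
      by (simp add: dim_eq_card_independent card_image)
    then show ?thesis unfolding span[OF yT, symmetric] by simp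
  qed
  ultimately show thesis using that[OF U(1,3,2)] by blast
qed

lemma W_tilde_vector_bundle:
  assumes "connected (UNIV :: 'm set)"
  shows "is_vector_bundle A (W_tilde A D)"
proof -
  define ch where "ch x = (SOME c. c \<in> A \<and> x \<in> fst c)" for x
  have ch: "ch x \<in> A" "x \<in> fst (ch x)" for x
    using someI_ex[of "\<lambda>c. c \<in> A \<and> x \<in> fst c"] chart_exists[of x] unfolding ch_def by blast+
  define \<rho> where "\<rho> x = dim (kernel_all (ch x) (snd (ch x) x))" for x
  have \<rho>: "dim (kernel_all c (snd c x)) = \<rho> x" if "c \<in> A" "x \<in> fst c" for c x
    unfolding \<rho>_def by (rule dim_kernel_chart_independent[OF that ch])
  have "eventually (\<lambda>y. \<rho> x = \<rho> y) (at x within UNIV)" for x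
  proof -
    obtain U where U: "open U" "x \<in> U" "U \<subseteq> fst (ch x)"
      and dim: "\<And>y. y \<in> U \<Longrightarrow> dim (kernel_all (ch x) (snd (ch x) y)) = \<rho> x"
      by (rule local_frame[OF ch(1) ch(2) \<rho>_def[of x]]) blast
    then have "\<rho> x = \<rho> y" if "y \<in> U" for y using \<rho>[OF ch(1)[of x], of y] that by auto
    then show ?thesis unfolding eventually_at_topological using U by blast
  qed
  then have const: "\<rho> x = \<rho> y" for x y
    using connected_local_const[OF assms, of x y \<rho>] by blast
  \<comment> \<open>\<open>undefined\<close> is an arbitrary point of the manifold.\<close>
  define r where "r = \<rho> undefined"
  have "\<exists>U X. x \<in> U \<and> open U \<and> (\<forall>i<r. form_section A U (X i)) \<and>
      (\<forall>y\<in>U. inj_on (\<lambda>i. X i y) {..<r} \<and> independent ((\<lambda>i. X i y) ` {..<r}) \<and>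
        fib (W_tilde A D) y = span ((\<lambda>i. X i y) ` {..<r}))" for x
  proof -
    have d: "r = dim (kernel_all (ch x) (snd (ch x) x))"
      using const[of x undefined] by (simp add: r_def \<rho>_def)
    show ?thesis
      by (rule local_frame[OF ch(1)[of x] ch(2)[of x] d]) blast
  qed
  then show ?thesis unfolding is_vector_bundle_def by blast
qed

end

theorem lemma19:
  fixes A :: "('m::{t2_space, second_countable_topology}, 'n::finite) chart set"
    and D :: "('m, 'n) cov_deriv"
  assumes "connected (UNIV :: 'm set)"
    and "analytic_atlas A"
    and "analytic_connection A D"
  shows "is_vector_bundle A (W_tilde A D)"
proof -
  interpret atlas_connection A D
    by unfold_locales (use assms in auto)
  show ?thesis by (rule W_tilde_vector_bundle[OF assms(1)])
qed

end
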